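(* Let $\mathcal S$ be a finite simplicial poset of rank $n$ with vertex set $[m]=\{1,\ldots,m\}$, and let $t_i=\lambda_{i1}v_1+\cdots+\lambda_{im}v_m$, $i=1,\ldots,n$, be a sequence of linear (degree-two) elements of $\mathbb Z[\mathcal S]$, with $\lambda_{ij}\in\mathbb Z$. Let $\Lambda=(\lambda_{ij})$ be the corresponding $n\times m$ matrix, for $\sigma\in\mathcal S$ let $\Lambda_\sigma$ be the $n\times|\sigma|$ submatrix formed by the $\lambda_{ij}$ with $j\in V(\sigma)$, and let $T_\Lambda=\ker(\lambda\colon T^m\to T^n)$, where $\lambda$ is the homomorphism of tori defined by $\Lambda$. The following conditions are equivalent: (a) the sequence $t_1,\ldots,t_n$ is an lsop in the rational face ring $\mathbb Q[\mathcal S]$; (b) for every $\sigma\in\mathcal S$ the matrix $\Lambda_\sigma$ has rank $|\sigma|$; (c) $T_\Lambda$ is the product of an $(m-n)$-torus and a finite group, and $T_\Lambda$ acts almost freely on the moment-angle complex $\mathcal Z_{\mathcal S}$.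
   Context: Simplicial posets. A finite poset $\mathcal S$ is simplicial if it has an initial element $\hat 0$ and for each $\sigma\in\mathcal S$ the lower segment $[\hat 0,\sigma]$ is a boolean lattice (the face poset of a simplex). The rank $|\sigma|$ equals $k$ if $[\hat 0,\sigma]$ is the face poset of a $(k-1)$-dimensional simplex; the rank of $\mathcal S$ is the maximum of the ranks of its elements. Vertices are the elements of rank one, identified with $[m]=\{1,\ldots,m\}$; $V(\sigma)=\{i\in[m]: i\le\sigma\}$. For $\sigma,\tau\in\mathcal S$, $\sigma\vee\tau$ denotes the set of their least (i.e. minimal) common upper bounds, and $\sigma\wedge\tau$ the set of their greatest common lower bounds, which is a single element whenever $\sigma\vee\tau\neq\varnothing$. Face ring. For $R=\mathbb Z$ or $\mathbb Q$, $R[\mathcal S]=R[v_\sigma:\sigma\in\mathcal S]/\mathcal I_{\mathcal S}$, where $\deg v_\sigma=2|\sigma|$ and $\mathcal I_{\mathcal S}$ is generated by $v_{\hat 0}-1$ and all elements $v_\sigma v_\tau-v_{\sigma\wedge\tau}\cdot\sum_{\eta\in\sigma\vee\tau}v_\eta$ (the empty sum is zero, so $v_\sigma v_\tau=0$ if $\sigma\vee\tau=\varnothing$). Lsop. With $n$ the rank of $\mathcal S$, a sequence $t_1,\ldots,t_n$ of degree-two elements is an lsop (linear system of parameters) in $R[\mathcal S]$ if $t_1,\ldots,t_n$ are algebraically independent and $R[\mathcal S]$ is a finitely generated $R[t_1,\ldots,t_n]$-module. Moment-angle complex. Let $D^2\subset\mathbb C$ be the closed unit disc. For $\sigma\in\mathcal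 S$ let $B_\sigma=\{(z_1,\ldots,z_m)\in(D^2)^m: |z_j|=1\text{ if }j\not\le\sigma\}$; then $B_\tau\subset B_\sigma$ when $\tau\le\sigma$. $\mathcal Z_{\mathcal S}$ is the colimit in topological spaces of the diagram $\sigma\mapsto B_\sigma$ of these inclusions, indexed by the poset $\mathcal S$ viewed as a category. The coordinatewise action of $T^m=(S^1)^m$ on $(D^2)^m$ preserves each $B_\sigma$ and induces a $T^m$-action on $\mathcal Z_{\mathcal S}$. The homomorphism $\lambda\colon T^m\to T^n$ is the one induced by $\Lambda\colon\mathbb Z^m\to\mathbb Z^n$: $\lambda(z_1,\ldots,z_m)_i=\prod_{j}z_j^{\lambda_{ij}}$. An action is almost free if all its isotropy subgroups are finite. *)

theory Defs
  imports
    "HOL-Analysis.Analysis"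
    "HOL-Library.Poly_Mapping"
    "HOL-Algebra.Algebra"
    "HOL-Algebra.Group_Action"
    "HOL-Algebra.Product_Groups"
    "Jordan_Normal_Form.DL_Rank"
    "Jordan_Normal_Form.DL_Submatrix"
begin

section \<open>Simplicial posets\<close>

text \<open>A finite poset with initial element is a type \<open>'a\<close> of sort \<open>{finite, order_bot}\<close>; the
  initial element is \<open>bot\<close>. The face poset of a \<open>(k - 1)\<close>-simplex, empty face included, is
  the power set of a \<open>k\<close>-element set.\<close>

definition segment_is_simplex :: "'a::order_bot \<Rightarrow> nat \<Rightarrow> bool" where
  "segment_is_simplex \<sigma> k \<longleftrightarrow>
     (\<exists>f. bij_betw f {bot..\<sigma>} (Pow {..<k}) \<and>
          (\<forall>x\<in>{bot..\<sigma>}. \<forall>y\<in>{bot..\<sigma>}. x \<le> y \<longleftrightarrow> f x \<subseteq> f y))"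

definition simplicial_poset :: "'a::{finite,order_bot} itself \<Rightarrow> bool" where
  "simplicial_poset TYPE('a) \<longleftrightarrow> (\<forall>\<sigma>::'a. \<exists>k. segment_is_simplex \<sigma> k)"

definition face_rank :: "'a::order_bot \<Rightarrow> nat" where
  "face_rank \<sigma> = (THE k. segment_is_simplex \<sigma> k)"

definition poset_rank :: "'a::{finite,order_bot} itself \<Rightarrow> nat" where
  "poset_rank TYPE('a) = Max (range (face_rank :: 'a \<Rightarrow> nat))"

text \<open>Vertices are numbered by \<open>{..<m}\<close> rather than by \<open>{1..m}\<close>, to agree with the 0-based
  indexing of matrices.\<close>

definition vertex_numbering :: "nat \<Rightarrow> (nat \<Rightarrow> 'a::order_bot) \<Rightarrow> bool" where
  "vertex_numbering m vert \<longleftrightarrow> bij_betw vert {..<m} {\<sigma>. face_rank \<sigma> = 1}"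

definition vertices_of :: "nat \<Rightarrow> (nat \<Rightarrow> 'a::order_bot) \<Rightarrow> 'a \<Rightarrow> nat set" where
  "vertices_of m vert \<sigma> = {j. j < m \<and> vert j \<le> \<sigma>}"

definition joins :: "'a::order \<Rightarrow> 'a \<Rightarrow> 'a set" where
  "joins \<sigma> \<tau> = {\<eta>. \<sigma> \<le> \<eta> \<and> \<tau> \<le> \<eta> \<and> (\<forall>\<rho>. \<sigma> \<le> \<rho> \<and> \<tau> \<le> \<rho> \<and> \<rho> \<le> \<eta> \<longrightarrow> \<rho> = \<eta>)}"

definition meets :: "'a::order \<Rightarrow> 'a \<Rightarrow> 'a set" where
  "meets \<sigma> \<tau> = {\<eta>. \<eta> \<le> \<sigma> \<and> \<eta> \<le> \<tau> \<and> (\<forall>\<rho>. \<rho> \<le> \<sigma> \<and> \<rho> \<le> \<tau> \<and> \<eta> \<le> \<rho> \<longrightarrow> \<rho> = \<eta>)}"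

lemma segment_is_simplex_unique:
  assumes "segment_is_simplex \<sigma> k" "segment_is_simplex \<sigma> l"
  shows "k = l"
proof -
  have c: "card {bot..\<sigma>} = 2 ^ j" if "segment_is_simplex \<sigma> j" for j
    using that unfolding segment_is_simplex_def
    by (auto dest!: bij_betw_same_card simp: card_Pow)
  show ?thesis
    using c[OF assms(1)] c[OF assms(2)] by simp
qed

lemma face_rank_eq: "segment_is_simplex \<sigma> k \<Longrightarrow> face_rank \<sigma> = k"
  unfolding face_rank_def using segment_is_simplex_unique by blast


section \<open>The face ring\<close>

text \<open>Polynomials over \<open>'r\<close> in variables of type \<open>'x\<close>: finitely supported maps from exponent
  vectors \<open>'x \<Rightarrow>\<^sub>0 nat\<close> to coefficients, with the convolution product.\<close>

type_synonym ('x, 'r) mpoly = "('x \<Rightarrow>\<^sub>0 nat) \<Rightarrow>\<^sub>0 'r"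

definition PConst :: "'r::zero \<Rightarrow> ('x, 'r) mpoly" where
  "PConst c = Poly_Mapping.single 0 c"

definition PVar :: "'x \<Rightarrow> ('x, 'r::zero_neq_one) mpoly" where
  "PVar x = Poly_Mapping.single (Poly_Mapping.single x 1) 1"

text \<open>When \<open>joins \<sigma> \<tau>\<close> is nonempty, \<open>meets \<sigma> \<tau>\<close> is a singleton; otherwise its
  (arbitrary) \<open>the_elem\<close> is multiplied by an empty sum.\<close>

definition face_relations :: "('a::{finite,order_bot}, 'r::comm_ring_1) mpoly set" where
  "face_relations =
     {PVar bot - 1} \<union>
     {PVar \<sigma> * PVar \<tau> - PVar (the_elem (meets \<sigma> \<tau>)) * (\<Sum>\<eta>\<in>joins \<sigma> \<tau>. PVar \<eta>) | \<sigma> \<tau>. True}"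

definition face_ideal :: "('a::{finite,order_bot}, 'r::comm_ring_1) mpoly set" where
  "face_ideal = genideal class_ring face_relations"

definition face_ring :: "('a::{finite,order_bot}, 'r::comm_ring_1) mpoly set ring" where
  "face_ring = class_ring Quot face_ideal"

definition face_class ::
    "('a::{finite,order_bot}, 'r::comm_ring_1) mpoly \<Rightarrow> ('a, 'r) mpoly set" where
  "face_class p = a_r_coset class_ring face_ideal p"

definition face_weight :: "('a::order_bot \<Rightarrow>\<^sub>0 nat) \<Rightarrow> nat" where
  "face_weight e = (\<Sum>\<sigma>\<in>Poly_Mapping.keys e. Poly_Mapping.lookup e \<sigma> * (2 * face_rank \<sigma>))"

definition face_ring_part ::
    "nat \<Rightarrow> ('a::{finite,order_bot}, 'r::comm_ring_1) mpoly set set" where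
  "face_ring_part d = {face_class p | p. \<forall>e\<in>Poly_Mapping.keys p. face_weight e = d}"

text \<open>The element \<open>\<Sum>\<^sub>j \<lambda>\<^sub>i\<^sub>j v\<^sub>j\<close> of \<open>'r[S]\<close>; over the rationals it is the image of the
  corresponding element of the integral face ring.\<close>

definition linear_element ::
    "(nat \<Rightarrow> 'a) \<Rightarrow> int mat \<Rightarrow> nat \<Rightarrow> ('a::{finite,order_bot}, 'r::comm_ring_1) mpoly set" where
  "linear_element vert \<Lambda> i =
     face_class (\<Sum>j<dim_col \<Lambda>. PConst (of_int (\<Lambda> $$ (i, j))) * PVar (vert j))"

lemma class_ring_is_cring: "cring (class_ring :: 'b::comm_ring_1 ring)"
  by (rule class_cring.is_cring)

lemma face_ideal_ideal:
  "ideal (face_ideal :: ('a::{finite,order_bot}, 'r::comm_ring_1) mpoly set) class_ring"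
  unfolding face_ideal_def
  by (rule ring.genideal_ideal[OF cring.axioms(1)[OF class_ring_is_cring]]) simp

lemma face_ring_is_cring:
  "cring (face_ring :: ('a::{finite,order_bot}, 'r::comm_ring_1) mpoly set ring)"
  unfolding face_ring_def
  by (rule ideal.quotient_is_cring[OF face_ideal_ideal class_ring_is_cring])

lemma face_class_hom:
  "face_class \<in> Ring.ring_hom class_ring
     (face_ring :: ('a::{finite,order_bot}, 'r::comm_ring_1) mpoly set ring)"
  using ideal.rcos_ring_hom[OF face_ideal_ideal]
  unfolding face_ring_def face_class_def by simp


section \<open>Linear systems of parameters\<close>

text \<open>Value of a polynomial in \<open>x\<^sub>0, x\<^sub>1, \<dots>\<close> at a sequence of elements of \<open>'r[S]\<close>.\<close>

definition face_eval ::
    "(nat \<Rightarrow> ('a, 'r) mpoly set) \<Rightarrow> (nat, 'r) mpoly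
      \<Rightarrow> ('a::{finite,order_bot}, 'r::comm_ring_1) mpoly set" where
  "face_eval t p =
     (\<Oplus>\<^bsub>face_ring\<^esub>e\<in>Poly_Mapping.keys p.
        face_class (PConst (Poly_Mapping.lookup p e)) \<otimes>\<^bsub>face_ring\<^esub>
        (\<Otimes>\<^bsub>face_ring\<^esub>i\<in>Poly_Mapping.keys e. t i [^]\<^bsub>face_ring\<^esub> Poly_Mapping.lookup e i))"

definition polys_in :: "nat \<Rightarrow> (nat, 'r::zero) mpoly set" where
  "polys_in n = {p. \<forall>e\<in>Poly_Mapping.keys p. Poly_Mapping.keys e \<subseteq> {..<n}}"

definition algebraically_independent ::
    "nat \<Rightarrow> (nat \<Rightarrow> ('a::{finite,order_bot}, 'r::comm_ring_1) mpoly set) \<Rightarrow> bool" where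
  "algebraically_independent n t \<longleftrightarrow>
     (\<forall>p\<in>polys_in n. face_eval t p = \<zero>\<^bsub>face_ring\<^esub> \<longrightarrow> p = 0)"

definition finite_over ::
    "nat \<Rightarrow> (nat \<Rightarrow> ('a::{finite,order_bot}, 'r::comm_ring_1) mpoly set) \<Rightarrow> bool" where
  "finite_over n t \<longleftrightarrow>
     (\<exists>us. set us \<subseteq> carrier face_ring \<and>
           ring.Span face_ring (face_eval t ` polys_in n) us = carrier face_ring)"

definition lsop ::
    "nat \<Rightarrow> (nat \<Rightarrow> ('a::{finite,order_bot}, 'r::comm_ring_1) mpoly set) \<Rightarrow> bool" where
  "lsop n t \<longleftrightarrow>
     n = poset_rank TYPE('a) \<and> (\<forall>i<n. t i \<in> face_ring_part 2) \<and>
     algebraically_independent n t \<and> finite_over n t"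


section \<open>Tori\<close>

definition circle_group :: "complex monoid" where
  "circle_group = \<lparr>carrier = sphere 0 1, mult = (*), one = 1\<rparr>"

definition torus :: "nat \<Rightarrow> (nat \<Rightarrow> complex) monoid" where
  "torus k = product_group {..<k} (\<lambda>_. circle_group)"

definition torus_topology :: "nat \<Rightarrow> (nat \<Rightarrow> complex) topology" where
  "torus_topology k = product_topology (\<lambda>_. top_of_set (sphere 0 1)) {..<k}"

definition torus_hom :: "int mat \<Rightarrow> (nat \<Rightarrow> complex) \<Rightarrow> (nat \<Rightarrow> complex)" where
  "torus_hom \<Lambda> z = (\<lambda>i\<in>{..<dim_row \<Lambda>}. \<Prod>j<dim_col \<Lambda>. z j powi (\<Lambda> $$ (i, j)))"

definition torus_kernel :: "int mat \<Rightarrow> (nat \<Rightarrow> complex) set" where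
  "torus_kernel \<Lambda> = kernel (torus (dim_col \<Lambda>)) (torus (dim_row \<Lambda>)) (torus_hom \<Lambda>)"

definition torus_kernel_group :: "int mat \<Rightarrow> (nat \<Rightarrow> complex) monoid" where
  "torus_kernel_group \<Lambda> = (torus (dim_col \<Lambda>))\<lparr>carrier := torus_kernel \<Lambda>\<rparr>"

definition torus_kernel_topology :: "int mat \<Rightarrow> (nat \<Rightarrow> complex) topology" where
  "torus_kernel_topology \<Lambda> = subtopology (torus_topology (dim_col \<Lambda>)) (torus_kernel \<Lambda>)"

text \<open>Isomorphism of topological groups. The finite group \<open>F\<close> below is discrete; taking its
  carrier inside \<open>nat\<close> loses no generality.\<close>

definition top_group_isomorphic ::
    "'a monoid \<Rightarrow> 'a topology \<Rightarrow> 'b monoid \<Rightarrow> 'b topology \<Rightarrow> bool" where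
  "top_group_isomorphic G TG H TH \<longleftrightarrow> (\<exists>f. f \<in> iso G H \<and> homeomorphic_map TG TH f)"

definition torus_times_finite ::
    "nat \<Rightarrow> 'a monoid \<Rightarrow> 'a topology \<Rightarrow> bool" where
  "torus_times_finite k G TG \<longleftrightarrow>
     (\<exists>F :: nat monoid. group F \<and> finite (carrier F) \<and>
        top_group_isomorphic (torus k \<times>\<times> F)
          (prod_topology (torus_topology k) (discrete_topology (carrier F))) G TG)"


section \<open>The moment-angle complex\<close>

definition ma_block :: "nat \<Rightarrow> (nat \<Rightarrow> 'a::order) \<Rightarrow> 'a \<Rightarrow> (nat \<Rightarrow> complex) set" where
  "ma_block m vert \<sigma> =
     {z \<in> (\<Pi>\<^sub>E j\<in>{..<m}. cball 0 1). \<forall>j<m. \<not> vert j \<le> \<sigma> \<longrightarrow> norm (z j) = 1}"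

definition ma_block_topology :: "nat \<Rightarrow> (nat \<Rightarrow> 'a::order) \<Rightarrow> 'a \<Rightarrow> (nat \<Rightarrow> complex) topology" where
  "ma_block_topology m vert \<sigma> =
     subtopology (product_topology (\<lambda>_. top_of_set (cball 0 1)) {..<m}) (ma_block m vert \<sigma>)"

text \<open>The colimit: disjoint union of the blocks modulo the equivalence relation generated by
  identifying \<open>z\<close> in the block of \<open>\<tau>\<close> with \<open>z\<close> in the block of \<open>\<sigma>\<close> for \<open>\<tau> \<le> \<sigma>\<close>, with the
  quotient topology. Points of the colimit are equivalence classes.\<close>

definition ma_sum :: "nat \<Rightarrow> (nat \<Rightarrow> 'a::order) \<Rightarrow> ('a \<times> (nat \<Rightarrow> complex)) topology" where
  "ma_sum m vert = sum_topology (ma_block_topology m vert) UNIV"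

definition ma_glue ::
    "nat \<Rightarrow> (nat \<Rightarrow> 'a::order) \<Rightarrow> (('a \<times> (nat \<Rightarrow> complex)) \<times> ('a \<times> (nat \<Rightarrow> complex))) set" where
  "ma_glue m vert = {((\<tau>, z), (\<sigma>, z)) | \<tau> \<sigma> z. \<tau> \<le> \<sigma> \<and> z \<in> ma_block m vert \<tau>}"

definition ma_equiv ::
    "nat \<Rightarrow> (nat \<Rightarrow> 'a::order) \<Rightarrow> (('a \<times> (nat \<Rightarrow> complex)) \<times> ('a \<times> (nat \<Rightarrow> complex))) set" where
  "ma_equiv m vert =
     (ma_glue m vert \<union> (ma_glue m vert)\<inverse>)\<^sup>* \<inter> (topspace (ma_sum m vert) \<times> topspace (ma_sum m vert))"

definition ma_points :: "nat \<Rightarrow> (nat \<Rightarrow> 'a::order) \<Rightarrow> ('a \<times> (nat \<Rightarrow> complex)) set set" where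
  "ma_points m vert = topspace (ma_sum m vert) // ma_equiv m vert"

definition moment_angle_complex ::
    "nat \<Rightarrow> (nat \<Rightarrow> 'a::order) \<Rightarrow> ('a \<times> (nat \<Rightarrow> complex)) set topology" where
  "moment_angle_complex m vert =
     topology (\<lambda>U. U \<subseteq> ma_points m vert \<and> openin (ma_sum m vert) (\<Union>U))"

definition torus_action ::
    "nat \<Rightarrow> (nat \<Rightarrow> 'a::order) \<Rightarrow> (nat \<Rightarrow> complex)
      \<Rightarrow> ('a \<times> (nat \<Rightarrow> complex)) set \<Rightarrow> ('a \<times> (nat \<Rightarrow> complex)) set" where
  "torus_action m vert g =
     (\<lambda>x\<in>topspace (moment_angle_complex m vert).
        (\<lambda>(\<sigma>, z). (\<sigma>, \<lambda>j\<in>{..<m}. g j * z j)) ` x)"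

definition almost_free :: "('g, 'c) monoid_scheme \<Rightarrow> 'b set \<Rightarrow> ('g \<Rightarrow> 'b \<Rightarrow> 'b) \<Rightarrow> bool" where
  "almost_free G E \<phi> \<longleftrightarrow> (\<forall>x\<in>E. finite (stabilizer G \<phi> x))"

lemma topspace_ma_block [simp]: "topspace (ma_block_topology m vert \<sigma>) = ma_block m vert \<sigma>"
  by (auto simp: ma_block_topology_def ma_block_def)

lemma topspace_ma_sum: "topspace (ma_sum m vert) = Sigma UNIV (ma_block m vert)"
  by (simp add: ma_sum_def comp_def)

lemma ma_block_mono:
  assumes "\<tau> \<le> \<sigma>" shows "ma_block m vert \<tau> \<subseteq> ma_block m vert \<sigma>"
  using assms by (auto simp: ma_block_def dest: order_trans)


lemma ma_equiv_equiv: "equiv (topspace (ma_sum m vert)) (ma_equiv m vert)"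
proof (rule equivI)
  show "ma_equiv m vert \<subseteq> topspace (ma_sum m vert) \<times> topspace (ma_sum m vert)"
    unfolding ma_equiv_def by (rule Int_lower2)
  show "refl_on (topspace (ma_sum m vert)) (ma_equiv m vert)"
    unfolding ma_equiv_def by (rule refl_onI) simp
  have "sym (topspace (ma_sum m vert) \<times> topspace (ma_sum m vert))"
    by (rule symI) blast
  thus "sym (ma_equiv m vert)"
    unfolding ma_equiv_def by (intro sym_Int sym_rtrancl sym_Un_converse)
  have "trans (topspace (ma_sum m vert) \<times> topspace (ma_sum m vert))"
    by (rule transI) blast
  thus "trans (ma_equiv m vert)"
    unfolding ma_equiv_def by (intro trans_Int trans_rtrancl)
qed

lemma Union_ma_points: "\<Union>(ma_points m vert) = topspace (ma_sum m vert)"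
  unfolding ma_points_def by (rule Union_quotient[OF ma_equiv_equiv])

lemma istopology_moment_angle_complex:
  "istopology (\<lambda>U. U \<subseteq> ma_points m vert \<and> openin (ma_sum m vert) (\<Union>U))"
  unfolding istopology_def
proof (intro conjI allI impI)
  fix S T
  assume S: "S \<subseteq> ma_points m vert \<and> openin (ma_sum m vert) (\<Union>S)"
    and T: "T \<subseteq> ma_points m vert \<and> openin (ma_sum m vert) (\<Union>T)"
  have "x = y" if "x \<in> S" "y \<in> T" "p \<in> x" "p \<in> y" for x y p
    using that S T quotient_disj[OF ma_equiv_equiv[of m vert], of x y]
    unfolding ma_points_def by blast
  hence "\<Union>(S \<inter> T) = \<Union>S \<inter> \<Union>T" by blast
  thus "openin (ma_sum m vert) (\<Union>(S \<inter> T))"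
    using S T by (simp add: openin_Int)
next
  fix \<K>
  assume K: "\<forall>K\<in>\<K>. K \<subseteq> ma_points m vert \<and> openin (ma_sum m vert) (\<Union>K)"
  thus "\<Union>\<K> \<subseteq> ma_points m vert" by blast
  have "\<Union>(\<Union>\<K>) = \<Union>(Union ` \<K>)" by blast
  thus "openin (ma_sum m vert) (\<Union>(\<Union>\<K>))"
    using K by (metis (no_types, lifting) image_iff openin_Union)
qed blast

lemma openin_moment_angle_complex:
  "openin (moment_angle_complex m vert) U \<longleftrightarrow>
     U \<subseteq> ma_points m vert \<and> openin (ma_sum m vert) (\<Union>U)"
  by (simp add: moment_angle_complex_def topology_inverse'[OF istopology_moment_angle_complex])

lemma topspace_moment_angle_complex [simp]:
  "topspace (moment_angle_complex m vert) = ma_points m vert"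
proof
  show "topspace (moment_angle_complex m vert) \<subseteq> ma_points m vert"
    using openin_topspace[of "moment_angle_complex m vert"] openin_moment_angle_complex by blast
  have "openin (moment_angle_complex m vert) (ma_points m vert)"
    by (simp add: openin_moment_angle_complex Union_ma_points)
  thus "ma_points m vert \<subseteq> topspace (moment_angle_complex m vert)"
    by (rule openin_subset)
qed

lemma quotient_map_moment_angle_complex:
  "quotient_map (ma_sum m vert) (moment_angle_complex m vert) (\<lambda>p. ma_equiv m vert `` {p})"
proof -
  have img: "(\<lambda>p. ma_equiv m vert `` {p}) ` topspace (ma_sum m vert) = ma_points m vert"
    by (auto simp: ma_points_def quotient_def)
  have pre: "{p \<in> topspace (ma_sum m vert). ma_equiv m vert `` {p} \<in> U} = \<Union>U"
    if U: "U \<subseteq> ma_points m vert" for U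
  proof (intro subset_antisym subsetI)
    fix p assume "p \<in> {p \<in> topspace (ma_sum m vert). ma_equiv m vert `` {p} \<in> U}"
    thus "p \<in> \<Union>U" using equiv_class_self[OF ma_equiv_equiv, of p m vert] by blast
  next
    fix p assume "p \<in> \<Union>U"
    then obtain x where x: "x \<in> U" "p \<in> x" by blast
    then obtain q where q: "q \<in> topspace (ma_sum m vert)" "x = ma_equiv m vert `` {q}"
      using U unfolding ma_points_def by (meson quotientE subsetD)
    hence "(q, p) \<in> ma_equiv m vert" using x by simp
    moreover from this have "ma_equiv m vert `` {p} = x"
      using q(2) equiv_class_eq[OF ma_equiv_equiv] by metis
    moreover have "p \<in> topspace (ma_sum m vert)"
      using calculation(1) unfolding ma_equiv_def by blast
    ultimately show "p \<in> {p \<in> topspace (ma_sum m vert). ma_equiv m vert `` {p} \<in> U}"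
      using x by simp
  qed
  show ?thesis
    unfolding quotient_map_def topspace_moment_angle_complex
  proof (intro conjI allI impI)
    fix U assume U: "U \<subseteq> ma_points m vert"
    show "openin (ma_sum m vert) {p \<in> topspace (ma_sum m vert). ma_equiv m vert `` {p} \<in> U}
            \<longleftrightarrow> openin (moment_angle_complex m vert) U"
      using U unfolding pre[OF U] openin_moment_angle_complex by simp
  qed (rule img)
qed

text \<open>The coordinatewise action is compatible with the gluing, so it is an action on the colimit.\<close>

definition block_action ::
    "nat \<Rightarrow> (nat \<Rightarrow> complex) \<Rightarrow> 'a \<times> (nat \<Rightarrow> complex) \<Rightarrow> 'a \<times> (nat \<Rightarrow> complex)" where
  "block_action m g = (\<lambda>(\<sigma>, z). (\<sigma>, \<lambda>j\<in>{..<m}. g j * z j))"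

lemma circle_group_group: "group circle_group"
proof (rule groupI)
  fix x assume x: "x \<in> carrier circle_group"
  hence "x \<noteq> 0" by (auto simp: circle_group_def)
  hence "inverse x \<otimes>\<^bsub>circle_group\<^esub> x = \<one>\<^bsub>circle_group\<^esub>"
    by (simp add: circle_group_def)
  moreover have "inverse x \<in> carrier circle_group"
    using x by (simp add: circle_group_def norm_inverse)
  ultimately show "\<exists>y\<in>carrier circle_group. y \<otimes>\<^bsub>circle_group\<^esub> x = \<one>\<^bsub>circle_group\<^esub>"
    by blast
qed (simp_all add: circle_group_def norm_mult mult.assoc)

lemma torus_group: "group (torus m)"
  unfolding torus_def by (rule product_group) (rule circle_group_group)

lemma torus_norm:
  assumes "g \<in> carrier (torus m)" "j < m" shows "norm (g j) = 1"
proof -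
  have "g j \<in> carrier circle_group"
    using assms unfolding torus_def carrier_product_group by (auto dest: PiE_mem)
  thus ?thesis by (simp add: circle_group_def)
qed

lemma block_action_block:
  assumes "g \<in> carrier (torus m)" "z \<in> ma_block m vert \<sigma>"
  shows "(\<lambda>j\<in>{..<m}. g j * z j) \<in> ma_block m vert \<sigma>"
proof -
  have n: "norm (g j * z j) = norm (z j)" if "j < m" for j
    using torus_norm[OF assms(1) that] by (simp add: norm_mult)
  have z: "norm (z j) \<le> 1" if "j < m" for j
    using assms(2) that unfolding ma_block_def by (simp add: PiE_iff)
  have "(\<lambda>j\<in>{..<m}. g j * z j) \<in> (\<Pi>\<^sub>E j\<in>{..<m}. cball 0 1)"
    using n z by (intro restrict_PiE_iff[THEN iffD2] ballI) simp
  thus ?thesis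
    using assms(2) n unfolding ma_block_def by simp
qed

lemma block_action_topspace:
  "g \<in> carrier (torus m) \<Longrightarrow> p \<in> topspace (ma_sum m vert) \<Longrightarrow>
     block_action m g p \<in> topspace (ma_sum m vert)"
  by (cases p) (simp add: topspace_ma_sum block_action_def block_action_block)

lemma block_action_glue:
  assumes g: "g \<in> carrier (torus m)" and "(p, q) \<in> ma_glue m vert"
  shows "(block_action m g p, block_action m g q) \<in> ma_glue m vert"
proof -
  obtain \<tau> \<sigma> z where "p = (\<tau>, z)" "q = (\<sigma>, z)" "\<tau> \<le> \<sigma>" "z \<in> ma_block m vert \<tau>"
    using assms(2) unfolding ma_glue_def by blast
  thus ?thesis
    using block_action_block[OF g] unfolding ma_glue_def block_action_def by simp
qed

lemma block_action_equiv:
  assumes g: "g \<in> carrier (torus m)" and "(p, q) \<in> ma_equiv m vert"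
  shows "(block_action m g p, block_action m g q) \<in> ma_equiv m vert"
proof -
  have "(p, q) \<in> (ma_glue m vert \<union> (ma_glue m vert)\<inverse>)\<^sup>*"
    using assms(2) by (simp add: ma_equiv_def)
  hence "(block_action m g p, block_action m g q) \<in> (ma_glue m vert \<union> (ma_glue m vert)\<inverse>)\<^sup>*"
  proof induction
    case (step y z)
    hence "(block_action m g y, block_action m g z) \<in> ma_glue m vert \<union> (ma_glue m vert)\<inverse>"
      using block_action_glue[OF g, of y z vert] block_action_glue[OF g, of z y vert] by blast
    with step.IH show ?case by (rule rtrancl_into_rtrancl)
  qed simp
  thus ?thesis
    using assms(2) block_action_topspace[OF g, of p vert] block_action_topspace[OF g, of q vert]
    by (simp add: ma_equiv_def)
qed

lemma block_action_mult:
  "block_action m (g \<otimes>\<^bsub>torus m\<^esub> h) p = block_action m g (block_action m h p)"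
  unfolding block_action_def torus_def mult_product_group circle_group_def
  by (cases p) (simp add: fun_eq_iff mult.assoc)

lemma block_action_one:
  assumes "p \<in> topspace (ma_sum m vert)"
  shows "block_action m (\<one>\<^bsub>torus m\<^esub>) p = p"
proof -
  obtain \<sigma> z where p: "p = (\<sigma>, z)" by (cases p)
  hence "z \<in> (\<Pi>\<^sub>E j\<in>{..<m}. cball 0 1)"
    using assms unfolding topspace_ma_sum ma_block_def by blast
  hence "z \<in> extensional {..<m}" unfolding PiE_def by (rule IntD2)
  thus ?thesis
    unfolding p block_action_def torus_def one_product_group circle_group_def
    by (simp add: fun_eq_iff extensional_def)
qed

lemma block_action_class:
  assumes g: "g \<in> carrier (torus m)" and p: "p \<in> topspace (ma_sum m vert)"
  shows "block_action m g ` (ma_equiv m vert `` {p}) = ma_equiv m vert `` {block_action m g p}"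
proof (intro subset_antisym subsetI)
  fix q assume "q \<in> block_action m g ` (ma_equiv m vert `` {p})"
  then obtain r where "(p, r) \<in> ma_equiv m vert" "q = block_action m g r" by blast
  thus "q \<in> ma_equiv m vert `` {block_action m g p}"
    using block_action_equiv[OF g] by simp
next
  fix q assume "q \<in> ma_equiv m vert `` {block_action m g p}"
  hence q: "(block_action m g p, q) \<in> ma_equiv m vert" by simp
  interpret T: group "torus m" by (rule torus_group)
  let ?h = "inv\<^bsub>torus m\<^esub> g"
  have h: "?h \<in> carrier (torus m)" using g by simp
  have qt: "q \<in> topspace (ma_sum m vert)" using q by (simp add: ma_equiv_def)
  have "block_action m ?h (block_action m g p) = p"
    using block_action_mult[of m ?h g p] block_action_one[OF p] g by simp
  hence "(p, block_action m ?h q) \<in> ma_equiv m vert"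
    using block_action_equiv[OF h q] by simp
  moreover have "block_action m g (block_action m ?h q) = q"
    using block_action_mult[of m g ?h q] block_action_one[OF qt] g by simp
  ultimately show "q \<in> block_action m g ` (ma_equiv m vert `` {p})"
    by (metis Image_singleton_iff image_eqI)
qed

lemma torus_action_class:
  assumes "g \<in> carrier (torus m)" "p \<in> topspace (ma_sum m vert)"
  shows "torus_action m vert g (ma_equiv m vert `` {p}) = ma_equiv m vert `` {block_action m g p}"
proof -
  have "ma_equiv m vert `` {p} \<in> ma_points m vert"
    unfolding ma_points_def using assms(2) by (rule quotientI)
  thus ?thesis
    using block_action_class[OF assms]
    unfolding torus_action_def topspace_moment_angle_complex block_action_def by simp
qed

lemma torus_action_group_action:
  "group_action (torus m) (topspace (moment_angle_complex m vert)) (torus_action m vert)"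
proof -
  interpret T: group "torus m" by (rule torus_group)
  let ?E = "ma_points m vert" and ?a = "torus_action m vert"
  have cls: "\<exists>p\<in>topspace (ma_sum m vert). x = ma_equiv m vert `` {p}" if "x \<in> ?E" for x
    using that unfolding ma_points_def by (elim quotientE) blast
  have closed: "?a g x \<in> ?E" if g: "g \<in> carrier (torus m)" and x: "x \<in> ?E" for g x
  proof -
    obtain p where p: "p \<in> topspace (ma_sum m vert)" "x = ma_equiv m vert `` {p}"
      using cls[OF x] by blast
    have "block_action m g p \<in> topspace (ma_sum m vert)"
      by (rule block_action_topspace[OF g p(1)])
    thus ?thesis
      unfolding p(2) torus_action_class[OF g p(1)] ma_points_def by (rule quotientI)
  qed
  have mult: "?a (g \<otimes>\<^bsub>torus m\<^esub> h) x = ?a g (?a h x)"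
    if g: "g \<in> carrier (torus m)" and h: "h \<in> carrier (torus m)" and x: "x \<in> ?E" for g h x
  proof -
    obtain p where p: "p \<in> topspace (ma_sum m vert)" "x = ma_equiv m vert `` {p}"
      using cls[OF x] by blast
    show ?thesis
      unfolding p(2) torus_action_class[OF h p(1)] torus_action_class[OF T.m_closed[OF g h] p(1)]
        torus_action_class[OF g block_action_topspace[OF h p(1)]] block_action_mult ..
  qed
  have one: "?a \<one>\<^bsub>torus m\<^esub> x = x" if x: "x \<in> ?E" for x
  proof -
    obtain p where p: "p \<in> topspace (ma_sum m vert)" "x = ma_equiv m vert `` {p}"
      using cls[OF x] by blast
    show ?thesis
      unfolding p(2) torus_action_class[OF T.one_closed p(1)] block_action_one[OF p(1)] ..
  qed
  have bij: "?a g \<in> Bij ?E" if g: "g \<in> carrier (torus m)" for g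
  proof -
    have "bij_betw (?a g) ?E ?E"
    proof (rule bij_betw_byWitness[where f' = "?a (inv\<^bsub>torus m\<^esub> g)"])
      show "\<forall>x\<in>?E. ?a (inv\<^bsub>torus m\<^esub> g) (?a g x) = x"
        using g mult[of "inv\<^bsub>torus m\<^esub> g" g] one by simp
      show "\<forall>x\<in>?E. ?a g (?a (inv\<^bsub>torus m\<^esub> g) x) = x"
        using g mult[of g "inv\<^bsub>torus m\<^esub> g"] one by simp
      show "?a g ` ?E \<subseteq> ?E" using closed[OF g] by blast
      show "?a (inv\<^bsub>torus m\<^esub> g) ` ?E \<subseteq> ?E" using closed[OF T.inv_closed[OF g]] by blast
    qed
    moreover have "?a g \<in> extensional ?E"
      by (simp add: torus_action_def)
    ultimately show ?thesis by (simp add: Bij_def)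
  qed
  have "?a \<in> hom (torus m) (BijGroup ?E)"
  proof (rule homI)
    fix g h assume g: "g \<in> carrier (torus m)" and h: "h \<in> carrier (torus m)"
    show "?a (g \<otimes>\<^bsub>torus m\<^esub> h) = ?a g \<otimes>\<^bsub>BijGroup ?E\<^esub> ?a h"
    proof
      fix x
      show "?a (g \<otimes>\<^bsub>torus m\<^esub> h) x = (?a g \<otimes>\<^bsub>BijGroup ?E\<^esub> ?a h) x"
      proof (cases "x \<in> ?E")
        case True
        thus ?thesis
          using mult[OF g h True] bij[OF g] bij[OF h] by (simp add: BijGroup_def compose_def)
      next
        case False
        thus ?thesis
          using bij[OF g] bij[OF h] by (simp add: BijGroup_def compose_def torus_action_def)
      qed
    qed
  qed (use bij in \<open>simp add: BijGroup_def\<close>)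
  thus ?thesis
    by (simp add: group_action_def group_hom_def group_hom_axioms_def torus_group group_BijGroup)
qed

end

theory Submission
  imports Defs
begin

text \<open>All three conditions are compared with one: for every face \<open>\<sigma>\<close> the columns of \<open>\<Lambda>\<close> indexed by
  the vertices of \<open>\<sigma>\<close> satisfy no nontrivial integer relation. After clearing denominators this is
  the rank condition (b).

  The bridge to the face ring is restriction to a face. Below \<open>\<sigma>\<close> the poset is the power set of
  the vertices of \<open>\<sigma>\<close>, joins and meets being unions and intersections. Hence
  \<open>v\<^sub>\<tau> \<mapsto> \<Prod>\<^sub>j w\<^sub>j\<close> over the vertices of \<open>\<tau>\<close>, for \<open>\<tau> \<le> \<sigma>\<close>, and
  \<open>v\<^sub>\<tau> \<mapsto> 0\<close> otherwise respects the relations of the face ring, for any values \<open>w\<^sub>j\<close>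
  (\<open>face_value_relation\<close>).

  A system of parameters has independent columns: a relation \<open>w\<close> between the columns at \<open>\<sigma>\<close> gives
  the values \<open>w\<^sub>j x\<close> in \<open>\<rat>[x]\<close>, at which all \<open>t\<^sub>i\<close> vanish. Finitely many module generators over
  \<open>\<rat>[t]\<close> would then bound the degrees of all values, while the powers of a single \<open>v\<^sub>j\<close> with
  \<open>w\<^sub>j \<noteq> 0\<close> have values of every degree (\<open>finite_over_imp_independent\<close>).

  Conversely let the columns be independent. At a face with \<open>n\<close> vertices the restricted \<open>t\<^sub>i\<close> are a
  linear change of coordinates, hence algebraically independent. The face ring is a finitely
  generated module over \<open>\<rat>[t]\<close> because it equals \<open>\<Sum>\<^sub>\<sigma> \<rat>[t] v\<^sub>\<sigma>\<close>: this sum contains 1 and is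
  stable under multiplication by vertices. Indeed \<open>v\<^sub>j v\<^sub>\<sigma>\<close> is a sum of \<open>v\<^sub>\<eta>\<close> if \<open>j\<close> is not a
  vertex of \<open>\<sigma>\<close>, and for a vertex of \<open>\<sigma>\<close> a left inverse of the columns at \<open>\<sigma>\<close> writes
  \<open>v\<^sub>j v\<^sub>\<sigma>\<close> through the \<open>t\<^sub>i v\<^sub>\<sigma>\<close> and products of the first kind
  (\<open>spanned_vert_inside\<close>); general faces follow from vertices (\<open>spanned_face_below\<close>).

  On the topological side, the gluing of the moment-angle complex identifies points of different
  blocks only when they are the same point of the polydisc. So the isotropy group of a point with
  coordinates \<open>z\<close> consists of the \<open>g\<close> in the kernel with \<open>g\<^sub>j = 1\<close> wherever \<open>z\<^sub>j \<noteq> 0\<close>. Taking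
  the zeros of \<open>z\<close> to be the vertices of \<open>\<sigma>\<close>, it is finite precisely when the columns at \<open>\<sigma>\<close>
  are independent: a left inverse makes the group torsion of bounded order, and a relation yields
  a one-parameter subgroup (\<open>almost_free_iff_independent\<close>). For the shape of the kernel,
  integral column operations turn \<open>\<Lambda>\<close> into \<open>(H | 0)\<close> with a square block \<open>H\<close>; independent
  columns make \<open>H\<close> nonsingular, and the kernel becomes the finite kernel of \<open>H\<close> times the torus
  of the remaining \<open>m - n\<close> coordinates (\<open>torus_kernel_splits\<close>).\<close>

section \<open>Faces and their vertex sets\<close>

locale numbered_simplicial_poset =
  fixes m :: nat and vert :: "nat \<Rightarrow> 'a::{finite,order_bot}"
  assumes simplicial: "simplicial_poset TYPE('a)"
    and numbering: "vertex_numbering m vert"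
begin

abbreviation V :: "'a \<Rightarrow> nat set" where
  "V \<equiv> vertices_of m vert"

lemma finite_V [simp]: "finite (V \<sigma>)"
  by (simp add: vertices_of_def)

lemma V_subset: "V \<sigma> \<subseteq> {..<m}"
  by (auto simp: vertices_of_def)

lemma V_mono: "\<rho> \<le> \<sigma> \<Longrightarrow> V \<rho> \<subseteq> V \<sigma>"
  by (auto simp: vertices_of_def)

lemma segment_chart:
  obtains f where "bij_betw f {bot..\<sigma>::'a} (Pow {..<face_rank \<sigma>})"
    and "\<And>x y. x \<le> \<sigma> \<Longrightarrow> y \<le> \<sigma> \<Longrightarrow> x \<le> y \<longleftrightarrow> f x \<subseteq> f y"
proof -
  obtain k where k: "segment_is_simplex \<sigma> k"
    using simplicial unfolding simplicial_poset_def by blast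
  then have "segment_is_simplex \<sigma> (face_rank \<sigma>)"
    by (simp add: face_rank_eq)
  then show thesis
    unfolding segment_is_simplex_def using that by auto
qed

text \<open>An order isomorphism of a segment onto a power set identifies each smaller segment with the
  power set of the image of its top, so the rank of a smaller face can be read off there.\<close>

lemma face_rank_in_chart:
  assumes f: "bij_betw f {bot..\<zeta>::'a} (Pow {..<k::nat})"
    and ord: "\<And>x y. x \<le> \<zeta> \<Longrightarrow> y \<le> \<zeta> \<Longrightarrow> x \<le> y \<longleftrightarrow> f x \<subseteq> f y"
    and \<rho>: "\<rho> \<le> \<zeta>"
  shows "face_rank \<rho> = card (f \<rho>)"
proof -
  have f\<rho>: "f \<rho> \<subseteq> {..<k}"
    using bij_betwE[OF f] \<rho> by auto
  then have "finite (f \<rho>)" by (rule finite_subset) simp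
  then obtain g where g: "bij_betw g (f \<rho>) {..<card (f \<rho>)}"
    using ex_bij_betw_finite_nat[of "f \<rho>"] by (auto simp: atLeast0LessThan)
  have restr: "bij_betw f {bot..\<rho>} (Pow (f \<rho>))"
  proof (rule bij_betw_imageI)
    show "inj_on f {bot..\<rho>}"
    proof (rule inj_on_subset)
      show "inj_on f {bot..\<zeta>}" using f by (rule bij_betw_imp_inj_on)
      show "{bot..\<rho>} \<subseteq> {bot..\<zeta>}" using \<rho> by auto
    qed
    show "f ` {bot..\<rho>} = Pow (f \<rho>)"
    proof (intro equalityI subsetI)
      fix A assume "A \<in> f ` {bot..\<rho>}"
      then obtain x where x: "x \<le> \<rho>" "A = f x" by auto
      then have "x \<le> \<zeta>" using \<rho> by auto
      then show "A \<in> Pow (f \<rho>)" using ord[OF _ \<rho>, of x] x by blast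
    next
      fix A assume A: "A \<in> Pow (f \<rho>)"
      then have "A \<in> Pow {..<k}" using f\<rho> by blast
      then have "A \<in> f ` {bot..\<zeta>}" using bij_betw_imp_surj_on[OF f] by simp
      then obtain x where x: "x \<le> \<zeta>" "f x = A" by auto
      then have "x \<le> \<rho>" using ord[OF x(1) \<rho>] A by blast
      then show "A \<in> f ` {bot..\<rho>}" using x by auto
    qed
  qed
  have "bij_betw (image g \<circ> f) {bot..\<rho>} (Pow {..<card (f \<rho>)})"
    using restr bij_betw_Pow[OF g] by (rule bij_betw_trans)
  moreover have "x \<le> y \<longleftrightarrow> (image g \<circ> f) x \<subseteq> (image g \<circ> f) y"
    if "x \<in> {bot..\<rho>}" "y \<in> {bot..\<rho>}" for x y
  proof -
    have xy: "x \<le> \<rho>" "y \<le> \<rho>" using that by auto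
    then have le: "x \<le> \<zeta>" "y \<le> \<zeta>" using \<rho> by auto
    have "f x \<subseteq> f \<rho>" "f y \<subseteq> f \<rho>"
      using ord[OF le(1) \<rho>] ord[OF le(2) \<rho>] xy by blast+
    then have "g ` f x \<subseteq> g ` f y \<longleftrightarrow> f x \<subseteq> f y"
      using g by (meson bij_betw_imp_inj_on inj_on_image_subset_iff)
    then show ?thesis using ord[OF le] by simp
  qed
  ultimately have "segment_is_simplex \<rho> (card (f \<rho>))"
    unfolding segment_is_simplex_def by (intro exI[of _ "image g \<circ> f"] conjI ballI)
  then show ?thesis by (rule face_rank_eq)
qed

lemma vert_image: "vert ` {..<m} = {\<sigma>. face_rank \<sigma> = 1}"
  using numbering unfolding vertex_numbering_def by (rule bij_betw_imp_surj_on)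

lemma vert_inj: "inj_on vert {..<m}"
  using numbering unfolding vertex_numbering_def by (rule bij_betw_imp_inj_on)

lemma face_rank_vert: "j < m \<Longrightarrow> face_rank (vert j) = 1"
  using vert_image by auto

lemma rank_one_vert:
  assumes "face_rank \<sigma> = 1" shows "\<exists>j<m. vert j = \<sigma>"
proof -
  have "\<sigma> \<in> vert ` {..<m}" using assms vert_image by simp
  then show ?thesis by auto
qed

text \<open>Vertices are the faces that an isomorphism onto a power set sends to singletons. Hence a face is
  determined, inside a fixed segment, by its vertices.\<close>

lemma segment_vertices:
  shows V_bij: "bij_betw V {bot..\<zeta>} (Pow (V \<zeta>))"
    and V_order: "\<And>x y. x \<le> \<zeta> \<Longrightarrow> y \<le> \<zeta> \<Longrightarrow> x \<le> y \<longleftrightarrow> V x \<subseteq> V y"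
    and card_V: "card (V \<zeta>) = face_rank \<zeta>"
proof -
  let ?k = "face_rank \<zeta>"
  obtain f where f: "bij_betw f {bot..\<zeta>} (Pow {..<?k})"
    and ord: "\<And>x y. x \<le> \<zeta> \<Longrightarrow> y \<le> \<zeta> \<Longrightarrow> x \<le> y \<longleftrightarrow> f x \<subseteq> f y"
    by (rule segment_chart) blast
  have sub: "f x \<subseteq> {..<?k}" if "x \<le> \<zeta>" for x
    using bij_betwE[OF f] that by auto
  have finj: "x = y" if "x \<le> \<zeta>" "y \<le> \<zeta>" "f x = f y" for x y
    using inj_onD[OF bij_betw_imp_inj_on[OF f] that(3)] that(1,2) by simp
  have fsurj: "\<exists>x\<le>\<zeta>. f x = A" if "A \<subseteq> {..<?k}" for A
  proof -
    have "A \<in> f ` {bot..\<zeta>}" using bij_betw_imp_surj_on[OF f] that by simp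
    then show ?thesis by auto
  qed
  have "\<exists>i. f (vert j) = {i}" if "j \<in> V \<zeta>" for j
  proof -
    have "j < m" "vert j \<le> \<zeta>" using that by (auto simp: vertices_of_def)
    then have "card (f (vert j)) = 1"
      using face_rank_in_chart[OF f ord, of "vert j"] face_rank_vert by simp
    then show ?thesis by (simp add: card_1_singleton_iff)
  qed
  then obtain c where c: "\<And>j. j \<in> V \<zeta> \<Longrightarrow> f (vert j) = {c j}" by metis
  have cbij: "bij_betw c (V \<zeta>) {..<?k}"
  proof (rule bij_betw_imageI)
    show "inj_on c (V \<zeta>)"
    proof (rule inj_onI)
      fix i j assume ij: "i \<in> V \<zeta>" "j \<in> V \<zeta>" "c i = c j"
      then have "f (vert i) = f (vert j)" using c by simp
      then have "vert i = vert j"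
        using finj[of "vert i" "vert j"] ij(1,2) by (simp add: vertices_of_def)
      then show "i = j" using inj_onD[OF vert_inj] ij by (simp add: vertices_of_def)
    qed
    show "c ` V \<zeta> = {..<?k}"
    proof (intro equalityI subsetI)
      fix i assume "i \<in> c ` V \<zeta>"
      then show "i \<in> {..<?k}" using c sub by (force simp: vertices_of_def)
    next
      fix i assume "i \<in> {..<?k}"
      then obtain x where x: "x \<le> \<zeta>" "f x = {i}" using fsurj[of "{i}"] by auto
      then have "face_rank x = 1" using face_rank_in_chart[OF f ord, of x] by simp
      then obtain j where j: "j < m" "vert j = x" using rank_one_vert by blast
      then have "j \<in> V \<zeta>" using x by (simp add: vertices_of_def)
      moreover have "c j = i" using c[OF calculation] x j by simp
      ultimately show "i \<in> c ` V \<zeta>" by blast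
    qed
  qed
  show "card (V \<zeta>) = ?k" using bij_betw_same_card[OF cbij] by simp
  have cinj: "inj_on c (V \<zeta>)" using cbij by (rule bij_betw_imp_inj_on)
  \<comment> \<open>\<open>c\<close> numbers the vertices of \<open>\<zeta>\<close> as the chart \<open>f\<close> does, so it turns vertex sets into chart values.\<close>
  have cV: "c ` V x = f x" if x: "x \<le> \<zeta>" for x
  proof -
    have "j \<in> V x \<longleftrightarrow> j \<in> V \<zeta> \<and> c j \<in> f x" for j
    proof (cases "j \<in> V \<zeta>")
      case True
      then have "vert j \<le> \<zeta>" "j < m" by (auto simp: vertices_of_def)
      then show ?thesis using ord[OF \<open>vert j \<le> \<zeta>\<close> x] c[OF True] True
        by (simp add: vertices_of_def)
    next
      case False
      then show ?thesis using V_mono[OF x] by blast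
    qed
    then have "c ` V x = {i \<in> c ` V \<zeta>. i \<in> f x}" by blast
    then show ?thesis using cbij sub[OF x] unfolding bij_betw_def by auto
  qed
  show ordV: "x \<le> y \<longleftrightarrow> V x \<subseteq> V y" if "x \<le> \<zeta>" "y \<le> \<zeta>" for x y
    using inj_on_image_subset_iff[OF cinj V_mono[OF that(1)] V_mono[OF that(2)]]
      ord[OF that] cV that by simp
  show "bij_betw V {bot..\<zeta>} (Pow (V \<zeta>))"
  proof (rule bij_betw_imageI)
    show "inj_on V {bot..\<zeta>}"
    proof (rule inj_onI)
      fix x y assume xy: "x \<in> {bot..\<zeta>}" "y \<in> {bot..\<zeta>}" "V x = V y"
      then have "x \<le> y" "y \<le> x" using ordV[of x y] ordV[of y x] by auto
      then show "x = y" by (rule antisym)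
    qed
    show "V ` {bot..\<zeta>} = Pow (V \<zeta>)"
    proof (intro equalityI subsetI)
      fix W assume "W \<in> V ` {bot..\<zeta>}"
      then obtain x where "x \<le> \<zeta>" "W = V x" by auto
      then show "W \<in> Pow (V \<zeta>)" using V_mono[of x \<zeta>] by blast
    next
      fix W assume W: "W \<in> Pow (V \<zeta>)"
      then have "c ` W \<subseteq> {..<?k}" using cbij unfolding bij_betw_def by blast
      then obtain x where x: "x \<le> \<zeta>" "f x = c ` W" using fsurj by blast
      then have "V x = W"
        using cV[OF x(1)] inj_on_image_eq_iff[OF cinj V_mono[OF x(1)]] W by auto
      then show "W \<in> V ` {bot..\<zeta>}" using x by auto
    qed
  qed
qed

text \<open>Distinct faces may share their vertices; they cannot if they lie under a common face.\<close>

lemma V_eqD: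
  assumes "V x = V y" "x \<le> \<zeta>" "y \<le> \<zeta>"
  shows "x = y"
proof (rule antisym)
  show "x \<le> y" using V_order[OF assms(2,3)] assms(1) by blast
  show "y \<le> x" using V_order[OF assms(3,2)] assms(1) by blast
qed

lemma face_with_vertices: "W \<subseteq> V \<zeta> \<Longrightarrow> \<exists>x\<le>\<zeta>. V x = W"
  using V_bij[of \<zeta>] unfolding bij_betw_def by (metis PowI atLeastAtMost_iff imageE)

lemma V_bot [simp]: "V bot = {}"
proof -
  obtain x where x: "x \<le> bot" "V x = {}" using face_with_vertices[of "{}" bot] by blast
  show ?thesis using x(2) unfolding le_bot[OF x(1)] .
qed

lemma V_empty_iff: "V x = {} \<longleftrightarrow> x = bot"
proof
  assume "V x = {}"
  then show "x = bot" by (intro V_eqD[of x bot x]) simp_all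
qed simp

lemma V_vert:
  assumes "j < m" shows "V (vert j) = {j}"
proof -
  have "card (V (vert j)) = 1"
    using card_V face_rank_vert[OF assms] by simp
  then obtain i where "V (vert j) = {i}" by (rule card_1_singletonE)
  moreover have "j \<in> V (vert j)" using assms by (simp add: vertices_of_def)
  ultimately show ?thesis by simp
qed

text \<open>A least common upper bound has no superfluous vertices, because the segment below it contains a
  face with exactly the vertices of both arguments. There may be several such upper bounds, one
  below each common upper bound (\<open>join_below\<close>).\<close>

lemma joins_iff: "\<eta> \<in> joins \<alpha> \<beta> \<longleftrightarrow> \<alpha> \<le> \<eta> \<and> \<beta> \<le> \<eta> \<and> V \<eta> = V \<alpha> \<union> V \<beta>"
proof
  assume \<eta>: "\<eta> \<in> joins \<alpha> \<beta>"
  then have le: "\<alpha> \<le> \<eta>" "\<beta> \<le> \<eta>" by (auto simp: joins_def)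
  then have "V \<alpha> \<union> V \<beta> \<subseteq> V \<eta>" using V_mono by blast
  then obtain x where x: "x \<le> \<eta>" "V x = V \<alpha> \<union> V \<beta>" using face_with_vertices by blast
  then have "\<alpha> \<le> x" "\<beta> \<le> x" using V_order[OF le(1) x(1)] V_order[OF le(2) x(1)] x(2) by auto
  then have "x = \<eta>" using \<eta> x(1) unfolding joins_def by blast
  then show "\<alpha> \<le> \<eta> \<and> \<beta> \<le> \<eta> \<and> V \<eta> = V \<alpha> \<union> V \<beta>" using le x by simp
next
  assume \<eta>: "\<alpha> \<le> \<eta> \<and> \<beta> \<le> \<eta> \<and> V \<eta> = V \<alpha> \<union> V \<beta>"
  have "\<rho> = \<eta>" if "\<alpha> \<le> \<rho>" "\<beta> \<le> \<rho>" "\<rho> \<le> \<eta>" for \<rho>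
  proof -
    have "V \<rho> = V \<eta>" using V_mono[OF that(1)] V_mono[OF that(2)] V_mono[OF that(3)] \<eta> by auto
    then show ?thesis using V_eqD that(3) by blast
  qed
  then show "\<eta> \<in> joins \<alpha> \<beta>" using \<eta> unfolding joins_def by blast
qed

lemma join_below:
  assumes "\<alpha> \<le> (\<zeta>::'a)" "\<beta> \<le> \<zeta>"
  shows "\<exists>\<eta>. {\<xi> \<in> joins \<alpha> \<beta>. \<xi> \<le> \<zeta>} = {\<eta>}"
proof -
  have "V \<alpha> \<union> V \<beta> \<subseteq> V \<zeta>" using assms V_mono by blast
  then obtain \<eta> where \<eta>: "\<eta> \<le> \<zeta>" "V \<eta> = V \<alpha> \<union> V \<beta>" using face_with_vertices by blast
  then have "\<eta> \<in> joins \<alpha> \<beta>"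
    using V_order[OF assms(1) \<eta>(1)] V_order[OF assms(2) \<eta>(1)] by (simp add: joins_iff)
  moreover have "\<xi> = \<eta>" if "\<xi> \<in> joins \<alpha> \<beta>" "\<xi> \<le> \<zeta>" for \<xi>
    using that \<eta> V_eqD[of \<xi> \<eta> \<zeta>] by (simp add: joins_iff)
  ultimately have "{\<xi> \<in> joins \<alpha> \<beta>. \<xi> \<le> \<zeta>} = {\<eta>}" using \<eta>(1) by blast
  then show ?thesis by blast
qed

lemma meet_below:
  assumes "\<alpha> \<le> \<zeta>" "\<beta> \<le> \<zeta>"
  shows "\<exists>\<gamma>. meets \<alpha> \<beta> = {\<gamma>} \<and> \<gamma> \<le> \<alpha> \<and> V \<gamma> = V \<alpha> \<inter> V \<beta>"
proof -
  have "V \<alpha> \<inter> V \<beta> \<subseteq> V \<zeta>" using assms V_mono by blast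
  then obtain \<gamma> where \<gamma>: "\<gamma> \<le> \<zeta>" "V \<gamma> = V \<alpha> \<inter> V \<beta>" using face_with_vertices by blast
  have le: "\<gamma> \<le> \<alpha>" "\<gamma> \<le> \<beta>"
    using V_order[OF \<gamma>(1) assms(1)] V_order[OF \<gamma>(1) assms(2)] \<gamma>(2) by auto
  have greatest: "\<rho> \<le> \<gamma>" if "\<rho> \<le> \<alpha>" "\<rho> \<le> \<beta>" for \<rho>
  proof -
    have "\<rho> \<le> \<zeta>" using that assms by auto
    moreover have "V \<rho> \<subseteq> V \<gamma>" using V_mono[OF that(1)] V_mono[OF that(2)] \<gamma>(2) by blast
    ultimately show ?thesis using V_order[of \<rho> \<zeta> \<gamma>] \<gamma>(1) by blast
  qed
  have "meets \<alpha> \<beta> = {\<gamma>}"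
  proof (intro equalityI subsetI)
    fix \<delta> assume "\<delta> \<in> meets \<alpha> \<beta>"
    then show "\<delta> \<in> {\<gamma>}" using le greatest[of \<delta>] unfolding meets_def by blast
  next
    fix \<delta> assume "\<delta> \<in> {\<gamma>}"
    moreover have "\<gamma> \<in> meets \<alpha> \<beta>"
      unfolding meets_def using le antisym[OF greatest] by blast
    ultimately show "\<delta> \<in> meets \<alpha> \<beta>" by simp
  qed
  then show ?thesis using le \<gamma> by blast
qed

lemma facet_of_full_rank: "\<exists>\<sigma>::'a. face_rank \<sigma> = poset_rank TYPE('a)"
proof -
  have "Max (range (face_rank :: 'a \<Rightarrow> nat)) \<in> range (face_rank :: 'a \<Rightarrow> nat)"
    by (rule Max_in) auto
  then show ?thesis unfolding poset_rank_def by fastforce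
qed

lemma poset_rank_le_vertices: "poset_rank TYPE('a) \<le> m"
proof -
  obtain \<sigma> :: 'a where "face_rank \<sigma> = poset_rank TYPE('a)" using facet_of_full_rank by blast
  then show ?thesis using card_V[of \<sigma>] card_mono[OF _ V_subset[of \<sigma>]] by simp
qed

end

section \<open>Independent columns\<close>

text \<open>This frees \<open>$\<close> and \<open>\<bullet>\<close> for vectors whose dimension is a number.\<close>

unbundle no vec_syntax and no inner_syntax

text \<open>The rank is the dimension of the span of the \<^emph>\<open>set\<close> of columns. Repeated columns
  therefore need their own argument in both directions: they lower the rank, and their difference
  lies in the kernel.\<close>

lemma (in vec_space) rank_eq_dim_col_iff:
  assumes A: "A \<in> carrier_mat n k"
  shows "rank A = k \<longleftrightarrow> (\<forall>v\<in>carrier_vec k. A *\<^sub>v v = 0\<^sub>v n \<longrightarrow> v = 0\<^sub>v k)"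
proof -
  have low: "rank A < k" if nd: "\<not> distinct (cols A)"
  proof -
    obtain S where S: "maximal S (\<lambda>T. T \<subseteq> set (cols A) \<and> lin_indpt T)"
      using maximal_exists[of "(\<lambda>T. T \<subseteq> set (cols A) \<and> lin_indpt T)" "card (set (cols A))" "{}"]
      by (meson List.finite_set card_mono empty_iff empty_subsetI finite_lin_indpt2 rev_finite_subset)
    then have "card S \<le> card (set (cols A))" by (simp add: card_mono maximal_def)
    moreover have "card (set (cols A)) < length (cols A)"
      using nd card_distinct card_length le_neq_implies_less by blast
    ultimately show ?thesis using rank_card_indpt[OF A S] A by simp
  qed
  show ?thesis
  proof
    assume r: "rank A = k"
    then have d: "distinct (cols A)" using low by auto
    then have "lin_indpt (set (cols A))" by (rule full_rank_lin_indpt[OF A r])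
    then show "\<forall>v\<in>carrier_vec k. A *\<^sub>v v = 0\<^sub>v n \<longrightarrow> v = 0\<^sub>v k"
      using lin_depI[OF A _ _ _ d] by blast
  next
    assume ker: "\<forall>v\<in>carrier_vec k. A *\<^sub>v v = 0\<^sub>v n \<longrightarrow> v = 0\<^sub>v k"
    have d: "distinct (cols A)"
    proof (rule ccontr)
      assume "\<not> distinct (cols A)"
      then obtain i j where ij: "i < k" "j < k" "i \<noteq> j" "col A i = col A j"
        using A unfolding distinct_conv_nth by auto
      let ?v = "unit_vec k i - unit_vec k j :: 'a vec"
      have "A *\<^sub>v ?v = A *\<^sub>v unit_vec k i - A *\<^sub>v unit_vec k j"
        using A by (intro mult_minus_distrib_mat_vec[of _ n k]) auto
      also have "\<dots> = 0\<^sub>v n"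
      proof (rule eq_vecI)
        fix r assume "r < dim_vec (0\<^sub>v n :: 'a vec)"
        then have r: "r < n" by simp
        have "A $$ (r, i) = A $$ (r, j)"
        proof -
          have "A $$ (r, i) = col A i $ r" using r ij(1) A by simp
          also have "\<dots> = col A j $ r" by (simp only: ij(4))
          also have "\<dots> = A $$ (r, j)" using r ij(2) A by simp
          finally show ?thesis .
        qed
        then show "(A *\<^sub>v unit_vec k i - A *\<^sub>v unit_vec k j) $ r = 0\<^sub>v n $ r"
          using r ij A by simp
      qed (use A in simp)
      finally have "?v = 0\<^sub>v k" using ker by simp
      then have "?v $ i = 0\<^sub>v k $ i" by simp
      then show False using ij by simp
    qed
    moreover have "lin_indpt (set (cols A))"
    proof
      assume "lin_dep (set (cols A))"
      then show False using lin_depE[OF A _ d] ker by metis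
    qed
    ultimately show "rank A = k" by (rule lin_indpt_full_rank[OF A])
  qed
qed

text \<open>Integer relations are used instead of rational ones because the torus side of the theorem needs
  integer exponents; \<open>rank_submatrix_eq_card_iff\<close> shows that the rank over the rationals
  agrees.\<close>

definition columns_independent :: "int mat \<Rightarrow> nat set \<Rightarrow> bool" where
  "columns_independent \<Lambda> J \<longleftrightarrow>
     (\<forall>w. (\<forall>i<dim_row \<Lambda>. (\<Sum>j\<in>J. \<Lambda> $$ (i, j) * w j) = 0) \<longrightarrow> (\<forall>j\<in>J. w j = 0))"

lemma columns_independentD:
  assumes "columns_independent \<Lambda> J" "j \<in> J"
    and "\<And>i. i < dim_row \<Lambda> \<Longrightarrow> (\<Sum>j\<in>J. \<Lambda> $$ (i, j) * w j) = 0"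
  shows "w j = 0"
  using assms unfolding columns_independent_def by simp

lemma bij_betw_pick: "finite J \<Longrightarrow> bij_betw (pick J) {..<card J} J"
proof (rule bij_betw_imageI)
  assume J: "finite J"
  show inj: "inj_on (pick J) {..<card J}"
  proof (rule inj_onI)
    fix x y assume xy: "x \<in> {..<card J}" "y \<in> {..<card J}" "pick J x = pick J y"
    have "x = card {a \<in> J. a < pick J x}" using card_pick_le[of x J] xy(1) by simp
    also have "\<dots> = y" unfolding xy(3) using card_pick_le[of y J] xy(2) by simp
    finally show "x = y" .
  qed
  show "pick J ` {..<card J} = J"
  proof (rule card_seteq[OF J])
    show "pick J ` {..<card J} \<subseteq> J"
      by (rule image_subsetI, rule pick_in_set_le) simp
    show "card J \<le> card (pick J ` {..<card J})" using card_image[OF inj] by simp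
  qed
qed

lemma clear_denominators:
  fixes w :: "nat \<Rightarrow> rat"
  assumes "finite J"
  shows "\<exists>D::int. D \<noteq> 0 \<and> (\<forall>j\<in>J. \<exists>z::int. of_int z = of_int D * w j)"
  using assms
proof induction
  case empty
  show ?case by (intro exI[of _ 1]) simp
next
  case (insert x J)
  then obtain D where D: "D \<noteq> 0" "\<And>j. j \<in> J \<Longrightarrow> \<exists>z::int. of_int z = of_int D * w j" by blast
  obtain a b where q: "quotient_of (w x) = (a, b)" by (cases "quotient_of (w x)")
  have ab: "w x = of_int a / of_int b" "b \<noteq> 0"
    using quotient_of_div[OF q] quotient_of_denom_pos[OF q] by simp_all
  have "\<exists>z::int. of_int z = of_int (D * b) * w j" if j: "j \<in> insert x J" for j
  proof (cases "j = x")
    case True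
    then show ?thesis using ab by (intro exI[of _ "D * a"]) simp
  next
    case False
    then obtain z :: int where "of_int z = of_int D * w j" using D(2) j by blast
    then show ?thesis by (intro exI[of _ "b * z"]) simp
  qed
  then show ?case using D(1) ab(2) by (intro exI[of _ "D * b"]) simp
qed

context
  fixes \<Lambda> :: "int mat" and n m :: nat and J :: "nat set"
  assumes \<Lambda>: "\<Lambda> \<in> carrier_mat n m" and J: "J \<subseteq> {..<m}"
begin

private lemma finJ: "finite J"
  using J by (rule finite_subset) simp

private lemma Jsel: "{j. j < m \<and> j \<in> J} = J"
  using J by auto

private lemma sub_carrier: "submatrix \<Lambda> UNIV J \<in> carrier_mat n (card J)"
  using \<Lambda> by (intro carrier_matI) (simp_all add: dim_submatrix Jsel)

private lemma sub_index:
  "i < n \<Longrightarrow> k < card J \<Longrightarrow> submatrix \<Lambda> UNIV J $$ (i, k) = \<Lambda> $$ (i, pick J k)"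
  using \<Lambda> by (simp add: submatrix_index Jsel pick_UNIV)

private lemma sum_pick: "(\<Sum>k<card J. f (pick J k)) = (\<Sum>j\<in>J. f j)"
  by (rule sum.reindex_bij_betw[OF bij_betw_pick[OF finJ]])

text \<open>The inverse of \<open>pick J\<close>: the position in the submatrix of the column with index \<open>j\<close>.\<close>

private definition pos :: "nat \<Rightarrow> nat" where
  "pos = the_inv_into {..<card J} (pick J)"

private lemma pos:
  shows "j \<in> J \<Longrightarrow> pos j < card J" and "j \<in> J \<Longrightarrow> pick J (pos j) = j"
    and "k < card J \<Longrightarrow> pos (pick J k) = k"
proof -
  note b = bij_betw_pick[OF finJ]
  have inj: "inj_on (pick J) {..<card J}" and im: "pick J ` {..<card J} = J"
    using b by (rule bij_betw_imp_inj_on, rule bij_betw_imp_surj_on)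
  show "pos j < card J" if "j \<in> J"
    using the_inv_into_into[OF inj, of j "{..<card J}"] that im by (simp add: pos_def)
  show "pick J (pos j) = j" if "j \<in> J"
    using f_the_inv_into_f[OF inj, of j] that im by (simp add: pos_def)
  show "pos (pick J k) = k" if "k < card J"
    using the_inv_into_f_f[OF inj, of k] that by (simp add: pos_def)
qed

private lemma pos_inj: "j \<in> J \<Longrightarrow> k \<in> J \<Longrightarrow> pos j = pos k \<longleftrightarrow> j = k"
  using pos(2) by metis

private lemma mult_sub:
  fixes v :: "'c::comm_ring_1 vec"
  assumes "i < n" "v \<in> carrier_vec (card J)"
  shows "(map_mat of_int (submatrix \<Lambda> UNIV J) *\<^sub>v v) $ i
           = (\<Sum>j\<in>J. of_int (\<Lambda> $$ (i, j)) * v $ pos j)"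
proof -
  have "(map_mat of_int (submatrix \<Lambda> UNIV J) *\<^sub>v v) $ i
      = (\<Sum>k<card J. of_int (\<Lambda> $$ (i, pick J k)) * v $ k)"
    using assms sub_carrier by (simp add: scalar_prod_def sub_index atLeast0LessThan)
  also have "\<dots> = (\<Sum>k<card J. of_int (\<Lambda> $$ (i, pick J k)) * v $ pos (pick J k))"
    by (intro sum.cong refl) (simp add: pos)
  also have "\<dots> = (\<Sum>j\<in>J. of_int (\<Lambda> $$ (i, j)) * v $ pos j)"
    by (rule sum_pick)
  finally show ?thesis .
qed

lemma rank_submatrix_eq_card_iff:
  "vec_space.rank n (map_mat rat_of_int (submatrix \<Lambda> UNIV J)) = card J
     \<longleftrightarrow> columns_independent \<Lambda> J"
proof -
  interpret vec_space "TYPE(rat)" n .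
  let ?A = "map_mat rat_of_int (submatrix \<Lambda> UNIV J)"
  have A: "?A \<in> carrier_mat n (card J)" using sub_carrier by simp
  have "(\<forall>v\<in>carrier_vec (card J). ?A *\<^sub>v v = 0\<^sub>v n \<longrightarrow> v = 0\<^sub>v (card J))
      \<longleftrightarrow> columns_independent \<Lambda> J" (is "?L \<longleftrightarrow> _")
  proof
    assume L: ?L
    show "columns_independent \<Lambda> J"
      unfolding columns_independent_def
    proof (intro allI impI ballI)
      fix w j assume w: "\<forall>i<dim_row \<Lambda>. (\<Sum>j\<in>J. \<Lambda> $$ (i, j) * w j) = 0" and j: "j \<in> J"
      let ?v = "Matrix.vec (card J) (\<lambda>k. rat_of_int (w (pick J k)))"
      have "?A *\<^sub>v ?v = 0\<^sub>v n"
      proof (rule eq_vecI)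
        fix i assume "i < dim_vec (0\<^sub>v n :: rat vec)"
        then have i: "i < n" by simp
        have "(?A *\<^sub>v ?v) $ i = (\<Sum>j\<in>J. rat_of_int (\<Lambda> $$ (i, j)) * ?v $ pos j)"
          by (rule mult_sub[OF i]) simp
        also have "\<dots> = (\<Sum>j\<in>J. rat_of_int (\<Lambda> $$ (i, j) * w j))"
          by (intro sum.cong refl) (simp add: pos)
        also have "\<dots> = rat_of_int (\<Sum>j\<in>J. \<Lambda> $$ (i, j) * w j)" by simp
        also have "\<dots> = 0" using w i \<Lambda> by simp
        finally show "(?A *\<^sub>v ?v) $ i = 0\<^sub>v n $ i" using i by simp
      qed (use A in simp)
      then have "?v = 0\<^sub>v (card J)" using L by simp
      then have "?v $ pos j = 0\<^sub>v (card J) $ pos j" by simp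
      then show "w j = 0" using pos(1,2)[OF j] by simp
    qed
  next
    assume R: "columns_independent \<Lambda> J"
    show ?L
    proof (intro ballI impI)
      fix v :: "rat vec" assume v: "v \<in> carrier_vec (card J)" and 0: "?A *\<^sub>v v = 0\<^sub>v n"
      obtain D :: int where D: "D \<noteq> 0" "\<forall>j\<in>J. \<exists>z::int. of_int z = of_int D * v $ pos j"
        using clear_denominators[OF finJ, of "\<lambda>j. v $ pos j"] by blast
      then obtain w :: "nat \<Rightarrow> int" where w: "\<And>j. j \<in> J \<Longrightarrow> of_int (w j) = of_int D * v $ pos j"
        by metis
      have "(\<Sum>j\<in>J. \<Lambda> $$ (i, j) * w j) = 0" if i: "i < dim_row \<Lambda>" for i
      proof -
        have "rat_of_int (\<Sum>j\<in>J. \<Lambda> $$ (i, j) * w j)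
            = (\<Sum>j\<in>J. of_int D * (of_int (\<Lambda> $$ (i, j)) * v $ pos j))"
          by (simp add: w mult.assoc mult.left_commute)
        also have "\<dots> = of_int D * (?A *\<^sub>v v) $ i"
          using i \<Lambda> by (subst mult_sub[OF _ v]) (auto simp: sum_distrib_left)
        also have "\<dots> = 0" unfolding 0 using i \<Lambda> by simp
        finally show ?thesis by (simp only: of_int_eq_0_iff)
      qed
      then have w0: "w j = 0" if "j \<in> J" for j
        by (rule columns_independentD[OF R that])
      show "v = 0\<^sub>v (card J)"
      proof (rule eq_vecI)
        fix k assume "k < dim_vec (0\<^sub>v (card J) :: rat vec)"
        then have k: "k < card J" by simp
        then have j: "pick J k \<in> J" by (rule pick_in_set_le)
        show "v $ k = 0\<^sub>v (card J) $ k"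
          using w[OF j] w0[OF j] D(1) k pos(3)[OF k] by simp
      qed (use v in simp)
    qed
  qed
  then show ?thesis using rank_eq_dim_col_iff[OF A] by simp
qed

private lemma independent_kernel:
  assumes "columns_independent \<Lambda> J" "v \<in> carrier_vec (card J)"
    and "submatrix \<Lambda> UNIV J *\<^sub>v v = 0\<^sub>v n"
  shows "v = 0\<^sub>v (card J)"
proof -
  have id: "map_mat of_int (submatrix \<Lambda> UNIV J) = submatrix \<Lambda> UNIV J" by auto
  have "(\<Sum>j\<in>J. \<Lambda> $$ (i, j) * v $ pos j) = 0" if "i < dim_row \<Lambda>" for i
    using mult_sub[of i v] assms(2,3) that \<Lambda> unfolding id by simp
  then have *: "v $ pos j = 0" if "j \<in> J" for j
    by (rule columns_independentD[OF assms(1) that])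
  show ?thesis
  proof (rule eq_vecI)
    fix k assume "k < dim_vec (0\<^sub>v (card J) :: int vec)"
    then have k: "k < card J" by simp
    show "v $ k = 0\<^sub>v (card J) $ k"
      using *[OF pick_in_set_le[OF k]] k pos(3)[OF k] by simp
  qed (use assms(2) in simp)
qed

text \<open>For a matrix \<open>B\<close> of independent columns the Gram matrix \<open>G = B\<^sup>T B\<close> is nonsingular, since
  \<open>G v = 0\<close> makes the sum of the squares of the entries of \<open>B v\<close> vanish. Then
  \<open>adj G B\<^sup>T\<close> is an integral left inverse up to the factor \<open>det G\<close>.\<close>

lemma independent_left_inverse:
  assumes "columns_independent \<Lambda> J"
  obtains N :: "nat \<Rightarrow> nat \<Rightarrow> int" and d :: int where "d \<noteq> 0"
    "\<And>k j. k \<in> J \<Longrightarrow> j \<in> J \<Longrightarrow> (\<Sum>i<n. N k i * \<Lambda> $$ (i, j)) = (if k = j then d else 0)"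
proof -
  define B where "B = submatrix \<Lambda> UNIV J"
  define c where "c = card J"
  have B: "B \<in> carrier_mat n c" unfolding B_def c_def by (rule sub_carrier)
  have BT: "transpose_mat B \<in> carrier_mat c n" using B by simp
  define G where "G = transpose_mat B * B"
  have G: "G \<in> carrier_mat c c" unfolding G_def using B by simp
  have "Determinant.det G \<noteq> 0"
  proof
    assume "Determinant.det G = 0"
    then obtain v where v: "v \<in> carrier_vec c" "v \<noteq> 0\<^sub>v c" "G *\<^sub>v v = 0\<^sub>v c"
      using det_0_iff_vec_prod_zero[OF G] by blast
    have Bv: "B *\<^sub>v v \<in> carrier_vec n" using B v(1) by simp
    have "transpose_mat B *\<^sub>v (B *\<^sub>v v) = 0\<^sub>v c"
      using v(3) unfolding G_def assoc_mult_mat_vec[OF BT B v(1)] .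
    then have "(B *\<^sub>v v) \<bullet> (B *\<^sub>v v) = 0\<^sub>v c \<bullet> v"
      using transpose_vec_mult_scalar[OF B v(1) Bv] by simp
    then have "(B *\<^sub>v v) \<bullet> (B *\<^sub>v v) = 0" using v(1) by simp
    then have "(\<Sum>i<n. ((B *\<^sub>v v) $ i)\<^sup>2) = 0"
      using Bv B by (simp add: scalar_prod_def power2_eq_square atLeast0LessThan del: index_mult_mat_vec)
    then have "\<forall>i\<in>{..<n}. ((B *\<^sub>v v) $ i)\<^sup>2 = 0"
      by (subst (asm) sum_nonneg_eq_0_iff) auto
    then have "B *\<^sub>v v = 0\<^sub>v n"
      using Bv B by (intro eq_vecI) (auto simp del: index_mult_mat_vec)
    then show False using independent_kernel[OF assms] v unfolding B_def c_def by blast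
  qed
  define M where "M = adj_mat G * transpose_mat B"
  have M: "M \<in> carrier_mat c n" unfolding M_def using adj_mat(1)[OF G] B by simp
  have MB: "M * B = Determinant.det G \<cdot>\<^sub>m 1\<^sub>m c"
    unfolding M_def assoc_mult_mat[OF adj_mat(1)[OF G] BT B]
    using adj_mat(3)[OF G] unfolding G_def .
  show thesis
  proof
    show "Determinant.det G \<noteq> 0" by fact
    fix k j assume kj: "k \<in> J" "j \<in> J"
    then have p: "pos k < c" "pos j < c" unfolding c_def by (simp_all add: pos)
    have "(\<Sum>i<n. M $$ (pos k, i) * \<Lambda> $$ (i, j)) = (\<Sum>i<n. M $$ (pos k, i) * B $$ (i, pos j))"
      unfolding B_def using kj by (intro sum.cong refl) (simp add: sub_index pos)
    also have "\<dots> = (M * B) $$ (pos k, pos j)"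
      using M B p by (simp add: scalar_prod_def atLeast0LessThan)
    also have "\<dots> = (if k = j then Determinant.det G else 0)"
      unfolding MB using p pos_inj[OF kj] by simp
    finally show "(\<Sum>i<n. M $$ (pos k, i) * \<Lambda> $$ (i, j)) = (if k = j then Determinant.det G else 0)" .
  qed
qed

lemma independent_right_inverse:
  assumes "columns_independent \<Lambda> J" "card J = n"
  obtains N :: "nat \<Rightarrow> nat \<Rightarrow> int" and d :: int where "d \<noteq> 0"
    "\<And>i l. i < n \<Longrightarrow> l < n \<Longrightarrow> (\<Sum>j\<in>J. \<Lambda> $$ (i, j) * N j l) = (if i = l then d else 0)"
proof -
  define B where "B = submatrix \<Lambda> UNIV J"
  have B: "B \<in> carrier_mat n n" unfolding B_def using sub_carrier assms(2) by simp
  have det: "Determinant.det B \<noteq> 0"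
    using independent_kernel[OF assms(1)] assms(2) det_0_iff_vec_prod_zero[OF B]
    unfolding B_def by auto
  let ?M = "adj_mat B"
  have M: "?M \<in> carrier_mat n n" by (rule adj_mat(1)[OF B])
  show thesis
  proof
    show "Determinant.det B \<noteq> 0" by fact
    fix i l assume il: "i < n" "l < n"
    have "(\<Sum>j\<in>J. \<Lambda> $$ (i, j) * ?M $$ (pos j, l))
        = (\<Sum>k<card J. \<Lambda> $$ (i, pick J k) * ?M $$ (pos (pick J k), l))"
      by (rule sum_pick[symmetric])
    also have "\<dots> = (\<Sum>k<n. B $$ (i, k) * ?M $$ (k, l))"
      unfolding B_def using assms(2) il by (intro sum.cong) (simp_all add: sub_index pos)
    also have "\<dots> = (B * ?M) $$ (i, l)"
      using M B il by (simp add: scalar_prod_def atLeast0LessThan)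
    also have "\<dots> = (if i = l then Determinant.det B else 0)"
      unfolding adj_mat(2)[OF B] using il by simp
    finally show "(\<Sum>j\<in>J. \<Lambda> $$ (i, j) * ?M $$ (pos j, l))
        = (if i = l then Determinant.det B else 0)" .
  qed
qed

end

section \<open>Unimodular column operations\<close>

text \<open>The inverse is recorded explicitly, because the torus automorphism given by \<open>U\<close> is inverted
  with it.\<close>

definition column_equivalent :: "int mat \<Rightarrow> int mat \<Rightarrow> bool" where
  "column_equivalent A B \<longleftrightarrow>
     (\<exists>U\<in>carrier_mat (dim_col A) (dim_col A). \<exists>V\<in>carrier_mat (dim_col A) (dim_col A).
        U * V = 1\<^sub>m (dim_col A) \<and> V * U = 1\<^sub>m (dim_col A) \<and> B = A * U)"

lemma column_equivalent_refl: "column_equivalent A A"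
  unfolding column_equivalent_def by (intro bexI[of _ "1\<^sub>m (dim_col A)"]) simp_all

lemma column_equivalent_dim:
  "column_equivalent A B \<Longrightarrow> dim_row B = dim_row A \<and> dim_col B = dim_col A"
  unfolding column_equivalent_def by auto

lemma column_equivalent_trans:
  assumes "column_equivalent A B" "column_equivalent B C"
  shows "column_equivalent A C"
proof -
  let ?m = "dim_col A"
  obtain U V where U: "U \<in> carrier_mat ?m ?m" and V: "V \<in> carrier_mat ?m ?m"
    and UV: "U * V = 1\<^sub>m ?m" "V * U = 1\<^sub>m ?m" "B = A * U"
    using assms(1) unfolding column_equivalent_def by blast
  have B: "dim_col B = ?m" using UV(3) U by simp
  obtain U' V' where U': "U' \<in> carrier_mat ?m ?m" and V': "V' \<in> carrier_mat ?m ?m"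
    and UV': "U' * V' = 1\<^sub>m ?m" "V' * U' = 1\<^sub>m ?m" "C = B * U'"
    using assms(2) unfolding column_equivalent_def B by blast
  have A: "A \<in> carrier_mat (dim_row A) ?m" by simp
  have "(U * U') * (V' * V) = U * ((U' * V') * V)"
    unfolding assoc_mult_mat[OF U' V' V]
    by (rule assoc_mult_mat[OF U U' mult_carrier_mat[OF V' V]])
  then have 1: "(U * U') * (V' * V) = 1\<^sub>m ?m" using UV UV' V by simp
  have "(V' * V) * (U * U') = V' * ((V * U) * U')"
    unfolding assoc_mult_mat[OF V U U']
    by (rule assoc_mult_mat[OF V' V mult_carrier_mat[OF U U']])
  then have 2: "(V' * V) * (U * U') = 1\<^sub>m ?m" using UV UV' U' by simp
  have "C = A * (U * U')" unfolding UV' UV using A U U' by (rule assoc_mult_mat)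
  then show ?thesis unfolding column_equivalent_def
    using 1 2 mult_carrier_mat[OF U U'] mult_carrier_mat[OF V' V] by blast
qed

lemma column_equivalent_addcol:
  assumes "k < dim_col A" "l < dim_col A" "k \<noteq> l"
  shows "column_equivalent A (addcol a l k A)"
  unfolding column_equivalent_def
proof (intro bexI conjI)
  let ?m = "dim_col A"
  show "addcol a l k A = A * addrow_mat ?m a k l" using assms by (intro addcol_mat) auto
  show "addrow_mat ?m a k l * addrow_mat ?m (- a) k l = 1\<^sub>m ?m"
    using assms by (intro addrow_mat_inv)
  show "addrow_mat ?m (- a) k l * addrow_mat ?m a k l = 1\<^sub>m ?m"
    using addrow_mat_inv[OF assms, of "- a"] by simp
qed simp_all

lemma column_equivalent_swapcols:
  assumes "k < dim_col A" "l < dim_col A"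
  shows "column_equivalent A (swapcols k l A)"
  unfolding column_equivalent_def
proof (intro bexI conjI)
  let ?m = "dim_col A"
  show "swapcols k l A = A * swaprows_mat ?m k l" using assms by (intro swapcols_mat) auto
  show "swaprows_mat ?m k l * swaprows_mat ?m k l = 1\<^sub>m ?m"
    "swaprows_mat ?m k l * swaprows_mat ?m k l = 1\<^sub>m ?m"
    by (rule swaprows_mat_inv[OF assms])+
qed simp_all

text \<open>This is the Euclidean algorithm on the entries of row \<open>k\<close> from the diagonal on, with the sum
  of their absolute values as measure. The operations mix only columns from \<open>k\<close> on, where the
  earlier rows already vanish.\<close>

lemma clear_row:
  assumes "A \<in> carrier_mat n m" "k < n"
    and "\<And>i j. i < k \<Longrightarrow> i < j \<Longrightarrow> j < m \<Longrightarrow> A $$ (i, j) = 0"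
  shows "\<exists>B. column_equivalent A B \<and> (\<forall>i j. i < Suc k \<longrightarrow> i < j \<longrightarrow> j < m \<longrightarrow> B $$ (i, j) = 0)"
  using assms
proof (induction "\<Sum>j\<in>{k..<m}. nat \<bar>A $$ (k, j)\<bar>" arbitrary: A rule: less_induct)
  case (less A)
  note A = less.prems(1) and k = less.prems(2) and zero = less.prems(3)
  show ?case
  proof (cases "\<exists>j l. j \<in> {k..<m} \<and> l \<in> {k..<m} \<and> j \<noteq> l \<and> A $$ (k, j) \<noteq> 0 \<and> A $$ (k, l) \<noteq> 0")
    case True
    then obtain j l where jl: "j \<in> {k..<m}" "l \<in> {k..<m}" "j \<noteq> l"
      "A $$ (k, j) \<noteq> 0" "A $$ (k, l) \<noteq> 0" "\<bar>A $$ (k, j)\<bar> \<le> \<bar>A $$ (k, l)\<bar>"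
      by (metis linorder_le_cases)
    \<comment> \<open>With this sign the absolute value of the larger entry drops by that of the smaller one.\<close>
    let ?c = "- (sgn (A $$ (k, j)) * sgn (A $$ (k, l)))"
    let ?B = "addcol ?c l j A"
    have idx: "?B $$ (i, r) = (if r = l then ?c * A $$ (i, j) + A $$ (i, l) else A $$ (i, r))"
      if "i < n" "r < m" for i r
      using that A by auto
    have eq: "column_equivalent A ?B" using A jl by (intro column_equivalent_addcol) auto
    have dec: "\<bar>?B $$ (k, l)\<bar> < \<bar>A $$ (k, l)\<bar>"
      using jl(2) k jl(4-6) by (subst idx) (auto simp: sgn_if abs_if split: if_splits)
    have smaller: "(\<Sum>j\<in>{k..<m}. nat \<bar>?B $$ (k, j)\<bar>) < (\<Sum>j\<in>{k..<m}. nat \<bar>A $$ (k, j)\<bar>)"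
    proof (rule sum_strict_mono_ex1)
      show "\<forall>x\<in>{k..<m}. nat \<bar>?B $$ (k, x)\<bar> \<le> nat \<bar>A $$ (k, x)\<bar>"
      proof
        fix x assume x: "x \<in> {k..<m}"
        show "nat \<bar>?B $$ (k, x)\<bar> \<le> nat \<bar>A $$ (k, x)\<bar>"
        proof (cases "x = l")
          case True then show ?thesis using dec by simp
        next
          case False then show ?thesis using idx[of k x] k x by simp
        qed
      qed
      show "\<exists>x\<in>{k..<m}. nat \<bar>?B $$ (k, x)\<bar> < nat \<bar>A $$ (k, x)\<bar>"
        using jl(2) dec by (intro bexI[of _ l]) auto
    qed simp
    have B: "?B \<in> carrier_mat n m" using A by auto
    have zeroB: "?B $$ (i, r) = 0" if "i < k" "i < r" "r < m" for i r
      using that k jl zero[of i j] zero[of i l] zero[of i r] by (subst idx) auto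
    from less.hyps[OF smaller B k zeroB]
    show ?thesis using column_equivalent_trans[OF eq] by blast
  next
    case False
    show ?thesis
    proof (cases "\<exists>l. k < l \<and> l < m \<and> A $$ (k, l) \<noteq> 0")
      case True
      then obtain l where l: "k < l" "l < m" "A $$ (k, l) \<noteq> 0" by blast
      let ?B = "swapcols k l A"
      have idx: "?B $$ (i, r) = (if k = r then A $$ (i, l) else if l = r then A $$ (i, k) else A $$ (i, r))"
        if "i < n" "r < m" for i r
        using that A by auto
      have row: "A $$ (k, r) = 0" if "k \<le> r" "r < m" "r \<noteq> l" for r
        using False l that by force
      have "?B $$ (i, r) = 0" if "i < Suc k" "i < r" "r < m" for i r
      proof (cases "i = k")
        case True
        then show ?thesis using that k l row[of k] row[of r] by (subst idx) auto
      next
        case False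
        then show ?thesis using that k l zero[of i l] zero[of i k] zero[of i r] by (subst idx) auto
      qed
      moreover have "column_equivalent A ?B"
        using A l by (intro column_equivalent_swapcols) auto
      ultimately show ?thesis by blast
    next
      case False
      then have "A $$ (i, j) = 0" if "i < Suc k" "i < j" "j < m" for i j
        using that zero[of i j] by (cases "i = k") auto
      then show ?thesis using column_equivalent_refl by blast
    qed
  qed
qed

lemma column_reduction:
  fixes A :: "int mat"
  assumes A: "A \<in> carrier_mat n m"
  obtains U V where "U \<in> carrier_mat m m" "V \<in> carrier_mat m m" "U * V = 1\<^sub>m m" "V * U = 1\<^sub>m m"
    "\<And>i j. i < n \<Longrightarrow> n \<le> j \<Longrightarrow> j < m \<Longrightarrow> (A * U) $$ (i, j) = 0"
proof -
  have "\<exists>B. column_equivalent A B \<and> (\<forall>i j. i < k \<longrightarrow> i < j \<longrightarrow> j < m \<longrightarrow> B $$ (i, j) = 0)"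
    if "k \<le> n" for k
    using that
  proof (induction k)
    case 0
    show ?case using column_equivalent_refl by auto
  next
    case (Suc k)
    then obtain B where B: "column_equivalent A B"
      "\<And>i j. i < k \<Longrightarrow> i < j \<Longrightarrow> j < m \<Longrightarrow> B $$ (i, j) = 0" by auto
    have "B \<in> carrier_mat n m" using column_equivalent_dim[OF B(1)] A by auto
    moreover have "k < n" using Suc.prems by simp
    ultimately obtain C where "column_equivalent B C"
      "\<forall>i j. i < Suc k \<longrightarrow> i < j \<longrightarrow> j < m \<longrightarrow> C $$ (i, j) = 0"
      using clear_row[of B n m k] B(2) by metis
    then show ?case using column_equivalent_trans[OF B(1)] by blast
  qed
  from this[of n] obtain B where B: "column_equivalent A B"
    "\<And>i j. i < n \<Longrightarrow> i < j \<Longrightarrow> j < m \<Longrightarrow> B $$ (i, j) = 0" by blast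
  have m: "dim_col A = m" using A by simp
  obtain U V where UV: "U \<in> carrier_mat m m" "V \<in> carrier_mat m m" "U * V = 1\<^sub>m m" "V * U = 1\<^sub>m m"
    and BU: "B = A * U"
    using B(1) unfolding column_equivalent_def m by blast
  show thesis
  proof (rule that[OF UV])
    fix i j assume "i < n" "n \<le> j" "j < m"
    then show "(A * U) $$ (i, j) = 0" using B(2)[of i j] BU by simp
  qed
qed

section \<open>Evaluation of polynomials\<close>

definition monomial_value :: "('x \<Rightarrow> 'b::comm_monoid_mult) \<Rightarrow> ('x \<Rightarrow>\<^sub>0 nat) \<Rightarrow> 'b" where
  "monomial_value h e = (\<Prod>x\<in>Poly_Mapping.keys e. h x ^ Poly_Mapping.lookup e x)"

definition mpoly_eval ::
    "('r::zero \<Rightarrow> 'b::comm_semiring_1) \<Rightarrow> ('x \<Rightarrow> 'b) \<Rightarrow> ('x, 'r) mpoly \<Rightarrow> 'b" where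
  "mpoly_eval c h p = (\<Sum>e\<in>Poly_Mapping.keys p. c (Poly_Mapping.lookup p e) * monomial_value h e)"

lemma monomial_value_superset:
  assumes "finite S" "Poly_Mapping.keys e \<subseteq> S"
  shows "monomial_value h e = (\<Prod>x\<in>S. h x ^ Poly_Mapping.lookup e x)"
  unfolding monomial_value_def using assms
  by (intro prod.mono_neutral_left) (auto simp: in_keys_iff)

lemma monomial_value_0 [simp]: "monomial_value h 0 = 1"
  by (simp add: monomial_value_def)

lemma monomial_value_single [simp]: "monomial_value h (Poly_Mapping.single x k) = h x ^ k"
  by (subst monomial_value_superset[of "{x}"]) auto

lemma monomial_value_add:
  "monomial_value h (e + f) = monomial_value h e * monomial_value h f"
proof -
  let ?S = "Poly_Mapping.keys e \<union> Poly_Mapping.keys f"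
  have S: "finite ?S" by simp
  have "monomial_value h (e + f) = (\<Prod>x\<in>?S. h x ^ Poly_Mapping.lookup (e + f) x)"
    using S keys_add by (rule monomial_value_superset)
  also have "\<dots> = (\<Prod>x\<in>?S. h x ^ Poly_Mapping.lookup e x) * (\<Prod>x\<in>?S. h x ^ Poly_Mapping.lookup f x)"
    by (simp add: lookup_add power_add prod.distrib)
  also have "\<dots> = monomial_value h e * monomial_value h f"
    using monomial_value_superset[OF S, of e h] monomial_value_superset[OF S, of f h] by simp
  finally show ?thesis .
qed

lemma poly_mapping_sum_single:
  "(\<Sum>e\<in>Poly_Mapping.keys p. Poly_Mapping.single e (Poly_Mapping.lookup p e)) = p"
proof (rule poly_mapping_eqI)
  fix k
  have "Poly_Mapping.lookup (\<Sum>e\<in>Poly_Mapping.keys p. Poly_Mapping.single e (Poly_Mapping.lookup p e)) k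
      = (\<Sum>e\<in>Poly_Mapping.keys p. if e = k then Poly_Mapping.lookup p e else 0)"
    by (simp add: lookup_sum lookup_single when_def)
  also have "\<dots> = Poly_Mapping.lookup p k"
    by (simp add: sum.delta in_keys_iff)
  finally show "Poly_Mapping.lookup (\<Sum>e\<in>Poly_Mapping.keys p.
      Poly_Mapping.single e (Poly_Mapping.lookup p e)) k = Poly_Mapping.lookup p k" .
qed

text \<open>A ring homomorphism on the coefficients; with it \<open>mpoly_eval c h\<close> is the homomorphism of
  polynomial rings that sends the variable \<open>x\<close> to \<open>h x\<close>.\<close>

locale coefficient_hom =
  fixes c :: "'r::comm_ring_1 \<Rightarrow> 'b::comm_ring_1"
  assumes c_add: "c (a + b) = c a + c b"
    and c_mult: "c (a * b) = c a * c b"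
    and c_one: "c 1 = 1"
begin

lemma c_zero: "c 0 = 0"
  using c_add[of 0 0] by simp

lemma c_uminus: "c (- a) = - c a"
  using c_add[of a "- a"] c_zero by (simp add: eq_neg_iff_add_eq_0 add.commute)

lemma eval_superset:
  assumes "finite S" "Poly_Mapping.keys p \<subseteq> S"
  shows "mpoly_eval c h p = (\<Sum>e\<in>S. c (Poly_Mapping.lookup p e) * monomial_value h e)"
  unfolding mpoly_eval_def using assms
  by (intro sum.mono_neutral_left) (auto simp: in_keys_iff c_zero)

lemma eval_single: "mpoly_eval c h (Poly_Mapping.single e a) = c a * monomial_value h e"
  by (subst eval_superset[of "{e}"]) auto

lemma eval_zero: "mpoly_eval c h 0 = 0"
  by (simp add: mpoly_eval_def)

lemma eval_add: "mpoly_eval c h (p + q) = mpoly_eval c h p + mpoly_eval c h q"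
proof -
  let ?S = "Poly_Mapping.keys p \<union> Poly_Mapping.keys q"
  have S: "finite ?S" by simp
  have "mpoly_eval c h (p + q)
      = (\<Sum>e\<in>?S. c (Poly_Mapping.lookup (p + q) e) * monomial_value h e)"
    using S keys_add by (rule eval_superset)
  also have "\<dots> = (\<Sum>e\<in>?S. c (Poly_Mapping.lookup p e) * monomial_value h e)
      + (\<Sum>e\<in>?S. c (Poly_Mapping.lookup q e) * monomial_value h e)"
    by (simp add: lookup_add c_add algebra_simps sum.distrib)
  also have "\<dots> = mpoly_eval c h p + mpoly_eval c h q"
    using eval_superset[OF S, of p h] eval_superset[OF S, of q h] by simp
  finally show ?thesis .
qed

lemma eval_sum: "mpoly_eval c h (\<Sum>i\<in>I. p i) = (\<Sum>i\<in>I. mpoly_eval c h (p i))"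
  by (induction I rule: infinite_finite_induct) (simp_all add: eval_zero eval_add)

lemma eval_mult: "mpoly_eval c h (p * q) = mpoly_eval c h p * mpoly_eval c h q"
proof -
  let ?P = "Poly_Mapping.keys p" and ?Q = "Poly_Mapping.keys q"
  let ?p = "Poly_Mapping.lookup p" and ?q = "Poly_Mapping.lookup q"
  have "p * q = (\<Sum>e\<in>?P. Poly_Mapping.single e (?p e)) * (\<Sum>f\<in>?Q. Poly_Mapping.single f (?q f))"
    by (simp only: poly_mapping_sum_single)
  also have "\<dots> = (\<Sum>e\<in>?P. \<Sum>f\<in>?Q. Poly_Mapping.single (e + f) (?p e * ?q f))"
    by (simp only: sum_product mult_single)
  finally have "mpoly_eval c h (p * q)
      = (\<Sum>e\<in>?P. \<Sum>f\<in>?Q. (c (?p e) * monomial_value h e) * (c (?q f) * monomial_value h f))"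
    by (simp add: eval_sum eval_single monomial_value_add c_mult algebra_simps)
  then show ?thesis unfolding mpoly_eval_def by (simp only: sum_product)
qed

lemma eval_PConst: "mpoly_eval c h (PConst a) = c a"
  by (simp add: PConst_def eval_single)

lemma eval_PVar: "mpoly_eval c h (PVar x) = h x"
  by (simp add: PVar_def eval_single c_one)

lemma eval_one: "mpoly_eval c h 1 = 1"
  using eval_single[of h 0 1] by (simp add: c_one)

lemma eval_uminus: "mpoly_eval c h (- p) = - mpoly_eval c h p"
  using eval_add[of h p "- p"] by (simp add: eval_zero eq_neg_iff_add_eq_0 add.commute)

lemma eval_diff: "mpoly_eval c h (p - q) = mpoly_eval c h p - mpoly_eval c h q"
  using eval_add[of h p "- q"] by (simp add: eval_uminus)

lemma eval_power: "mpoly_eval c h (p ^ k) = mpoly_eval c h p ^ k"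
  by (induction k) (simp_all add: eval_one eval_mult)

lemma eval_prod: "mpoly_eval c h (\<Prod>i\<in>I. p i) = (\<Prod>i\<in>I. mpoly_eval c h (p i))"
  by (induction I rule: infinite_finite_induct) (simp_all add: eval_one eval_mult)

lemmas eval_simps = eval_zero eval_one eval_add eval_diff eval_uminus eval_mult eval_sum
  eval_power eval_prod eval_PConst eval_PVar

lemma eval_substitute:
  "mpoly_eval c h (mpoly_eval PConst T p) = mpoly_eval c (\<lambda>x. mpoly_eval c h (T x)) p"
  unfolding mpoly_eval_def[of PConst] mpoly_eval_def[of c "\<lambda>x. mpoly_eval c h (T x)"]
    monomial_value_def
  by (simp add: eval_simps)

end

lemma coefficient_hom_PConst: "coefficient_hom (PConst :: 'r::comm_ring_1 \<Rightarrow> ('x, 'r) mpoly)"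
  by unfold_locales (simp_all add: PConst_def single_add mult_single)

interpretation PConst: coefficient_hom "PConst :: 'r::comm_ring_1 \<Rightarrow> ('x, 'r) mpoly"
  by (rule coefficient_hom_PConst)

interpretation pCons: coefficient_hom "\<lambda>a::'r::comm_ring_1. [:a:]"
  by unfold_locales simp_all

lemma PVar_power: "PVar x ^ k = Poly_Mapping.single (Poly_Mapping.single x k) (1::'r::comm_ring_1)"
proof (induction k)
  case (Suc k)
  then show ?case
    by (simp add: PVar_def mult_single single_add[symmetric])
qed simp

lemma single_as_monomial:
  "Poly_Mapping.single e (a::'r::comm_ring_1) = PConst a * monomial_value PVar e"
proof -
  have "Poly_Mapping.single (\<Sum>x\<in>S. Poly_Mapping.single x (f x)) (1::'r) = (\<Prod>x\<in>S. PVar x ^ f x)"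
    if "finite S" for S and f :: "_ \<Rightarrow> nat"
    using that
  proof induction
    case (insert x S)
    have "Poly_Mapping.single (Poly_Mapping.single x (f x) + (\<Sum>x\<in>S. Poly_Mapping.single x (f x))) (1::'r)
       = Poly_Mapping.single (Poly_Mapping.single x (f x)) 1
         * Poly_Mapping.single (\<Sum>x\<in>S. Poly_Mapping.single x (f x)) 1"
      by (simp add: mult_single)
    then show ?case using insert by (simp add: PVar_power)
  qed simp
  from this[of "Poly_Mapping.keys e" "Poly_Mapping.lookup e"]
  have "Poly_Mapping.single e (1::'r) = monomial_value PVar e"
    by (simp add: poly_mapping_sum_single monomial_value_def)
  then show ?thesis
    unfolding PConst_def by (metis add_0 mult.right_neutral mult_single)
qed

lemma mpoly_induct [case_names one add const var]:
  fixes P :: "('x, 'r::comm_ring_1) mpoly \<Rightarrow> bool"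
  assumes one: "P 1"
    and add: "\<And>p q. P p \<Longrightarrow> P q \<Longrightarrow> P (p + q)"
    and const: "\<And>a p. P p \<Longrightarrow> P (PConst a * p)"
    and var: "\<And>x p. P p \<Longrightarrow> P (PVar x * p)"
  shows "P p"
proof -
  have zero: "P 0" using const[OF one, of 0] by (simp add: PConst_def)
  have pow: "P (PVar x ^ k * q)" if "P q" for x k q
    by (induction k) (simp_all add: that var mult.assoc)
  have mon: "P (\<Prod>x\<in>S. PVar x ^ f x)" if "finite S" for S and f :: "'x \<Rightarrow> nat"
    using that by induction (simp_all add: one pow)
  have "P (Poly_Mapping.single e a)" for e a
    unfolding single_as_monomial monomial_value_def by (rule const[OF mon]) simp
  then have "P (\<Sum>e\<in>E. Poly_Mapping.single e (Poly_Mapping.lookup p e))" for E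
    by (induction E rule: infinite_finite_induct) (simp_all add: zero add)
  then show ?thesis by (metis poly_mapping_sum_single)
qed

lemma polys_in_closed:
  fixes p q :: "(nat, 'r::comm_ring_1) mpoly"
  shows "PConst a \<in> polys_in n" "i < n \<Longrightarrow> (PVar i :: (nat, 'r) mpoly) \<in> polys_in n"
    and "p \<in> polys_in n \<Longrightarrow> q \<in> polys_in n \<Longrightarrow> p + q \<in> polys_in n"
    and "p \<in> polys_in n \<Longrightarrow> q \<in> polys_in n \<Longrightarrow> p * q \<in> polys_in n"
proof -
  show "PConst a \<in> polys_in n" "i < n \<Longrightarrow> (PVar i :: (nat, 'r) mpoly) \<in> polys_in n"
    by (simp_all add: polys_in_def PConst_def PVar_def)
  assume pq: "p \<in> polys_in n" "q \<in> polys_in n"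
  show "p + q \<in> polys_in n"
    unfolding polys_in_def
  proof (intro CollectI ballI)
    fix e assume "e \<in> Poly_Mapping.keys (p + q)"
    then have "e \<in> Poly_Mapping.keys p \<union> Poly_Mapping.keys q" using keys_add by (rule rev_subsetD)
    then show "Poly_Mapping.keys e \<subseteq> {..<n}" using pq unfolding polys_in_def by auto
  qed
  show "p * q \<in> polys_in n"
    unfolding polys_in_def
  proof (intro CollectI ballI)
    fix e assume "e \<in> Poly_Mapping.keys (p * q)"
    then obtain a b where ab: "a \<in> Poly_Mapping.keys p" "b \<in> Poly_Mapping.keys q" "e = a + b"
      using keys_mult[of p q] by blast
    then have "Poly_Mapping.keys e \<subseteq> Poly_Mapping.keys a \<union> Poly_Mapping.keys b"
      using keys_add[of a b] by simp
    then show "Poly_Mapping.keys e \<subseteq> {..<n}" using pq ab(1,2) unfolding polys_in_def by fastforce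
  qed
qed

text \<open>Uniqueness of digits in base \<open>B\<close>; the leading digit is the quotient by the highest power.\<close>

lemma base_expansion_unique:
  fixes e f :: "nat \<Rightarrow> nat"
  assumes "(\<Sum>i<n. e i * B ^ i) = (\<Sum>i<n. f i * B ^ i)"
    and "\<And>i. i < n \<Longrightarrow> e i < B" "\<And>i. i < n \<Longrightarrow> f i < B" and "i < n"
  shows "e i = f i"
  using assms
proof (induction n arbitrary: i)
  case (Suc n)
  have less: "(\<Sum>i<k. g i * B ^ i) < B ^ k" if "\<And>i. i < k \<Longrightarrow> g i < B" for g k
    using that
  proof (induction k)
    case (Suc k)
    then have "(\<Sum>i<k. g i * B ^ i) < B ^ k" "Suc (g k) \<le> B" by (simp_all add: Suc_leI)
    then have "(\<Sum>i<Suc k. g i * B ^ i) < Suc (g k) * B ^ k" by simp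
    also have "\<dots> \<le> B * B ^ k" by (rule mult_le_mono1) fact
    finally show ?case by simp
  qed simp
  have e: "(\<Sum>i<n. e i * B ^ i) < B ^ n" and f: "(\<Sum>i<n. f i * B ^ i) < B ^ n"
    using less[of n e] less[of n f] Suc.prems by simp_all
  have eq: "(\<Sum>i<n. e i * B ^ i) + e n * B ^ n = (\<Sum>i<n. f i * B ^ i) + f n * B ^ n"
    using Suc.prems(1) by simp
  have quot: "(s + k * B ^ n) div B ^ n = k" if "s < B ^ n" for s k :: nat
  proof -
    have "B ^ n \<noteq> 0" using that by (metis not_less_zero)
    then show ?thesis using that by (subst div_mult_self1) simp_all
  qed
  have top: "e n = f n" using quot[OF e, of "e n"] quot[OF f, of "f n"] unfolding eq by (rule trans[OF sym])
  then have "(\<Sum>i<n. e i * B ^ i) = (\<Sum>i<n. f i * B ^ i)" using eq by simp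
  then have "e j = f j" if "j < n" for j
    using Suc.IH[of j] Suc.prems(2,3) that by simp
  then show ?case using top Suc.prems(4) by (cases "i = n") auto
qed simp

text \<open>Substituting \<open>x ^ (B ^ i)\<close> for the \<open>i\<close>-th variable sends a monomial to the power of
  \<open>x\<close> whose base \<open>B\<close> digits are its exponents. If \<open>B\<close> exceeds all exponents, distinct
  monomials stay distinct, so no nonzero polynomial is killed.\<close>

lemma kronecker_substitution:
  fixes p :: "(nat, rat) mpoly"
  assumes p: "p \<in> polys_in n"
    and B: "\<And>e i. e \<in> Poly_Mapping.keys p \<Longrightarrow> Poly_Mapping.lookup e i < B"
    and 0: "mpoly_eval (\<lambda>a. [:a:]) (\<lambda>i. Polynomial.monom 1 (B ^ i)) p = 0"
  shows "p = 0"
proof (rule ccontr)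
  assume "p \<noteq> 0"
  define code where "code e = (\<Sum>i<n. Poly_Mapping.lookup e i * B ^ i)" for e :: "nat \<Rightarrow>\<^sub>0 nat"
  have keys: "Poly_Mapping.keys e \<subseteq> {..<n}" if "e \<in> Poly_Mapping.keys p" for e
    using p that by (simp add: polys_in_def)
  have mon: "(\<Prod>i\<in>I. Polynomial.monom (1::rat) (f i)) = Polynomial.monom 1 (\<Sum>i\<in>I. f i)"
    for I and f :: "nat \<Rightarrow> nat"
    by (induction I rule: infinite_finite_induct) (simp_all add: mult_monom)
  have val: "monomial_value (\<lambda>i. Polynomial.monom (1::rat) (B ^ i)) e = Polynomial.monom 1 (code e)"
    if e: "e \<in> Poly_Mapping.keys p" for e
    using monomial_value_superset[OF _ keys[OF e], of "\<lambda>i. Polynomial.monom (1::rat) (B ^ i)"] mon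
    by (simp add: code_def monom_power mult.commute)
  obtain e0 where e0: "e0 \<in> Poly_Mapping.keys p"
    using \<open>p \<noteq> 0\<close> by (metis all_not_in_conv keys_eq_empty)
  have inj: "e = e0" if e: "e \<in> Poly_Mapping.keys p" and c: "code e = code e0" for e
  proof (rule poly_mapping_eqI)
    fix i
    show "Poly_Mapping.lookup e i = Poly_Mapping.lookup e0 i"
    proof (cases "i < n")
      case True
      show ?thesis
        by (rule base_expansion_unique[of "Poly_Mapping.lookup e" B n "Poly_Mapping.lookup e0" i])
          (use c B[OF e] B[OF e0] True in \<open>simp_all add: code_def\<close>)
    next
      case False
      then have "i \<notin> Poly_Mapping.keys e" "i \<notin> Poly_Mapping.keys e0"
        using keys[OF e] keys[OF e0] by auto
      then show ?thesis by (simp add: in_keys_iff)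
    qed
  qed
  have "0 = Polynomial.coeff (mpoly_eval (\<lambda>a. [:a:]) (\<lambda>i. Polynomial.monom 1 (B ^ i)) p) (code e0)"
    using 0 by simp
  also have "\<dots> = (\<Sum>e\<in>Poly_Mapping.keys p.
      if e = e0 then Poly_Mapping.lookup p e else 0)"
    unfolding mpoly_eval_def Polynomial.coeff_sum
    by (intro sum.cong refl) (auto simp: val dest: inj)
  also have "\<dots> = Poly_Mapping.lookup p e0" using e0 by simp
  finally show False using e0 by (simp add: in_keys_iff)
qed

section \<open>Relations and values in the face ring\<close>

lemma face_class_add: "face_class (p + q) = face_class p \<oplus>\<^bsub>face_ring\<^esub> face_class q"
  using ring_hom_add[OF face_class_hom, of p q] by simp

lemma face_class_mult: "face_class (p * q) = face_class p \<otimes>\<^bsub>face_ring\<^esub> face_class q"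
  using ring_hom_mult[OF face_class_hom, of p q] by simp

text \<open>Congruence modulo the face ideal is expressed throughout as equality of classes.\<close>

lemma face_class_cong_add:
  "face_class p = face_class p' \<Longrightarrow> face_class q = face_class q' \<Longrightarrow>
     face_class (p + q) = face_class (p' + q')"
  by (simp add: face_class_add)

lemma face_class_cong_mult:
  "face_class p = face_class p' \<Longrightarrow> face_class q = face_class q' \<Longrightarrow>
     face_class (p * q) = face_class (p' * q')"
  by (simp add: face_class_mult)

lemma face_class_cong_sum:
  "(\<And>i. i \<in> I \<Longrightarrow> face_class (p i) = face_class (q i)) \<Longrightarrow>
     face_class (\<Sum>i\<in>I. p i) = face_class (\<Sum>i\<in>I. q i)"
proof (induction I rule: infinite_finite_induct)
  case (insert i I)
  have "face_class (p i + sum p I) = face_class (q i + sum q I)"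
    using insert by (intro face_class_cong_add) blast+
  then show ?case using insert(1,2) by simp
qed simp_all

lemma face_class_eq_iff: "face_class p = face_class q \<longleftrightarrow> p - q \<in> face_ideal"
  using ring.quotient_eq_iff_same_a_r_cos[OF class_ring.ring_axioms face_ideal_ideal, of p q]
  unfolding face_class_def by (simp add: class_ring_simps)

lemma face_class_zero: "face_class 0 = \<zero>\<^bsub>face_ring\<^esub>"
  using ring_hom_zero[OF face_class_hom class_ring.ring_axioms cring.axioms(1)[OF face_ring_is_cring]]
  by simp

lemma carrier_face_ring: "carrier face_ring = range face_class"
  unfolding face_ring_def face_class_def FactRing_def A_RCOSETS_def' by auto

lemma face_relation_in_ideal: "r \<in> face_relations \<Longrightarrow> r \<in> face_ideal"
  unfolding face_ideal_def
  using ring.genideal_self[OF class_ring.ring_axioms, of face_relations] by auto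

lemma face_class_bot: "face_class (PVar bot) = face_class 1"
  unfolding face_class_eq_iff
  by (rule face_relation_in_ideal) (simp add: face_relations_def)

lemma face_class_PVar_mult:
  "face_class (PVar \<sigma> * PVar \<tau>)
     = face_class (PVar (the_elem (meets \<sigma> \<tau>)) * (\<Sum>\<eta>\<in>joins \<sigma> \<tau>. PVar \<eta>))"
  unfolding face_class_eq_iff
  by (rule face_relation_in_ideal) (unfold face_relations_def, blast)

text \<open>The evaluation vanishes on an ideal, so it factors through the face ring as soon as it respects
  the generating relations.\<close>

lemma (in coefficient_hom) eval_face_class_cong:
  fixes h :: "'a::{finite,order_bot} \<Rightarrow> 'b"
  assumes bot: "h bot = 1"
    and rel: "\<And>\<sigma> \<tau>. h \<sigma> * h \<tau> = h (the_elem (meets \<sigma> \<tau>)) * (\<Sum>\<eta>\<in>joins \<sigma> \<tau>. h \<eta>)"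
    and eq: "face_class p = face_class q"
  shows "mpoly_eval c h p = mpoly_eval c h q"
proof -
  let ?K = "{p. mpoly_eval c h p = 0}"
  have "mpoly_eval c h \<in> Ring.ring_hom class_ring class_ring"
    by (rule ring_hom_memI) (simp_all add: eval_simps)
  from ring_hom_ring.kernel_is_ideal[OF ring_hom_ringI2[OF class_ring.ring_axioms class_ring.ring_axioms this]]
  have "ideal ?K class_ring" by (simp add: a_kernel_def kernel_def)
  moreover have "face_relations \<subseteq> ?K"
    unfolding face_relations_def by (auto simp: eval_simps bot rel)
  ultimately have "face_ideal \<subseteq> ?K"
    unfolding face_ideal_def by (rule ring.genideal_minimal[OF class_ring.ring_axioms])
  then have "mpoly_eval c h (p - q) = 0" using eq unfolding face_class_eq_iff by blast
  then show ?thesis by (simp add: eval_simps)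
qed

lemma face_eval_face_class:
  "face_eval (\<lambda>i. face_class (T i)) p = face_class (mpoly_eval PConst T p)"
proof -
  interpret h: ring_hom_cring class_ring face_ring face_class
    by (intro ring_hom_cringI ring_hom_ringI2 class_ring_is_cring face_ring_is_cring face_class_hom
        cring.axioms(1)[OF class_ring_is_cring] cring.axioms(1)[OF face_ring_is_cring])
  have pow: "face_class (T i) [^]\<^bsub>face_ring\<^esub> k = face_class (T i ^ k)" for i k
    by (induction k) (simp_all add: face_class_mult[symmetric] power_commutes
      ring_hom_one[OF face_class_hom, simplified, symmetric])
  have prod: "(\<Otimes>\<^bsub>face_ring\<^esub>i\<in>I. face_class (f i)) = face_class (\<Prod>i\<in>I. f i)" for I f
    using h.hom_finprod[of f I] by (simp add: class_ring_simps comp_def)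
  have sum: "(\<Oplus>\<^bsub>face_ring\<^esub>i\<in>I. face_class (f i)) = face_class (\<Sum>i\<in>I. f i)" for I f
    using h.hom_finsum[of f I] by (simp add: class_ring_simps comp_def)
  show ?thesis
    unfolding face_eval_def mpoly_eval_def monomial_value_def
    by (simp only: pow prod face_class_mult[symmetric] sum)
qed

text \<open>Spans over a subring are stated with polynomial representatives here, so that the remaining
  argument can be carried out in the polynomial ring.\<close>

lemma mem_Span_face_class:
  "x \<in> ring.Span face_ring (face_class ` K) (map face_class us) \<longleftrightarrow>
     (\<exists>ks. length ks = length us \<and> set ks \<subseteq> K \<and> x = face_class (\<Sum>(k, u)\<leftarrow>zip ks us. k * u))"
proof -
  interpret F: ring face_ring by (rule cring.axioms(1)[OF face_ring_is_cring])
  show ?thesis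
  proof (induction us arbitrary: x)
    case Nil
    show ?case by (auto simp: face_class_zero)
  next
    case (Cons u us)
    let ?comb = "\<lambda>ks us. \<Sum>(k, u)\<leftarrow>zip ks us. k * u"
    have step: "x \<in> F.Span (face_class ` K) (map face_class (u # us)) \<longleftrightarrow>
       (\<exists>k\<in>face_class ` K. \<exists>v\<in>F.Span (face_class ` K) (map face_class us).
          x = k \<otimes>\<^bsub>face_ring\<^esub> face_class u \<oplus>\<^bsub>face_ring\<^esub> v)"
      by (simp add: F.line_extension_mem_iff)
    show ?case
    proof
      assume "x \<in> F.Span (face_class ` K) (map face_class (u # us))"
      then obtain k v where k: "k \<in> K" and v: "v \<in> F.Span (face_class ` K) (map face_class us)"
        and x: "x = face_class k \<otimes>\<^bsub>face_ring\<^esub> face_class u \<oplus>\<^bsub>face_ring\<^esub> v"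
        unfolding step by (elim bexE imageE) simp
      obtain ks where ks: "length ks = length us" "set ks \<subseteq> K" "v = face_class (?comb ks us)"
        using v unfolding Cons.IH by (elim exE conjE)
      show "\<exists>ks. length ks = length (u # us) \<and> set ks \<subseteq> K \<and> x = face_class (?comb ks (u # us))"
        using k ks x by (intro exI[of _ "k # ks"]) (simp add: face_class_add face_class_mult)
    next
      assume "\<exists>ks. length ks = length (u # us) \<and> set ks \<subseteq> K \<and> x = face_class (?comb ks (u # us))"
      then obtain kks where kks: "length kks = length (u # us)" "set kks \<subseteq> K"
        "x = face_class (?comb kks (u # us))" by (elim exE conjE)
      then obtain k ks where k: "kks = k # ks" by (cases kks) auto
      have "face_class (?comb ks us) \<in> F.Span (face_class ` K) (map face_class us)"
        unfolding Cons.IH using kks k by (intro exI[of _ ks]) simp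
      moreover have "x = face_class k \<otimes>\<^bsub>face_ring\<^esub> face_class u \<oplus>\<^bsub>face_ring\<^esub> face_class (?comb ks us)"
        using kks k by (simp add: face_class_add face_class_mult)
      moreover have "face_class k \<in> face_class ` K" using kks k by simp
      ultimately show "x \<in> F.Span (face_class ` K) (map face_class (u # us))"
        unfolding step by (intro bexI)
    qed
  qed
qed

text \<open>The restriction of the face ring to the face \<open>\<sigma>\<close>, which is a polynomial ring in the vertices
  of \<open>\<sigma>\<close>, followed by evaluation at \<open>w\<close>.\<close>

definition face_value ::
    "nat \<Rightarrow> (nat \<Rightarrow> 'a::order_bot) \<Rightarrow> 'a \<Rightarrow> (nat \<Rightarrow> 'b::comm_semiring_1) \<Rightarrow> 'a \<Rightarrow> 'b" where
  "face_value m vert \<sigma> w \<tau> = (if \<tau> \<le> \<sigma> then \<Prod>j\<in>vertices_of m vert \<tau>. w j else 0)"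

definition linear_form :: "(nat \<Rightarrow> 'a) \<Rightarrow> int mat \<Rightarrow> nat \<Rightarrow> ('a, 'r::comm_ring_1) mpoly" where
  "linear_form vert \<Lambda> i = (\<Sum>j<dim_col \<Lambda>. PConst (of_int (\<Lambda> $$ (i, j))) * PVar (vert j))"

lemma linear_element_face_class: "linear_element vert \<Lambda> i = face_class (linear_form vert \<Lambda> i)"
  by (simp add: linear_element_def linear_form_def)

context numbered_simplicial_poset
begin

lemma face_value_bot: "face_value m vert \<sigma> w bot = 1"
  by (simp add: face_value_def)

lemma face_value_vert:
  "j < m \<Longrightarrow> face_value m vert \<sigma> w (vert j) = (if j \<in> V \<sigma> then w j else 0)"
  using V_vert[of j] by (simp add: face_value_def vertices_of_def)

text \<open>If both faces lie below \<open>\<sigma>\<close>, precisely one of their joins does, and the identity reads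
  \<open>\<Prod>\<^sub>A w \<cdot> \<Prod>\<^sub>B w = \<Prod>\<^bsub>A \<inter> B\<^esub> w \<cdot> \<Prod>\<^bsub>A \<union> B\<^esub> w\<close> for their vertex
  sets \<open>A\<close> and \<open>B\<close>. Otherwise no join lies below \<open>\<sigma>\<close> and both sides are zero.\<close>

lemma face_value_relation:
  fixes w :: "nat \<Rightarrow> 'b::comm_ring_1"
  shows "face_value m vert \<sigma> w \<alpha> * face_value m vert \<sigma> w \<beta>
     = face_value m vert \<sigma> w (the_elem (meets \<alpha> \<beta>)) * (\<Sum>\<eta>\<in>joins \<alpha> \<beta>. face_value m vert \<sigma> w \<eta>)"
proof (cases "\<alpha> \<le> \<sigma> \<and> \<beta> \<le> \<sigma>")
  case True
  obtain \<eta> where \<eta>: "{\<xi> \<in> joins \<alpha> \<beta>. \<xi> \<le> \<sigma>} = {\<eta>}"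
    using join_below True by blast
  have \<eta>J: "\<eta> \<in> joins \<alpha> \<beta>" "\<eta> \<le> \<sigma>" using \<eta> by blast+
  obtain \<gamma> where \<gamma>: "meets \<alpha> \<beta> = {\<gamma>}" "\<gamma> \<le> \<alpha>" "V \<gamma> = V \<alpha> \<inter> V \<beta>"
    using meet_below True by blast
  have "(\<Sum>\<xi>\<in>joins \<alpha> \<beta>. face_value m vert \<sigma> w \<xi>)
      = (\<Sum>\<xi>\<in>{\<xi> \<in> joins \<alpha> \<beta>. \<xi> \<le> \<sigma>}. face_value m vert \<sigma> w \<xi>)"
    by (intro sum.mono_neutral_right) (auto simp: face_value_def)
  also have "\<dots> = (\<Prod>j\<in>V \<alpha> \<union> V \<beta>. w j)"
    unfolding \<eta> using \<eta>J by (simp add: face_value_def joins_iff)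
  finally have join: "(\<Sum>\<xi>\<in>joins \<alpha> \<beta>. face_value m vert \<sigma> w \<xi>) = (\<Prod>j\<in>V \<alpha> \<union> V \<beta>. w j)" .
  have "\<gamma> \<le> \<sigma>" using \<gamma>(2) True by (meson order_trans)
  then have meet: "face_value m vert \<sigma> w (the_elem (meets \<alpha> \<beta>)) = (\<Prod>j\<in>V \<alpha> \<inter> V \<beta>. w j)"
    unfolding \<gamma>(1) by (simp add: face_value_def \<gamma>(3))
  have "(\<Prod>j\<in>V \<alpha> \<inter> V \<beta>. w j) * (\<Prod>j\<in>V \<alpha> \<union> V \<beta>. w j)
      = (\<Prod>j\<in>V \<alpha>. w j) * (\<Prod>j\<in>V \<beta>. w j)"
    using prod.union_inter[of "V \<alpha>" "V \<beta>" w] by (simp add: mult.commute)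
  then show ?thesis unfolding join meet using True by (simp add: face_value_def)
next
  case False
  have "face_value m vert \<sigma> w \<eta> = 0" if "\<eta> \<in> joins \<alpha> \<beta>" for \<eta>
  proof -
    have "\<alpha> \<le> \<eta>" "\<beta> \<le> \<eta>" using that by (simp_all add: joins_iff)
    then have "\<not> \<eta> \<le> \<sigma>" using False order_trans[of \<alpha> \<eta> \<sigma>] order_trans[of \<beta> \<eta> \<sigma>] by blast
    then show ?thesis by (simp add: face_value_def)
  qed
  then have "(\<Sum>\<eta>\<in>joins \<alpha> \<beta>. face_value m vert \<sigma> w \<eta>) = 0" by simp
  then show ?thesis using False by (auto simp: face_value_def)
qed

lemmas eval_face_value_cong =
  coefficient_hom.eval_face_class_cong[OF _ face_value_bot face_value_relation]

lemma joins_empty_product: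
  "joins \<sigma> \<tau> = {} \<Longrightarrow> face_class (PVar \<sigma> * PVar (\<tau>::'a)) = face_class 0"
  using face_class_PVar_mult[of \<sigma> \<tau>] by simp

text \<open>The meet of a face with a vertex outside it is the initial element, whose variable is 1.\<close>

lemma vert_product:
  assumes "j < m" "j \<notin> V \<sigma>"
  shows "face_class (PVar (vert j) * PVar \<sigma> :: ('a, 'r::comm_ring_1) mpoly)
     = face_class (\<Sum>\<eta>\<in>joins (vert j) \<sigma>. PVar \<eta>)"
proof (cases "joins (vert j) \<sigma> = {}")
  case True
  then show ?thesis using joins_empty_product[OF True] by simp
next
  case False
  then obtain \<zeta> where "\<zeta> \<in> joins (vert j) \<sigma>" by blast
  then have le: "vert j \<le> \<zeta>" "\<sigma> \<le> \<zeta>" by (simp_all add: joins_iff)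
  obtain \<gamma> where \<gamma>: "meets (vert j) \<sigma> = {\<gamma>}" "V \<gamma> = V (vert j) \<inter> V \<sigma>"
    using meet_below[OF le] by blast
  have "V \<gamma> = {}" unfolding \<gamma>(2) V_vert[OF assms(1)] using assms(2) by simp
  then have "the_elem (meets (vert j) \<sigma>) = bot" using \<gamma>(1) by (simp add: V_empty_iff)
  then have "face_class (PVar (vert j) * PVar \<sigma> :: ('a, 'r) mpoly)
      = face_class (PVar bot * (\<Sum>\<eta>\<in>joins (vert j) \<sigma>. PVar \<eta>))"
    using face_class_PVar_mult[of "vert j" \<sigma>] by simp
  also have "\<dots> = face_class (1 * (\<Sum>\<eta>\<in>joins (vert j) \<sigma>. PVar \<eta>))"
    by (rule face_class_cong_mult[OF face_class_bot refl])
  finally show ?thesis by simp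
qed

end

section \<open>Systems of parameters\<close>

locale weighted_simplicial_poset = numbered_simplicial_poset m vert
  for m :: nat and vert :: "nat \<Rightarrow> 'a::{finite,order_bot}" +
  fixes \<Lambda> :: "int mat" and n :: nat
  assumes \<Lambda>: "\<Lambda> \<in> carrier_mat n m"
    and n: "n = poset_rank TYPE('a)"
begin

abbreviation T :: "nat \<Rightarrow> ('a, rat) mpoly" where
  "T \<equiv> linear_form vert \<Lambda>"

lemma linear_element_degree_two: "linear_element vert \<Lambda> i \<in> (face_ring_part 2 :: ('a, rat) mpoly set set)"
proof -
  have "face_weight e = 2" if e: "e \<in> Poly_Mapping.keys (T i)" for e
  proof -
    have "Poly_Mapping.keys (T i)
        \<subseteq> (\<Union>j<m. Poly_Mapping.keys (PConst (rat_of_int (\<Lambda> $$ (i, j))) * PVar (vert j)))"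
      unfolding linear_form_def carrier_matD(2)[OF \<Lambda>] by (rule keys_sum)
    then obtain j where j: "j < m"
      and "e \<in> Poly_Mapping.keys (PConst (rat_of_int (\<Lambda> $$ (i, j))) * PVar (vert j))"
      using e by auto
    moreover have "PConst a * PVar v = Poly_Mapping.single (Poly_Mapping.single v 1) a"
      for a :: rat and v :: 'a
      by (simp add: PConst_def PVar_def mult_single)
    ultimately have "e = Poly_Mapping.single (vert j) 1" by (simp split: if_splits)
    then show ?thesis using face_rank_vert[OF j] by (simp add: face_weight_def)
  qed
  then show ?thesis
    unfolding face_ring_part_def linear_element_face_class by auto
qed

lemma eval_linear_form:
  fixes w :: "nat \<Rightarrow> rat poly"
  shows "mpoly_eval (\<lambda>a. [:a:]) (face_value m vert \<sigma> w) (T i)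
     = (\<Sum>j\<in>V \<sigma>. [:of_int (\<Lambda> $$ (i, j)):] * w j)"
proof -
  have "mpoly_eval (\<lambda>a. [:a:]) (face_value m vert \<sigma> w) (T i)
      = (\<Sum>j<m. [:of_int (\<Lambda> $$ (i, j)):] * (if j \<in> V \<sigma> then w j else 0))"
    unfolding linear_form_def pCons.eval_sum pCons.eval_mult pCons.eval_PConst pCons.eval_PVar
    using \<Lambda> by (intro sum.cong) (simp_all add: face_value_vert)
  also have "\<dots> = (\<Sum>j\<in>V \<sigma>. [:of_int (\<Lambda> $$ (i, j)):] * (if j \<in> V \<sigma> then w j else 0))"
    using V_subset by (intro sum.mono_neutral_right) auto
  finally show ?thesis by simp
qed

text \<open>A relation \<open>w\<close> between the columns at \<open>\<sigma>\<close> is a point at which all restricted \<open>t\<^sub>i\<close>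
  vanish. Along the line through it, polynomials in the \<open>t\<^sub>i\<close> are constant, so a finitely
  generated module has values of bounded degree, unlike the powers of a vertex.\<close>

lemma finite_over_imp_independent:
  assumes fin: "finite_over n (linear_element vert \<Lambda> :: nat \<Rightarrow> ('a, rat) mpoly set)"
  shows "columns_independent \<Lambda> (V \<sigma>)"
proof (rule ccontr)
  assume "\<not> columns_independent \<Lambda> (V \<sigma>)"
  then obtain w j where w: "\<And>i. i < n \<Longrightarrow> (\<Sum>j\<in>V \<sigma>. \<Lambda> $$ (i, j) * w j) = 0"
    and j: "j \<in> V \<sigma>" "w j \<noteq> 0"
    using \<Lambda> unfolding columns_independent_def by auto
  \<comment> \<open>The values \<open>w\<^sub>j x\<close>, as polynomials in one variable \<open>x\<close>.\<close>
  define h where "h = face_value m vert \<sigma> (\<lambda>j. [:0, rat_of_int (w j):])"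
  let ?ev = "mpoly_eval (\<lambda>a. [:a:]) h"
  have ev_cong: "face_class p = face_class q \<Longrightarrow> ?ev p = ?ev q" for p q
    unfolding h_def by (rule eval_face_value_cong[OF pCons.coefficient_hom_axioms])
  have evT: "?ev (T i) = 0" if i: "i < n" for i
  proof -
    have lin: "(\<Sum>j\<in>J. [:0, f j:]) = [:0, \<Sum>j\<in>J. f j:]" for J and f :: "nat \<Rightarrow> rat"
      by (induction J rule: infinite_finite_induct) simp_all
    have "?ev (T i) = (\<Sum>j\<in>V \<sigma>. [:0, rat_of_int (\<Lambda> $$ (i, j) * w j):])"
      unfolding h_def eval_linear_form by (intro sum.cong) simp_all
    also have "\<dots> = [:0, rat_of_int (\<Sum>j\<in>V \<sigma>. \<Lambda> $$ (i, j) * w j):]"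
      unfolding lin of_int_sum ..
    finally show ?thesis using w[OF i] by simp
  qed
  have const: "Polynomial.degree (?ev k) = 0" if k: "k \<in> mpoly_eval PConst T ` polys_in n" for k
  proof -
    obtain p where p: "p \<in> polys_in n" "k = mpoly_eval PConst T p" using k by blast
    have "?ev k = (\<Sum>e\<in>Poly_Mapping.keys p. [:Poly_Mapping.lookup p e:] * monomial_value (\<lambda>i. ?ev (T i)) e)"
      unfolding p(2) pCons.eval_substitute by (simp add: mpoly_eval_def)
    also have "Polynomial.degree \<dots> \<le> 0"
    proof (rule degree_sum_le)
      fix e assume e: "e \<in> Poly_Mapping.keys p"
      have "monomial_value (\<lambda>i. ?ev (T i)) e = (if e = 0 then 1 else 0)"
      proof (cases "e = 0")
        case False
        then obtain i where i: "i \<in> Poly_Mapping.keys e" by (metis all_not_in_conv keys_eq_empty)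
        then have "i < n" using p(1) e unfolding polys_in_def by auto
        then have "?ev (T i) ^ Poly_Mapping.lookup e i = 0"
          using i evT by (simp add: in_keys_iff)
        then have "monomial_value (\<lambda>i. ?ev (T i)) e = 0"
          unfolding monomial_value_def using i by (intro prod_zero) auto
        then show ?thesis using False by simp
      qed simp
      then show "Polynomial.degree ([:Poly_Mapping.lookup p e:] * monomial_value (\<lambda>i. ?ev (T i)) e) \<le> 0"
        by simp
    qed simp
    finally show ?thesis by simp
  qed
  obtain xs where xs: "set xs \<subseteq> carrier face_ring"
    and span: "ring.Span face_ring (face_eval (linear_element vert \<Lambda>) ` polys_in n) xs
      = (carrier face_ring :: ('a, rat) mpoly set set)"
    using fin unfolding finite_over_def by blast
  obtain us where us: "xs = map face_class us"
  proof -
    have "\<forall>x\<in>set xs. \<exists>u. x = face_class u" using xs unfolding carrier_face_ring by auto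
    then show thesis using that unfolding ex_map_conv[symmetric] by (elim exE)
  qed
  have K: "face_eval (linear_element vert \<Lambda>) ` polys_in n
      = (face_class ` (mpoly_eval PConst T ` polys_in n) :: ('a, rat) mpoly set set)"
    unfolding image_image linear_element_face_class[abs_def] face_eval_face_class ..
  \<comment> \<open>Any common bound for the degrees of the values of the generators serves.\<close>
  define D where "D = (\<Sum>u\<leftarrow>us. Polynomial.degree (?ev u))"
  have D: "Polynomial.degree (?ev u) \<le> D" if "u \<in> set us" for u
    unfolding D_def using that by (intro member_le_sum_list) auto
  have "face_class (PVar (vert j) ^ Suc D) \<in> (carrier face_ring :: ('a, rat) mpoly set set)"
    unfolding carrier_face_ring by (rule rangeI)
  then obtain ks where ks: "length ks = length us" "set ks \<subseteq> mpoly_eval PConst T ` polys_in n"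
    "face_class (PVar (vert j) ^ Suc D) = face_class (\<Sum>(k, u)\<leftarrow>zip ks us. k * u)"
    unfolding span[symmetric] K us mem_Span_face_class by (elim exE conjE)
  have "?ev (PVar (vert j) ^ Suc D) = ?ev (\<Sum>(k, u)\<leftarrow>zip ks us. k * u)"
    by (rule ev_cong[OF ks(3)])
  moreover have "Polynomial.degree (?ev (\<Sum>(k, u)\<leftarrow>zip ks us. k * u)) \<le> D"
    if "set ks \<subseteq> mpoly_eval PConst T ` polys_in n" "\<And>u. u \<in> set us \<Longrightarrow> Polynomial.degree (?ev u) \<le> D" for ks us
    using that
  proof (induction ks us rule: list_induct2')
    case (4 k ks u us)
    have "Polynomial.degree (?ev k * ?ev u) \<le> Polynomial.degree (?ev k) + Polynomial.degree (?ev u)"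
      by (rule degree_mult_le)
    also have "\<dots> \<le> D" using 4 const[of k] by simp
    finally show ?case using 4 by (simp add: pCons.eval_simps degree_add_le)
  qed (simp_all add: pCons.eval_simps)
  from this[OF ks(2) D] have "Polynomial.degree (?ev (\<Sum>(k, u)\<leftarrow>zip ks us. k * u)) \<le> D" .
  moreover have "?ev (PVar (vert j) ^ Suc D) = [:0, rat_of_int (w j):] ^ Suc D"
    unfolding pCons.eval_power pCons.eval_PVar h_def
    using j(1) V_subset by (subst face_value_vert) auto
  moreover have "Polynomial.degree ([:0, rat_of_int (w j):] ^ Suc D) = Suc D"
    using j(2) by (subst degree_power_eq) simp_all
  ultimately show False by simp
qed

text \<open>At a face with \<open>n\<close> vertices, arbitrary values of \<open>t\<^sub>1, \<dots>, t\<^sub>n\<close> are attained by solving a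
  linear system. Prescribing the values of the Kronecker substitution shows that a polynomial
  relation between the \<open>t\<^sub>i\<close> is trivial.\<close>

lemma independent_imp_algebraically_independent:
  assumes ind: "\<And>\<sigma>. columns_independent \<Lambda> (V \<sigma>)"
  shows "algebraically_independent n (linear_element vert \<Lambda> :: nat \<Rightarrow> ('a, rat) mpoly set)"
  unfolding algebraically_independent_def
proof (intro ballI impI)
  fix p :: "(nat, rat) mpoly"
  assume p: "p \<in> polys_in n"
    and 0: "face_eval (linear_element vert \<Lambda>) p = (\<zero>\<^bsub>face_ring\<^esub> :: ('a, rat) mpoly set)"
  obtain \<sigma> :: 'a where "face_rank \<sigma> = n"
    using facet_of_full_rank unfolding n by blast
  then have \<sigma>: "card (V \<sigma>) = n" by (simp add: card_V)
  obtain d N where d: "d \<noteq> 0"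
    and N: "\<And>i l. i < n \<Longrightarrow> l < n \<Longrightarrow> (\<Sum>j\<in>V \<sigma>. \<Lambda> $$ (i, j) * N j l) = (if i = l then d else 0)"
    by (rule independent_right_inverse[OF \<Lambda> V_subset ind \<sigma>]) (rule that)
  define B where "B = Suc (\<Sum>e\<in>Poly_Mapping.keys p. \<Sum>i\<in>Poly_Mapping.keys e. Poly_Mapping.lookup e i)"
  have B: "Poly_Mapping.lookup e i < B" if e: "e \<in> Poly_Mapping.keys p" for e i
  proof (cases "i \<in> Poly_Mapping.keys e")
    case True
    have "Poly_Mapping.lookup e i \<le> (\<Sum>i\<in>Poly_Mapping.keys e. Poly_Mapping.lookup e i)"
      using True by (intro member_le_sum) auto
    also have "\<dots> \<le> (\<Sum>e\<in>Poly_Mapping.keys p. \<Sum>i\<in>Poly_Mapping.keys e. Poly_Mapping.lookup e i)"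
      using e by (intro member_le_sum[where f = "\<lambda>e. \<Sum>i\<in>Poly_Mapping.keys e. Poly_Mapping.lookup e i"]) auto
    finally show ?thesis by (simp add: B_def)
  next
    case False
    then show ?thesis by (simp add: B_def in_keys_iff)
  qed
  \<comment> \<open>The solution of \<open>\<Lambda>\<^sub>\<sigma> w = (x\<^bsup>B^0\<^esup>, \<dots>, x\<^bsup>B^(n-1)\<^esup>)\<close>.\<close>
  define w where "w j = (\<Sum>l<n. Polynomial.monom (rat_of_int (N j l) / rat_of_int d) (B ^ l))" for j
  let ?ev = "mpoly_eval (\<lambda>a. [:a:]) (face_value m vert \<sigma> w)"
  have evT: "?ev (T i) = Polynomial.monom 1 (B ^ i)" if i: "i < n" for i
  proof -
    have "?ev (T i) = (\<Sum>j\<in>V \<sigma>. \<Sum>l<n.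
        Polynomial.monom (rat_of_int (\<Lambda> $$ (i, j) * N j l) / rat_of_int d) (B ^ l))"
      unfolding eval_linear_form w_def sum_distrib_left
      by (intro sum.cong refl) (simp add: smult_monom)
    also have "\<dots> = (\<Sum>l<n. \<Sum>j\<in>V \<sigma>.
        Polynomial.monom (rat_of_int (\<Lambda> $$ (i, j) * N j l) / rat_of_int d) (B ^ l))"
      by (rule sum.swap)
    also have "\<dots> = (\<Sum>l<n. Polynomial.monom
        (rat_of_int (\<Sum>j\<in>V \<sigma>. \<Lambda> $$ (i, j) * N j l) / rat_of_int d) (B ^ l))"
      by (simp add: monom_sum sum_divide_distrib)
    also have "\<dots> = (\<Sum>l<n. if l = i then Polynomial.monom 1 (B ^ l) else 0)"
      using N i d by (intro sum.cong refl) auto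
    also have "\<dots> = Polynomial.monom 1 (B ^ i)" using i by (simp add: sum.delta)
    finally show ?thesis .
  qed
  have "face_class (mpoly_eval PConst T p) = face_class 0"
    using 0 unfolding linear_element_face_class[abs_def] face_eval_face_class face_class_zero .
  then have "?ev (mpoly_eval PConst T p) = ?ev 0"
    by (rule eval_face_value_cong[OF pCons.coefficient_hom_axioms])
  then have "mpoly_eval (\<lambda>a. [:a:]) (\<lambda>i. ?ev (T i)) p = 0"
    unfolding pCons.eval_substitute by (simp add: pCons.eval_simps)
  moreover have "mpoly_eval (\<lambda>a. [:a:]) (\<lambda>i. ?ev (T i)) p
      = mpoly_eval (\<lambda>a. [:a:]) (\<lambda>i. Polynomial.monom 1 (B ^ i)) p"
    unfolding mpoly_eval_def[of _ "\<lambda>i. ?ev (T i)"] mpoly_eval_def[of _ "\<lambda>i. Polynomial.monom 1 (B ^ i)"]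
  proof (intro sum.cong refl arg_cong2[of _ _ _ _ "(*)"])
    fix e assume "e \<in> Poly_Mapping.keys p"
    then have "Poly_Mapping.keys e \<subseteq> {..<n}" using p by (simp add: polys_in_def)
    then show "monomial_value (\<lambda>i. ?ev (T i)) e = monomial_value (\<lambda>i. Polynomial.monom 1 (B ^ i)) e"
      unfolding monomial_value_def using evT by (intro prod.cong refl) auto
  qed
  ultimately show "p = 0" using kronecker_substitution[OF p B] by simp
qed

end

context weighted_simplicial_poset
begin

text \<open>Representatives of the subalgebra over the rationals generated by the \<open>t\<^sub>i\<close>.\<close>

definition parameter_polys :: "('a, rat) mpoly set" where
  "parameter_polys = mpoly_eval PConst T ` polys_in n"

text \<open>Membership of the class of \<open>p\<close> in \<open>\<Sum>\<^sub>\<sigma> \<rat>[t] v\<^sub>\<sigma>\<close>; the aim is that every class is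
  spanned.\<close>

definition spanned :: "('a, rat) mpoly \<Rightarrow> bool" where
  "spanned p \<longleftrightarrow> (\<exists>a. (\<forall>\<sigma>. a \<sigma> \<in> parameter_polys) \<and>
     face_class p = face_class (\<Sum>\<sigma>\<in>UNIV. a \<sigma> * PVar \<sigma>))"

lemma parameter_polys_PConst: "PConst a \<in> parameter_polys"
  unfolding parameter_polys_def
  by (rule image_eqI[OF _ polys_in_closed(1)[of a]]) (simp add: PConst.eval_PConst)

lemma parameter_polys_T: "i < n \<Longrightarrow> T i \<in> parameter_polys"
  unfolding parameter_polys_def
  by (rule image_eqI[OF _ polys_in_closed(2)[of i]]) (simp_all add: PConst.eval_PVar)

lemma parameter_polys_add:
  assumes "p \<in> parameter_polys" "q \<in> parameter_polys" shows "p + q \<in> parameter_polys"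
proof -
  obtain p' q' where "p' \<in> polys_in n" "q' \<in> polys_in n"
    "p = mpoly_eval PConst T p'" "q = mpoly_eval PConst T q'"
    using assms unfolding parameter_polys_def by auto
  then show ?thesis unfolding parameter_polys_def
    by (intro image_eqI[of _ _ "p' + q'"] polys_in_closed) (simp_all add: PConst.eval_add)
qed

lemma parameter_polys_mult:
  assumes "p \<in> parameter_polys" "q \<in> parameter_polys" shows "p * q \<in> parameter_polys"
proof -
  obtain p' q' where "p' \<in> polys_in n" "q' \<in> polys_in n"
    "p = mpoly_eval PConst T p'" "q = mpoly_eval PConst T q'"
    using assms unfolding parameter_polys_def by auto
  then show ?thesis unfolding parameter_polys_def
    by (intro image_eqI[of _ _ "p' * q'"] polys_in_closed) (simp_all add: PConst.eval_mult)
qed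

lemma PConst_01: "(PConst 0 :: ('x, 'r::comm_ring_1) mpoly) = 0" "(PConst 1 :: ('x, 'r) mpoly) = 1"
  by (simp_all add: PConst_def)

lemma parameter_polys_01: "0 \<in> parameter_polys" "1 \<in> parameter_polys"
  using parameter_polys_PConst[of 0] parameter_polys_PConst[of 1] by (simp_all add: PConst_01)

lemma spanned_cong: "face_class p = face_class q \<Longrightarrow> spanned q \<Longrightarrow> spanned p"
  unfolding spanned_def by simp

lemma spanned_add:
  assumes "spanned p" "spanned q" shows "spanned (p + q)"
proof -
  obtain a where a: "\<And>\<sigma>. a \<sigma> \<in> parameter_polys" "face_class p = face_class (\<Sum>\<sigma>\<in>UNIV. a \<sigma> * PVar \<sigma>)"
    using assms(1) unfolding spanned_def by auto
  obtain b where b: "\<And>\<sigma>. b \<sigma> \<in> parameter_polys" "face_class q = face_class (\<Sum>\<sigma>\<in>UNIV. b \<sigma> * PVar \<sigma>)"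
    using assms(2) unfolding spanned_def by auto
  have "face_class (p + q) = face_class (\<Sum>\<sigma>\<in>UNIV. (a \<sigma> + b \<sigma>) * PVar \<sigma>)"
    using face_class_cong_add[OF a(2) b(2)] by (simp add: distrib_right sum.distrib)
  then show ?thesis unfolding spanned_def
    using parameter_polys_add[OF a(1) b(1)] by (intro exI[of _ "\<lambda>\<sigma>. a \<sigma> + b \<sigma>"]) simp
qed

lemma spanned_scale:
  assumes "spanned p" "k \<in> parameter_polys" shows "spanned (k * p)"
proof -
  obtain a where a: "\<And>\<sigma>. a \<sigma> \<in> parameter_polys" "face_class p = face_class (\<Sum>\<sigma>\<in>UNIV. a \<sigma> * PVar \<sigma>)"
    using assms(1) unfolding spanned_def by auto
  have "face_class (k * p) = face_class (\<Sum>\<sigma>\<in>UNIV. (k * a \<sigma>) * PVar \<sigma>)"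
    using face_class_cong_mult[OF refl a(2), of k] by (simp add: sum_distrib_left mult.assoc)
  then show ?thesis unfolding spanned_def
    using parameter_polys_mult[OF assms(2) a(1)] by (intro exI[of _ "\<lambda>\<sigma>. k * a \<sigma>"]) simp
qed

lemma spanned_PVar: "spanned (PVar \<sigma>)"
  unfolding spanned_def
proof (intro exI conjI allI)
  let ?a = "\<lambda>\<tau>. if \<tau> = \<sigma> then 1 else 0 :: ('a, rat) mpoly"
  show "?a \<tau> \<in> parameter_polys" for \<tau> by (simp add: parameter_polys_01)
  have "(\<Sum>\<tau>\<in>UNIV. ?a \<tau> * PVar \<tau>) = (\<Sum>\<tau>\<in>UNIV. if \<tau> = \<sigma> then PVar \<tau> else 0)"
    by (intro sum.cong refl) simp
  also have "\<dots> = PVar \<sigma>" by simp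
  finally show "face_class (PVar \<sigma>) = face_class (\<Sum>\<tau>\<in>UNIV. ?a \<tau> * PVar \<tau>)" by simp
qed

lemma spanned_zero: "spanned 0"
  using spanned_scale[OF spanned_PVar parameter_polys_01(1)] by simp

lemma spanned_sum: "(\<And>i. i \<in> I \<Longrightarrow> spanned (p i)) \<Longrightarrow> spanned (\<Sum>i\<in>I. p i)"
  by (induction I rule: infinite_finite_induct) (simp_all add: spanned_zero spanned_add)

text \<open>Stability under multiplication by \<open>q\<close> need only be checked on the generators \<open>v\<^sub>\<sigma>\<close>.\<close>

lemma spanned_mult:
  assumes gen: "\<And>\<sigma>. spanned (q * PVar \<sigma>)" and p: "spanned p"
  shows "spanned (q * p)"
proof -
  obtain a where a: "\<And>\<sigma>. a \<sigma> \<in> parameter_polys" "face_class p = face_class (\<Sum>\<sigma>\<in>UNIV. a \<sigma> * PVar \<sigma>)"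
    using p unfolding spanned_def by auto
  have "q * (\<Sum>\<sigma>\<in>UNIV. a \<sigma> * PVar \<sigma>) = (\<Sum>\<sigma>\<in>UNIV. a \<sigma> * (q * PVar \<sigma>))"
    by (simp add: sum_distrib_left mult.left_commute)
  then have "spanned (q * (\<Sum>\<sigma>\<in>UNIV. a \<sigma> * PVar \<sigma>))"
    by (simp only:) (intro spanned_sum spanned_scale gen a)
  then show ?thesis by (rule spanned_cong[OF face_class_cong_mult[OF refl a(2)]])
qed

lemma spanned_vert_outside: "k < m \<Longrightarrow> k \<notin> V \<sigma> \<Longrightarrow> spanned (PVar (vert k) * PVar \<sigma>)"
  by (rule spanned_cong[OF vert_product]) (auto intro: spanned_sum spanned_PVar)

text \<open>Multiplying \<open>\<Sum>\<^sub>i N\<^sub>k\<^sub>i t\<^sub>i = \<Sum>\<^sub>j M\<^sub>j v\<^sub>j\<close> by \<open>v\<^sub>\<sigma>\<close>, where row \<open>k\<close> of \<open>N\<close> is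
  taken from a left inverse of the columns at \<open>\<sigma>\<close>, leaves among the vertices of \<open>\<sigma>\<close> only the
  term \<open>d v\<^sub>k v\<^sub>\<sigma>\<close>. The terms with a vertex outside \<open>\<sigma>\<close> are spanned already.\<close>

lemma spanned_vert_inside:
  assumes ind: "columns_independent \<Lambda> (V \<sigma>)" and k: "k \<in> V \<sigma>"
  shows "spanned (PVar (vert k) * PVar \<sigma>)"
proof -
  obtain d N where d: "d \<noteq> 0"
    and N: "\<And>k j. k \<in> V \<sigma> \<Longrightarrow> j \<in> V \<sigma> \<Longrightarrow> (\<Sum>i<n. N k i * \<Lambda> $$ (i, j)) = (if k = j then d else 0)"
    by (rule independent_left_inverse[OF \<Lambda> V_subset ind]) (rule that)
  define x where "x j = (PVar (vert j) * PVar \<sigma> :: ('a, rat) mpoly)" for j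
  define M where "M j = (\<Sum>i<n. N k i * \<Lambda> $$ (i, j))" for j
  have TP: "(\<Sum>i<n. PConst (of_int (N k i)) * T i) * PVar \<sigma> = (\<Sum>j<m. PConst (of_int (M j)) * x j)"
  proof -
    have "(\<Sum>i<n. PConst (of_int (N k i)) * T i) * PVar \<sigma>
        = (\<Sum>i<n. \<Sum>j<m. PConst (of_int (N k i * \<Lambda> $$ (i, j))) * x j)"
      using \<Lambda> by (simp add: linear_form_def x_def sum_distrib_left sum_distrib_right
          PConst.c_mult mult.assoc)
    also have "\<dots> = (\<Sum>j<m. \<Sum>i<n. PConst (of_int (N k i * \<Lambda> $$ (i, j))) * x j)"
      by (rule sum.swap)
    also have "\<dots> = (\<Sum>j<m. PConst (of_int (M j)) * x j)"
    proof (intro sum.cong refl)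
      fix j
      have add: "(\<Sum>i\<in>I. PConst (f i)) = PConst (\<Sum>i\<in>I. f i)" for I and f :: "nat \<Rightarrow> rat"
        by (induction I rule: infinite_finite_induct) (simp_all add: PConst_01 PConst.c_add)
      show "(\<Sum>i<n. PConst (of_int (N k i * \<Lambda> $$ (i, j))) * x j) = PConst (of_int (M j)) * x j"
        unfolding M_def of_int_sum add[symmetric] by (rule sum_distrib_right[symmetric])
    qed
    finally show ?thesis .
  qed
  have split: "(\<Sum>j<m. PConst (of_int (M j)) * x j)
      = PConst (of_int d) * x k + (\<Sum>j\<in>{..<m} - V \<sigma>. PConst (of_int (M j)) * x j)"
  proof -
    have "(\<Sum>j<m. PConst (of_int (M j)) * x j)
      = (\<Sum>j\<in>{..<m} - V \<sigma>. PConst (of_int (M j)) * x j) + (\<Sum>j\<in>V \<sigma>. PConst (of_int (M j)) * x j)"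
      by (rule sum.subset_diff[OF V_subset]) simp
    also have "(\<Sum>j\<in>V \<sigma>. PConst (of_int (M j)) * x j) = (\<Sum>j\<in>V \<sigma>. if j = k then PConst (of_int d) * x j else 0)"
      unfolding M_def using N k by (intro sum.cong refl) (simp add: PConst_01)
    also have "\<dots> = PConst (of_int d) * x k" using k by simp
    finally show ?thesis by (simp add: add.commute)
  qed
  have "spanned ((\<Sum>i<n. PConst (of_int (N k i)) * T i) * PVar \<sigma>)"
    unfolding sum_distrib_right
    by (intro spanned_sum spanned_scale[OF spanned_PVar] parameter_polys_mult
        parameter_polys_PConst parameter_polys_T) simp
  moreover have "spanned (\<Sum>j\<in>{..<m} - V \<sigma>. PConst (- of_int (M j)) * x j)"
    unfolding x_def
    by (intro spanned_sum spanned_scale[OF spanned_vert_outside] parameter_polys_PConst) auto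
  ultimately have "spanned ((\<Sum>i<n. PConst (of_int (N k i)) * T i) * PVar \<sigma>
      + (\<Sum>j\<in>{..<m} - V \<sigma>. PConst (- of_int (M j)) * x j))"
    by (rule spanned_add)
  also have "(\<Sum>i<n. PConst (of_int (N k i)) * T i) * PVar \<sigma>
      + (\<Sum>j\<in>{..<m} - V \<sigma>. PConst (- of_int (M j)) * x j) = PConst (of_int d) * x k"
    unfolding TP split by (simp add: PConst.c_uminus sum_negf)
  finally have "spanned (PConst (1 / of_int d) * (PConst (of_int d) * x k))"
    by (rule spanned_scale[OF _ parameter_polys_PConst])
  moreover have "PConst (1 / of_int d) * (PConst (of_int d) * x k) = x k"
    using d unfolding mult.assoc[symmetric] PConst.c_mult[symmetric] by (simp add: PConst_01)
  ultimately show ?thesis unfolding x_def by simp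
qed

context
  assumes ind: "\<And>\<sigma>. columns_independent \<Lambda> (V \<sigma>)"
begin

lemma spanned_vert_mult: "j < m \<Longrightarrow> spanned p \<Longrightarrow> spanned (PVar (vert j) * p)"
proof (rule spanned_mult)
  fix \<sigma> assume "j < m"
  then show "spanned (PVar (vert j) * PVar \<sigma>)"
    using spanned_vert_outside[of j \<sigma>] spanned_vert_inside[OF ind, of j \<sigma>] by blast
qed

text \<open>For a vertex \<open>j\<close> of \<open>\<rho>\<close> and its opposite face \<open>\<rho>'\<close>, the product \<open>v\<^sub>j v\<^bsub>\<rho>'\<^esub>\<close> is the sum
  of \<open>v\<^sub>\<pi>\<close> over all joins, \<open>\<rho>\<close> among them. Any other join \<open>\<pi>\<close> has the same vertices as
  \<open>\<rho>\<close> and therefore no common upper bound with \<open>\<eta>\<close>. So multiplication by \<open>v\<^sub>\<eta>\<close> leaves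
  only \<open>v\<^sub>\<rho> v\<^sub>\<eta>\<close>, which reduces \<open>\<rho>\<close> to a face with fewer vertices.\<close>

lemma spanned_face_below: "\<rho> \<le> \<eta> \<Longrightarrow> spanned (PVar \<rho> * PVar \<eta>)"
proof (induction "card (V \<rho>)" arbitrary: \<rho>)
  case 0
  then have "\<rho> = bot" by (simp add: V_empty_iff)
  then have "face_class (PVar \<rho> * PVar \<eta> :: ('a, rat) mpoly) = face_class (1 * PVar \<eta>)"
    using face_class_cong_mult[OF face_class_bot refl] by simp
  then show ?case by (rule spanned_cong) (simp add: spanned_PVar)
next
  case (Suc c)
  then obtain j where j: "j \<in> V \<rho>" by (metis card.empty ex_in_conv nat.distinct(1))
  then have jm: "j < m" "vert j \<le> \<rho>" by (simp_all add: vertices_of_def)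
  obtain \<rho>' where \<rho>': "\<rho>' \<le> \<rho>" "V \<rho>' = V \<rho> - {j}"
    using face_with_vertices[of "V \<rho> - {j}" \<rho>] by auto
  have "c = card (V \<rho>')" unfolding \<rho>'(2) using j Suc.hyps(2) by simp
  moreover have "\<rho>' \<le> \<eta>" using \<rho>'(1) Suc.prems by simp
  ultimately have IH: "spanned (PVar \<rho>' * PVar \<eta>)" by (rule Suc.hyps(1))
  have \<rho>: "\<rho> \<in> joins (vert j) \<rho>'"
    using jm \<rho>' j V_vert[OF jm(1)] by (auto simp: joins_iff)
  have vanish: "face_class (PVar \<pi> * PVar \<eta> :: ('a, rat) mpoly) = face_class 0"
    if \<pi>: "\<pi> \<in> joins (vert j) \<rho>'" "\<pi> \<noteq> \<rho>" for \<pi>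
  proof (rule joins_empty_product, rule ccontr)
    assume "joins \<pi> \<eta> \<noteq> {}"
    then obtain \<zeta> where "\<zeta> \<in> joins \<pi> \<eta>" by blast
    then have "\<pi> \<le> \<zeta>" "\<eta> \<le> \<zeta>" by (simp_all add: joins_iff)
    moreover have "V \<pi> = V \<rho>" using \<pi>(1) \<rho> by (simp add: joins_iff)
    ultimately show False using V_eqD[of \<pi> \<rho> \<zeta>] Suc.prems \<pi>(2) order_trans[of \<rho> \<eta> \<zeta>] by simp
  qed
  have "j \<notin> V \<rho>'" unfolding \<rho>'(2) by simp
  from face_class_cong_mult[OF vert_product[OF jm(1) this] refl, of "PVar \<eta> :: ('a, rat) mpoly"]
  have "face_class (PVar (vert j) * (PVar \<rho>' * PVar \<eta>) :: ('a, rat) mpoly)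
      = face_class (\<Sum>\<pi>\<in>joins (vert j) \<rho>'. PVar \<pi> * PVar \<eta>)"
    by (simp add: sum_distrib_right mult.assoc)
  also have "\<dots> = face_class (\<Sum>\<pi>\<in>joins (vert j) \<rho>'. if \<pi> = \<rho> then PVar \<rho> * PVar \<eta> else 0)"
    using vanish by (intro face_class_cong_sum) simp
  also have "\<dots> = face_class (PVar \<rho> * PVar \<eta>)" using \<rho> by simp
  finally show ?case
    using spanned_vert_mult[OF jm(1) IH] spanned_cong[OF sym] by blast
qed

lemma spanned_face_mult: "spanned (PVar \<sigma> * PVar \<tau>)"
proof (cases "joins \<sigma> \<tau> = {}")
  case True
  show ?thesis by (rule spanned_cong[OF joins_empty_product[OF True] spanned_zero])
next
  case False
  then obtain \<zeta> where \<zeta>: "\<zeta> \<in> joins \<sigma> \<tau>" by blast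
  then have "\<sigma> \<le> \<zeta>" "\<tau> \<le> \<zeta>" by (simp_all add: joins_iff)
  then obtain \<gamma> where \<gamma>: "meets \<sigma> \<tau> = {\<gamma>}" "\<gamma> \<le> \<sigma>"
    using meet_below by blast
  have "\<gamma> \<le> \<eta>" if "\<eta> \<in> joins \<sigma> \<tau>" for \<eta>
    using that \<gamma>(2) by (simp add: joins_iff) (metis order_trans)
  then have "spanned (\<Sum>\<eta>\<in>joins \<sigma> \<tau>. PVar \<gamma> * PVar \<eta>)"
    by (intro spanned_sum spanned_face_below)
  moreover have "face_class (PVar \<sigma> * PVar \<tau> :: ('a, rat) mpoly)
      = face_class (\<Sum>\<eta>\<in>joins \<sigma> \<tau>. PVar \<gamma> * PVar \<eta>)"
    using face_class_PVar_mult[of \<sigma> \<tau>] by (simp add: \<gamma>(1) sum_distrib_left)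
  ultimately show ?thesis using spanned_cong by blast
qed

lemma spanned_all: "spanned p"
proof (induction p rule: mpoly_induct)
  case one
  show ?case by (rule spanned_cong[OF face_class_bot[symmetric] spanned_PVar])
next
  case (add p q)
  then show ?case by (rule spanned_add)
next
  case (const a p)
  show ?case by (rule spanned_scale[OF const parameter_polys_PConst])
next
  case (var \<tau> p)
  show ?case by (rule spanned_mult[OF spanned_face_mult var])
qed

lemma independent_imp_finite_over:
  "finite_over n (linear_element vert \<Lambda> :: nat \<Rightarrow> ('a, rat) mpoly set)"
proof -
  obtain fs :: "'a list" where fs: "set fs = UNIV" "distinct fs"
    using finite_distinct_list[OF finite_class.finite_UNIV] by blast
  have K: "face_eval (linear_element vert \<Lambda>) ` polys_in n = face_class ` parameter_polys"
    unfolding parameter_polys_def image_image linear_element_face_class[abs_def] face_eval_face_class ..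
  let ?us = "map face_class (map PVar fs) :: ('a, rat) mpoly set list"
  have "x \<in> ring.Span face_ring (face_class ` parameter_polys) ?us"
    if x: "x \<in> carrier face_ring" for x
  proof -
    obtain p where p: "x = face_class p" using x unfolding carrier_face_ring by auto
    obtain a where a: "\<And>\<sigma>. a \<sigma> \<in> parameter_polys" "face_class p = face_class (\<Sum>\<sigma>\<in>UNIV. a \<sigma> * PVar \<sigma>)"
      using spanned_all[of p] unfolding spanned_def by auto
    have "(\<Sum>(k, u)\<leftarrow>zip (map a fs) (map PVar fs). k * u) = (\<Sum>\<sigma>\<leftarrow>fs. a \<sigma> * PVar \<sigma>)"
      by (simp add: zip_map_map zip_same_conv_map comp_def)
    also have "\<dots> = (\<Sum>\<sigma>\<in>UNIV. a \<sigma> * PVar \<sigma>)"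
      using sum_list_distinct_conv_sum_set[OF fs(2), of "\<lambda>\<sigma>. a \<sigma> * PVar \<sigma>"] fs(1) by simp
    finally show ?thesis
      unfolding mem_Span_face_class using a p by (intro exI[of _ "map a fs"]) auto
  qed
  moreover have "x \<in> carrier face_ring"
    if x: "x \<in> ring.Span face_ring (face_class ` parameter_polys) ?us" for x
    using x unfolding mem_Span_face_class carrier_face_ring by auto
  ultimately show ?thesis
    unfolding finite_over_def K by (intro exI[of _ ?us]) (auto simp: carrier_face_ring)
qed

end

lemma lsop_iff_independent:
  "lsop n (linear_element vert \<Lambda> :: nat \<Rightarrow> ('a, rat) mpoly set)
     \<longleftrightarrow> (\<forall>\<sigma>. columns_independent \<Lambda> (V \<sigma>))"
proof
  assume "lsop n (linear_element vert \<Lambda> :: nat \<Rightarrow> ('a, rat) mpoly set)"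
  then have "finite_over n (linear_element vert \<Lambda> :: nat \<Rightarrow> ('a, rat) mpoly set)"
    unfolding lsop_def by (elim conjE)
  then show "\<forall>\<sigma>. columns_independent \<Lambda> (V \<sigma>)"
    by (intro allI finite_over_imp_independent)
next
  assume "\<forall>\<sigma>. columns_independent \<Lambda> (V \<sigma>)"
  then have ind: "\<And>\<sigma>. columns_independent \<Lambda> (V \<sigma>)" by simp
  show "lsop n (linear_element vert \<Lambda> :: nat \<Rightarrow> ('a, rat) mpoly set)"
    unfolding lsop_def
    by (intro conjI allI impI n linear_element_degree_two ind
        independent_imp_algebraically_independent independent_imp_finite_over)
qed

end

section \<open>Integer matrices acting on tori\<close>

lemma power_int_sum:
  fixes x :: "'b::field"
  assumes "x \<noteq> 0"
  shows "x powi (\<Sum>i\<in>I. f i) = (\<Prod>i\<in>I. x powi f i)"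
  by (induction I rule: infinite_finite_induct) (simp_all add: power_int_add assms)

lemma power_int_prod:
  fixes f :: "'c \<Rightarrow> 'b::field"
  shows "(\<Prod>i\<in>I. f i) powi k = (\<Prod>i\<in>I. f i powi k)"
  by (induction I rule: infinite_finite_induct) (simp_all add: power_int_mult_distrib)

text \<open>Monomial maps compose like their matrices of exponents.\<close>

lemma prod_power_int_swap:
  fixes z :: "'c \<Rightarrow> 'b::field"
  assumes "\<And>j. j \<in> J \<Longrightarrow> z j \<noteq> 0"
  shows "(\<Prod>i\<in>I. (\<Prod>j\<in>J. z j powi B i j) powi N i) = (\<Prod>j\<in>J. z j powi (\<Sum>i\<in>I. N i * B i j))"
proof -
  have "(\<Prod>i\<in>I. (\<Prod>j\<in>J. z j powi B i j) powi N i) = (\<Prod>i\<in>I. \<Prod>j\<in>J. z j powi (N i * B i j))"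
    by (simp add: power_int_prod power_int_mult[symmetric] mult.commute)
  also have "\<dots> = (\<Prod>j\<in>J. \<Prod>i\<in>I. z j powi (N i * B i j))"
    by (rule prod.swap)
  also have "\<dots> = (\<Prod>j\<in>J. z j powi (\<Sum>i\<in>I. N i * B i j))"
    using assms by (intro prod.cong refl) (simp add: power_int_sum)
  finally show ?thesis .
qed

lemma carrier_torus: "carrier (torus k) = (\<Pi>\<^sub>E i\<in>{..<k}. sphere 0 1)"
  by (simp add: torus_def carrier_product_group circle_group_def)

lemma mult_torus: "x \<otimes>\<^bsub>torus k\<^esub> y = (\<lambda>i\<in>{..<k}. x i * y i)"
  by (simp add: torus_def mult_product_group circle_group_def)

lemma one_torus: "\<one>\<^bsub>torus k\<^esub> = (\<lambda>i\<in>{..<k}. 1)"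
  by (simp add: torus_def one_product_group circle_group_def)

lemma topspace_torus_topology: "topspace (torus_topology k) = carrier (torus k)"
  by (simp add: torus_topology_def carrier_torus)

lemma torus_coord_nonzero: "z \<in> carrier (torus k) \<Longrightarrow> i < k \<Longrightarrow> z i \<noteq> 0"
  using torus_norm[of z k i] by auto

lemma restrict_in_torus: "(\<And>i. i < k \<Longrightarrow> norm (f i) = 1) \<Longrightarrow> (\<lambda>i\<in>{..<k}. f i) \<in> carrier (torus k)"
  unfolding carrier_torus by (intro restrict_PiE_iff[THEN iffD2]) simp

lemma torus_eqI:
  assumes "x \<in> carrier (torus k)" "y \<in> carrier (torus k)" "\<And>i. i < k \<Longrightarrow> x i = y i"
  shows "x = y"
  using assms(1,2) unfolding carrier_torus by (rule PiE_ext) (use assms(3) in simp)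

lemma norm_monomial:
  assumes "z \<in> carrier (torus k)"
  shows "norm (\<Prod>j<k. z j powi f j) = 1"
  using torus_norm[OF assms] by (simp add: prod_norm[symmetric] norm_power_int)

lemma torus_hom_closed:
  assumes "A \<in> carrier_mat r k" "z \<in> carrier (torus k)"
  shows "torus_hom A z \<in> carrier (torus r)"
  using assms norm_monomial[OF assms(2)] unfolding torus_hom_def by (simp add: restrict_in_torus)

lemma torus_hom_index:
  assumes "A \<in> carrier_mat r k" "i < r"
  shows "torus_hom A z i = (\<Prod>j<k. z j powi (A $$ (i, j)))"
  using assms by (simp add: torus_hom_def)

lemma torus_hom_mult:
  assumes A: "A \<in> carrier_mat r k" and x: "x \<in> carrier (torus k)" and y: "y \<in> carrier (torus k)"
  shows "torus_hom A (x \<otimes>\<^bsub>torus k\<^esub> y) = torus_hom A x \<otimes>\<^bsub>torus r\<^esub> torus_hom A y"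
proof -
  interpret T: group "torus k" by (rule torus_group)
  interpret R: group "torus r" by (rule torus_group)
  show ?thesis
  proof (rule torus_eqI)
    show "torus_hom A (x \<otimes>\<^bsub>torus k\<^esub> y) \<in> carrier (torus r)"
      using x y by (intro torus_hom_closed[OF A]) simp
    show "torus_hom A x \<otimes>\<^bsub>torus r\<^esub> torus_hom A y \<in> carrier (torus r)"
      using torus_hom_closed[OF A x] torus_hom_closed[OF A y] by simp
    fix i assume i: "i < r"
    show "torus_hom A (x \<otimes>\<^bsub>torus k\<^esub> y) i = (torus_hom A x \<otimes>\<^bsub>torus r\<^esub> torus_hom A y) i"
      using i by (simp add: torus_hom_index[OF A] mult_torus power_int_mult_distrib prod.distrib)
  qed
qed

lemma torus_hom_compose:
  assumes A: "A \<in> carrier_mat r k" and B: "B \<in> carrier_mat k m" and z: "z \<in> carrier (torus m)"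
  shows "torus_hom (A * B) z = torus_hom A (torus_hom B z)"
proof (rule torus_eqI)
  show "torus_hom (A * B) z \<in> carrier (torus r)"
    by (rule torus_hom_closed[OF mult_carrier_mat[OF A B] z])
  show "torus_hom A (torus_hom B z) \<in> carrier (torus r)"
    by (rule torus_hom_closed[OF A torus_hom_closed[OF B z]])
  fix i assume i: "i < r"
  have "torus_hom A (torus_hom B z) i = (\<Prod>l<k. (\<Prod>j<m. z j powi (B $$ (l, j))) powi (A $$ (i, l)))"
    using i by (simp add: torus_hom_index[OF A] torus_hom_index[OF B])
  also have "\<dots> = (\<Prod>j<m. z j powi (\<Sum>l<k. A $$ (i, l) * B $$ (l, j)))"
    using torus_coord_nonzero[OF z] by (intro prod_power_int_swap) simp
  also have "\<dots> = (\<Prod>j<m. z j powi ((A * B) $$ (i, j)))"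
    using A B i by (intro prod.cong refl) (simp add: scalar_prod_def atLeast0LessThan)
  also have "\<dots> = torus_hom (A * B) z i"
    using i by (simp add: torus_hom_index[OF mult_carrier_mat[OF A B]])
  finally show "torus_hom (A * B) z i = torus_hom A (torus_hom B z) i" by simp
qed

lemma torus_hom_one:
  assumes "z \<in> carrier (torus k)" shows "torus_hom (1\<^sub>m k) z = z"
proof (rule torus_eqI[OF torus_hom_closed[OF one_carrier_mat assms] assms])
  fix i assume i: "i < k"
  have "torus_hom (1\<^sub>m k) z i = (\<Prod>j<k. if j = i then z j else 1)"
    unfolding torus_hom_index[OF one_carrier_mat i] using i by (intro prod.cong refl) auto
  also have "\<dots> = z i" using i by simp
  finally show "torus_hom (1\<^sub>m k) z i = z i" .
qed

lemma mem_torus_kernel: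
  assumes "A \<in> carrier_mat r k"
  shows "z \<in> torus_kernel A \<longleftrightarrow> z \<in> carrier (torus k) \<and> (\<forall>i<r. (\<Prod>j<k. z j powi (A $$ (i, j))) = 1)"
proof -
  have "torus_hom A z = \<one>\<^bsub>torus r\<^esub> \<longleftrightarrow> (\<forall>i<r. (\<Prod>j<k. z j powi (A $$ (i, j))) = 1)"
    using assms unfolding torus_hom_def one_torus by (auto simp: fun_eq_iff restrict_def)
  then show ?thesis using assms by (auto simp: torus_kernel_def kernel_def)
qed

text \<open>The exponent may be negative, hence the absolute value in the proof.\<close>

lemma finite_torus_torsion:
  assumes "d \<noteq> 0"
  shows "finite {z \<in> carrier (torus k). \<forall>j<k. z j powi d = 1}"
proof (rule finite_subset)
  let ?R = "{c::complex. c ^ nat \<bar>d\<bar> = 1}"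
  show "{z \<in> carrier (torus k). \<forall>j<k. z j powi d = 1} \<subseteq> (\<Pi>\<^sub>E i\<in>{..<k}. ?R)"
  proof
    fix z assume z: "z \<in> {z \<in> carrier (torus k). \<forall>j<k. z j powi d = 1}"
    have "z j ^ nat \<bar>d\<bar> = 1" if "j < k" for j
    proof -
      have "z j powi d = 1" using z that by blast
      then show ?thesis by (cases "d \<ge> 0") (simp_all add: power_int_def power_inverse)
    qed
    moreover have "z \<in> extensional {..<k}" using z by (auto simp: carrier_torus PiE_def)
    ultimately show "z \<in> (\<Pi>\<^sub>E i\<in>{..<k}. ?R)" by (simp add: PiE_iff)
  qed
  show "finite (\<Pi>\<^sub>E i\<in>{..<k}. ?R)"
    using assms by (intro finite_PiE finite_roots_unity) auto
qed

section \<open>Isotropy groups on the moment-angle complex\<close>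

text \<open>Gluing changes only the block in which a point is considered.\<close>

lemma ma_equiv_point:
  assumes "((\<sigma>, z), (\<tau>, z')) \<in> ma_equiv m vert" shows "z = z'"
proof -
  have "(p, q) \<in> (ma_glue m vert \<union> (ma_glue m vert)\<inverse>)\<^sup>* \<Longrightarrow> snd p = snd q" for p q
    by (induction rule: rtrancl_induct) (auto simp: ma_glue_def)
  from this[of "(\<sigma>, z)" "(\<tau>, z')"] show ?thesis using assms by (simp add: ma_equiv_def)
qed

lemma torus_action_fixes_iff:
  assumes g: "g \<in> carrier (torus m)" and z: "z \<in> ma_block m vert \<sigma>"
  shows "torus_action m vert g (ma_equiv m vert `` {(\<sigma>, z)}) = ma_equiv m vert `` {(\<sigma>, z)}
     \<longleftrightarrow> (\<forall>j<m. g j * z j = z j)"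
proof -
  have top: "(\<sigma>, z) \<in> topspace (ma_sum m vert)" using z by (simp add: topspace_ma_sum)
  have "torus_action m vert g (ma_equiv m vert `` {(\<sigma>, z)}) = ma_equiv m vert `` {(\<sigma>, z)}
      \<longleftrightarrow> (block_action m g (\<sigma>, z), (\<sigma>, z)) \<in> ma_equiv m vert"
    unfolding torus_action_class[OF g top]
    using eq_equiv_class_iff[OF ma_equiv_equiv block_action_topspace[OF g top] top] by simp
  also have "\<dots> \<longleftrightarrow> (\<lambda>j\<in>{..<m}. g j * z j) = z"
  proof
    assume "(block_action m g (\<sigma>, z), (\<sigma>, z)) \<in> ma_equiv m vert"
    then show "(\<lambda>j\<in>{..<m}. g j * z j) = z"
      unfolding block_action_def by (auto dest: ma_equiv_point)
  next
    assume "(\<lambda>j\<in>{..<m}. g j * z j) = z"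
    then have "block_action m g (\<sigma>, z) = (\<sigma>, z)" by (simp add: block_action_def)
    then show "(block_action m g (\<sigma>, z), (\<sigma>, z)) \<in> ma_equiv m vert"
      using equiv_class_self[OF ma_equiv_equiv top] by simp
  qed
  also have "\<dots> \<longleftrightarrow> (\<forall>j<m. g j * z j = z j)"
  proof
    assume eq: "(\<lambda>j\<in>{..<m}. g j * z j) = z"
    show "\<forall>j<m. g j * z j = z j"
    proof (intro allI impI)
      fix j assume "j < m"
      then show "g j * z j = z j" using fun_cong[OF eq, of j] by simp
    qed
  next
    assume eq: "\<forall>j<m. g j * z j = z j"
    have "z \<in> extensional {..<m}" using z by (auto simp: ma_block_def PiE_def)
    then show "(\<lambda>j\<in>{..<m}. g j * z j) = z"
      using eq by (intro ext) (simp add: restrict_def extensional_def)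
  qed
  finally show ?thesis .
qed

text \<open>An isotropy element at a point of the block of \<open>\<sigma>\<close> is 1 outside the vertices of \<open>\<sigma>\<close>, and
  a left inverse with factor \<open>d\<close> turns the equations of the kernel into \<open>g\<^sub>k ^ d = 1\<close> at the
  vertices. Conversely a relation \<open>w\<close> gives the one-parameter subgroup
  \<open>s \<mapsto> (e\<^bsup>i s w\<^sub>j\<^esup>)\<^sub>j\<close>, which fixes the point with coordinates 0 at the vertices of \<open>\<sigma>\<close> and
  1 elsewhere.\<close>

lemma (in numbered_simplicial_poset) almost_free_iff_independent:
  assumes \<Lambda>: "\<Lambda> \<in> carrier_mat n m"
  shows "almost_free (torus_kernel_group \<Lambda>) (topspace (moment_angle_complex m vert)) (torus_action m vert)
     \<longleftrightarrow> (\<forall>\<sigma>. columns_independent \<Lambda> (V \<sigma>))"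
proof
  assume ind: "\<forall>\<sigma>. columns_independent \<Lambda> (V \<sigma>)"
  show "almost_free (torus_kernel_group \<Lambda>) (topspace (moment_angle_complex m vert)) (torus_action m vert)"
    unfolding almost_free_def topspace_moment_angle_complex
  proof
    fix x assume "x \<in> ma_points m vert"
    then obtain p where p: "p \<in> topspace (ma_sum m vert)" "x = ma_equiv m vert `` {p}"
      unfolding ma_points_def by (rule quotientE)
    obtain \<sigma> z where \<sigma>z: "p = (\<sigma>, z)" by (cases p)
    then have z: "z \<in> ma_block m vert \<sigma>" using p(1) by (simp add: topspace_ma_sum)
    have zn: "z j \<noteq> 0" if "j < m" "j \<notin> V \<sigma>" for j
    proof -
      have "norm (z j) = 1" using z that by (simp add: ma_block_def vertices_of_def)
      then show ?thesis by auto
    qed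
    obtain d N where d: "d \<noteq> 0"
      and N: "\<And>k j. k \<in> V \<sigma> \<Longrightarrow> j \<in> V \<sigma> \<Longrightarrow> (\<Sum>i<n. N k i * \<Lambda> $$ (i, j)) = (if k = j then d else 0)"
      by (rule independent_left_inverse[OF \<Lambda> V_subset spec[OF ind]]) (rule that)
    have "stabilizer (torus_kernel_group \<Lambda>) (torus_action m vert) x
        \<subseteq> {g \<in> carrier (torus m). \<forall>j<m. g j powi d = 1}"
    proof
      fix g assume "g \<in> stabilizer (torus_kernel_group \<Lambda>) (torus_action m vert) x"
      then have gk: "g \<in> torus_kernel \<Lambda>" and fixed: "torus_action m vert g x = x"
        by (simp_all add: stabilizer_def torus_kernel_group_def)
      have g: "g \<in> carrier (torus m)" and ker: "\<And>i. i < n \<Longrightarrow> (\<Prod>j<m. g j powi (\<Lambda> $$ (i, j))) = 1"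
        using gk unfolding mem_torus_kernel[OF \<Lambda>] by blast+
      have "\<forall>j<m. g j * z j = z j"
        using fixed torus_action_fixes_iff[OF g z] unfolding p(2) \<sigma>z by blast
      then have one: "g j = 1" if "j < m" "j \<notin> V \<sigma>" for j
        using zn[OF that] that(1) by auto
      have "g k powi d = 1" if k: "k \<in> V \<sigma>" for k
      proof -
        have "(\<Prod>j\<in>V \<sigma>. g j powi (\<Lambda> $$ (i, j))) = 1" if i: "i < n" for i
        proof -
          have "(\<Prod>j\<in>V \<sigma>. g j powi (\<Lambda> $$ (i, j))) = (\<Prod>j<m. g j powi (\<Lambda> $$ (i, j)))"
            using V_subset one by (intro prod.mono_neutral_left) auto
          then show ?thesis using ker[OF i] by simp
        qed
        then have "1 = (\<Prod>i<n. (\<Prod>j\<in>V \<sigma>. g j powi (\<Lambda> $$ (i, j))) powi (N k i))" by simp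
        also have "\<dots> = (\<Prod>j\<in>V \<sigma>. g j powi (\<Sum>i<n. N k i * \<Lambda> $$ (i, j)))"
        proof (rule prod_power_int_swap)
          fix j assume "j \<in> V \<sigma>"
          then have "j < m" using V_subset by blast
          then show "g j \<noteq> 0" by (rule torus_coord_nonzero[OF g])
        qed
        also have "\<dots> = (\<Prod>j\<in>V \<sigma>. if j = k then g j powi d else 1)"
          using N[OF k] by (intro prod.cong refl) simp
        also have "\<dots> = g k powi d" using k by simp
        finally show ?thesis by simp
      qed
      then have "\<forall>j<m. g j powi d = 1" using one by (metis power_int_1_left)
      then show "g \<in> {g \<in> carrier (torus m). \<forall>j<m. g j powi d = 1}" using g by simp
    qed
    then show "finite (stabilizer (torus_kernel_group \<Lambda>) (torus_action m vert) x)"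
      by (rule finite_subset) (rule finite_torus_torsion[OF d])
  qed
next
  assume free: "almost_free (torus_kernel_group \<Lambda>) (topspace (moment_angle_complex m vert)) (torus_action m vert)"
  show "\<forall>\<sigma>. columns_independent \<Lambda> (V \<sigma>)"
  proof (intro allI, rule ccontr)
    fix \<sigma> assume "\<not> columns_independent \<Lambda> (V \<sigma>)"
    then obtain w k where w: "\<And>i. i < n \<Longrightarrow> (\<Sum>j\<in>V \<sigma>. \<Lambda> $$ (i, j) * w j) = 0"
      and k: "k \<in> V \<sigma>" "w k \<noteq> 0"
      using \<Lambda> unfolding columns_independent_def by auto
    define z where "z = (\<lambda>j\<in>{..<m}. if j \<in> V \<sigma> then 0 else 1 :: complex)"
    have z: "z \<in> ma_block m vert \<sigma>"
      by (auto simp: z_def ma_block_def vertices_of_def)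
    define g where "g s = (\<lambda>j\<in>{..<m}. if j \<in> V \<sigma> then cis (s * real_of_int (w j)) else 1)" for s
    have gt: "g s \<in> carrier (torus m)" for s
      unfolding g_def by (rule restrict_in_torus) simp
    have cis_prod: "(\<Prod>j\<in>J. cis (f j)) = cis (\<Sum>j\<in>J. f j)" for J and f :: "nat \<Rightarrow> real"
      by (induction J rule: infinite_finite_induct) (simp_all add: cis_mult)
    have gk: "g s \<in> torus_kernel \<Lambda>" for s
      unfolding mem_torus_kernel[OF \<Lambda>]
    proof (intro conjI allI impI gt)
      fix i assume i: "i < n"
      have "(\<Prod>j<m. g s j powi (\<Lambda> $$ (i, j))) = (\<Prod>j\<in>V \<sigma>. g s j powi (\<Lambda> $$ (i, j)))"
        using V_subset by (intro prod.mono_neutral_right) (auto simp: g_def)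
      also have "\<dots> = (\<Prod>j\<in>V \<sigma>. cis (s * real_of_int (\<Lambda> $$ (i, j) * w j)))"
      proof (intro prod.cong refl)
        fix j assume j: "j \<in> V \<sigma>"
        then have "j < m" using V_subset by blast
        then show "g s j powi (\<Lambda> $$ (i, j)) = cis (s * real_of_int (\<Lambda> $$ (i, j) * w j))"
          using j by (simp add: g_def cis_power_int mult.left_commute)
      qed
      also have "\<dots> = cis (s * real_of_int (\<Sum>j\<in>V \<sigma>. \<Lambda> $$ (i, j) * w j))"
        unfolding cis_prod of_int_sum sum_distrib_left ..
      also have "\<dots> = 1" unfolding w[OF i] by simp
      finally show "(\<Prod>j<m. g s j powi (\<Lambda> $$ (i, j))) = 1" .
    qed
    have "(\<sigma>, z) \<in> topspace (ma_sum m vert)" using z by (simp add: topspace_ma_sum)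
    then have "ma_equiv m vert `` {(\<sigma>, z)} \<in> ma_points m vert"
      unfolding ma_points_def by (rule quotientI)
    then have fin: "finite (stabilizer (torus_kernel_group \<Lambda>) (torus_action m vert) (ma_equiv m vert `` {(\<sigma>, z)}))"
      using free unfolding almost_free_def by simp
    have stab: "g s \<in> stabilizer (torus_kernel_group \<Lambda>) (torus_action m vert) (ma_equiv m vert `` {(\<sigma>, z)})" for s
    proof -
      have "\<forall>j<m. g s j * z j = z j" by (simp add: g_def z_def)
      then have "torus_action m vert (g s) (ma_equiv m vert `` {(\<sigma>, z)}) = ma_equiv m vert `` {(\<sigma>, z)}"
        using torus_action_fixes_iff[OF gt z] by blast
      then show ?thesis using gk by (simp add: stabilizer_def torus_kernel_group_def)
    qed
    \<comment> \<open>The \<open>k\<close>-th coordinates of the subgroup already form an infinite set.\<close>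
    have "cis ` {0<..<1} \<subseteq> (\<lambda>h. h k) ` stabilizer (torus_kernel_group \<Lambda>) (torus_action m vert) (ma_equiv m vert `` {(\<sigma>, z)})"
    proof
      fix c assume "c \<in> cis ` {0<..<1}"
      then obtain x where x: "c = cis x" by auto
      have "k < m" using k(1) V_subset by blast
      then have "c = g (x / real_of_int (w k)) k" using k by (simp add: g_def x)
      then show "c \<in> (\<lambda>h. h k) ` stabilizer (torus_kernel_group \<Lambda>) (torus_action m vert) (ma_equiv m vert `` {(\<sigma>, z)})"
        using stab by (intro image_eqI)
    qed
    then have "finite (cis ` {0<..<1})" using fin by (meson finite_imageI finite_subset)
    moreover have "inj_on cis {0<..<1}"
    proof (rule inj_on_inverseI)
      fix x :: real assume "x \<in> {0<..<1}"
      then show "Arg (cis x) = x" using pi_gt3 by (intro Arg_cis) auto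
    qed
    ultimately have "finite {0<..<1::real}" by (rule finite_imageD)
    then show False by (simp add: infinite_Ioo)
  qed
qed

section \<open>The kernel of a surjective homomorphism of tori\<close>

lemma continuous_map_complex_mult:
  fixes f g :: "'x \<Rightarrow> complex"
  assumes "continuous_map Y euclidean f" "continuous_map Y euclidean g"
  shows "continuous_map Y euclidean (\<lambda>x. f x * g x)"
proof -
  have "continuous_map Y (prod_topology euclidean euclidean) (\<lambda>x. (f x, g x))"
    using assms by (rule continuous_map_pairedI)
  then have pair: "continuous_map Y euclidean (\<lambda>x. (f x, g x))" by simp
  have "continuous_on UNIV (\<lambda>p::complex \<times> complex. fst p * snd p)"
    by (intro continuous_intros)
  then have "continuous_map euclidean euclidean (\<lambda>p::complex \<times> complex. fst p * snd p)" by simp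
  from continuous_map_compose[OF pair this] show ?thesis by (simp add: comp_def)
qed

lemma continuous_map_complex_prod:
  fixes f :: "'c \<Rightarrow> 'x \<Rightarrow> complex"
  assumes "\<And>i. i \<in> I \<Longrightarrow> continuous_map Y euclidean (f i)"
  shows "continuous_map Y euclidean (\<lambda>x. \<Prod>i\<in>I. f i x)"
  using assms
proof (induction I rule: infinite_finite_induct)
  case (insert i I)
  have "continuous_map Y euclidean (\<lambda>x. f i x * (\<Prod>i\<in>I. f i x))"
    using insert.prems insert.IH by (intro continuous_map_complex_mult) auto
  then show ?case using insert.hyps by simp
qed simp_all

lemma continuous_map_circle_power:
  assumes "continuous_map Y (top_of_set (sphere 0 1)) f"
  shows "continuous_map Y euclidean (\<lambda>x. f x powi k :: complex)"
proof -
  have "continuous_on (sphere 0 1) (\<lambda>z::complex. z powi k)"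
  proof (rule continuous_on_power_int)
    show "continuous_on (sphere 0 1) (\<lambda>z::complex. z)" by (rule continuous_on_id)
    show "0 \<le> k \<or> (\<forall>z\<in>sphere 0 1. (z::complex) \<noteq> 0)"
    proof (rule disjI2, rule ballI)
      fix z :: complex assume "z \<in> sphere 0 1"
      then have "norm z = 1" by (simp only: mem_sphere_0)
      then show "z \<noteq> 0" by force
    qed
  qed
  then have "continuous_map (top_of_set (sphere 0 1)) euclidean (\<lambda>z::complex. z powi k)"
    by (simp only: continuous_map_iff_continuous)
  from continuous_map_compose[OF assms this] show ?thesis by (simp only: comp_def)
qed

lemma continuous_map_torus_hom:
  assumes A: "A \<in> carrier_mat r k"
  shows "continuous_map (torus_topology k) (torus_topology r) (torus_hom A)"
  unfolding torus_topology_def[of r] continuous_map_componentwise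
proof (intro conjI ballI)
  have closed: "torus_hom A z \<in> carrier (torus r)" if "z \<in> topspace (torus_topology k)" for z
    using torus_hom_closed[OF A] that by (simp add: topspace_torus_topology)
  show "torus_hom A ` topspace (torus_topology k) \<subseteq> extensional {..<r}"
    using A by (auto simp: torus_hom_def)
  fix i assume i: "i \<in> {..<r}"
  have "continuous_map (torus_topology k) euclidean (\<lambda>z. \<Prod>j<k. z j powi (A $$ (i, j)))"
    unfolding torus_topology_def
    by (intro continuous_map_complex_prod continuous_map_circle_power continuous_map_product_projection)
  then have "continuous_map (torus_topology k) euclidean (\<lambda>z. torus_hom A z i)"
    using i by (simp add: torus_hom_index[OF A])
  then show "continuous_map (torus_topology k) (top_of_set (sphere 0 1)) (\<lambda>z. torus_hom A z i)"
    using torus_norm[OF closed] i by (intro continuous_map_into_subtopology) auto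
qed

text \<open>The first \<open>n\<close> coordinates are those on which the square block of the reduced matrix acts.\<close>

definition torus_join :: "nat \<Rightarrow> nat \<Rightarrow> (nat \<Rightarrow> complex) \<Rightarrow> (nat \<Rightarrow> complex) \<Rightarrow> nat \<Rightarrow> complex" where
  "torus_join n m x y = (\<lambda>j\<in>{..<m}. if j < n then x j else y (j - n))"

lemma torus_join_closed:
  assumes "x \<in> carrier (torus n)" "y \<in> carrier (torus (m - n))"
  shows "torus_join n m x y \<in> carrier (torus m)"
  unfolding torus_join_def using torus_norm[OF assms(1)] torus_norm[OF assms(2)]
  by (intro restrict_in_torus) auto

lemma torus_join_mult:
  assumes "n \<le> m"
  shows "torus_join n m (x \<otimes>\<^bsub>torus n\<^esub> x') (y \<otimes>\<^bsub>torus (m - n)\<^esub> y')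
     = torus_join n m x y \<otimes>\<^bsub>torus m\<^esub> torus_join n m x' y'"
  using assms by (auto simp: torus_join_def mult_torus fun_eq_iff)

lemma torus_join_inject:
  assumes "n \<le> m" "x \<in> carrier (torus n)" "x' \<in> carrier (torus n)"
    "y \<in> carrier (torus (m - n))" "y' \<in> carrier (torus (m - n))"
    and eq: "torus_join n m x y = torus_join n m x' y'"
  shows "x = x' \<and> y = y'"
proof
  have idx: "(if j < n then x j else y (j - n)) = (if j < n then x' j else y' (j - n))" if "j < m" for j
    using fun_cong[OF eq, of j] that by (simp add: torus_join_def)
  show "x = x'"
  proof (rule torus_eqI[OF assms(2,3)])
    fix i assume "i < n"
    then show "x i = x' i" using idx[of i] assms(1) by simp
  qed
  show "y = y'"
  proof (rule torus_eqI[OF assms(4,5)])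
    fix i assume "i < m - n"
    then show "y i = y' i" using idx[of "i + n"] by simp
  qed
qed

lemma torus_join_split:
  assumes "n \<le> m" "u \<in> carrier (torus m)"
  shows "torus_join n m (restrict u {..<n}) (\<lambda>j\<in>{..<m - n}. u (j + n)) = u"
proof (rule torus_eqI[OF _ assms(2)])
  show "torus_join n m (restrict u {..<n}) (\<lambda>j\<in>{..<m - n}. u (j + n)) \<in> carrier (torus m)"
    using assms(1) torus_norm[OF assms(2)] by (intro torus_join_closed restrict_in_torus) auto
  fix i assume "i < m"
  then show "torus_join n m (restrict u {..<n}) (\<lambda>j\<in>{..<m - n}. u (j + n)) i = u i"
    by (auto simp: torus_join_def)
qed

lemma torus_hom_group_hom:
  assumes "A \<in> carrier_mat r k"
  shows "group_hom (torus k) (torus r) (torus_hom A)"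
  using torus_hom_closed[OF assms] torus_hom_mult[OF assms]
  by (intro group_hom.intro group_hom_axioms.intro torus_group homI)

lemma torus_kernel_is_group:
  assumes "A \<in> carrier_mat r k"
  shows "group (torus_kernel_group A)"
proof -
  interpret group_hom "torus k" "torus r" "torus_hom A"
    by (rule torus_hom_group_hom[OF assms])
  have "subgroup (torus_kernel A) (torus k)"
    using subgroup_kernel assms unfolding torus_kernel_def by simp
  then show ?thesis
    using subgroup.subgroup_is_group[OF _ torus_group] assms
    unfolding torus_kernel_group_def by simp
qed

text \<open>Applying the adjugate to the equations of the kernel shows that every coordinate of a solution is
  a root of unity of order dividing the determinant.\<close>

lemma finite_torus_kernel:
  assumes H: "H \<in> carrier_mat n n" and det: "Determinant.det H \<noteq> 0"
  shows "finite (torus_kernel H)"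
proof (rule finite_subset)
  show "torus_kernel H \<subseteq> {z \<in> carrier (torus n). \<forall>j<n. z j powi Determinant.det H = 1}"
  proof
    fix z assume "z \<in> torus_kernel H"
    then have z: "z \<in> carrier (torus n)" and ker: "\<And>i. i < n \<Longrightarrow> (\<Prod>j<n. z j powi (H $$ (i, j))) = 1"
      unfolding mem_torus_kernel[OF H] by blast+
    have "z k powi Determinant.det H = 1" if k: "k < n" for k
    proof -
      have "1 = (\<Prod>i<n. (\<Prod>j<n. z j powi (H $$ (i, j))) powi (adj_mat H $$ (k, i)))"
        by (simp add: ker)
      also have "\<dots> = (\<Prod>j<n. z j powi (\<Sum>i<n. adj_mat H $$ (k, i) * H $$ (i, j)))"
        using torus_coord_nonzero[OF z] by (intro prod_power_int_swap) simp
      also have "\<dots> = (\<Prod>j<n. if j = k then z j powi Determinant.det H else 1)"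
      proof (intro prod.cong refl)
        fix j assume "j \<in> {..<n}"
        then have j: "j < n" by simp
        have "(\<Sum>i<n. adj_mat H $$ (k, i) * H $$ (i, j)) = (adj_mat H * H) $$ (k, j)"
          using adj_mat(1)[OF H] H j k by (simp add: scalar_prod_def atLeast0LessThan)
        also have "\<dots> = (if j = k then Determinant.det H else 0)"
          unfolding adj_mat(3)[OF H] using j k by simp
        finally show "z j powi (\<Sum>i<n. adj_mat H $$ (k, i) * H $$ (i, j))
            = (if j = k then z j powi Determinant.det H else 1)" by simp
      qed
      also have "\<dots> = z k powi Determinant.det H" using k by simp
      finally show ?thesis by simp
    qed
    then show "z \<in> {z \<in> carrier (torus n). \<forall>j<n. z j powi Determinant.det H = 1}" using z by simp
  qed
  show "finite {z \<in> carrier (torus n). \<forall>j<n. z j powi Determinant.det H = 1}"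
    by (rule finite_torus_torsion[OF det])
qed

text \<open>The finite factor in \<open>torus_times_finite\<close> has natural numbers as elements, so the kernel of
  the square block has to be renamed.\<close>

lemma finite_group_on_nat:
  assumes K: "group K" and fin: "finite (carrier K)"
  obtains F :: "nat monoid" and e where "group F" "finite (carrier F)" "e \<in> iso F K"
proof -
  interpret K: group K by fact
  obtain h where h: "bij_betw h (carrier K) {..<card (carrier K)}"
    using ex_bij_betw_finite_nat[OF fin] by (auto simp: atLeast0LessThan)
  define e where "e = the_inv_into (carrier K) h"
  have inj: "inj_on h (carrier K)" using h by (rule bij_betw_imp_inj_on)
  have he: "e (h x) = x" if "x \<in> carrier K" for x
    using the_inv_into_f_f[OF inj that] by (simp add: e_def)
  define F0 :: "nat monoid" where
    "F0 = \<lparr>carrier = {..<card (carrier K)}, mult = (\<lambda>a b. h (e a \<otimes>\<^bsub>K\<^esub> e b)), one = h \<one>\<^bsub>K\<^esub>\<rparr>"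
  have iso: "h \<in> iso K F0"
  proof (rule isoI)
    show "h \<in> hom K F0"
      using bij_betwE[OF h] he by (intro homI) (auto simp: F0_def)
    show "bij_betw h (carrier K) (carrier F0)" using h by (simp add: F0_def)
  qed
  have "group F0" using K.iso_imp_img_group[OF iso] by (simp add: F0_def)
  moreover have "finite (carrier F0)" by (simp add: F0_def)
  moreover have "inv_into (carrier K) h \<in> iso F0 K" by (rule K.iso_set_sym[OF iso])
  ultimately show thesis by (rule that)
qed

text \<open>The matrix \<open>P\<close> witnesses that \<open>A\<close> is onto over the rationals. A unimodular \<open>U\<close> brings
  \<open>A\<close> into the form \<open>(H | 0)\<close>, and \<open>P\<close> passes to a right inverse of \<open>H\<close> up to the
  factor \<open>d\<close>, so \<open>H\<close> is nonsingular. The automorphism of the torus given by \<open>U\<close> carries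
  the product of the kernel of \<open>H\<close> and the last \<open>m - n\<close> coordinates onto the kernel of
  \<open>A\<close>. It is a homeomorphism because it is a continuous bijection from a compact space to a
  Hausdorff space.\<close>

lemma torus_kernel_splits:
  assumes A: "A \<in> carrier_mat n m" and nm: "n \<le> m"
    and P: "P \<in> carrier_mat m n" and AP: "A * P = d \<cdot>\<^sub>m 1\<^sub>m n" and d: "d \<noteq> 0"
  shows "torus_times_finite (m - n) (torus_kernel_group A) (torus_kernel_topology A)"
proof -
  obtain U W where U: "U \<in> carrier_mat m m" and W: "W \<in> carrier_mat m m"
    and UW: "U * W = 1\<^sub>m m" and WU: "W * U = 1\<^sub>m m"
    and zero: "\<And>i j. i < n \<Longrightarrow> n \<le> j \<Longrightarrow> j < m \<Longrightarrow> (A * U) $$ (i, j) = 0"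
    by (rule column_reduction[OF A]) (rule that)
  have AU: "A * U \<in> carrier_mat n m" using A U by (rule mult_carrier_mat)
  have WP: "W * P \<in> carrier_mat m n" using W P by (rule mult_carrier_mat)
  define H where "H = Matrix.mat n n (\<lambda>(i, j). (A * U) $$ (i, j))"
  define Q where "Q = Matrix.mat n n (\<lambda>(i, j). (W * P) $$ (i, j))"
  have H: "H \<in> carrier_mat n n" and Q: "Q \<in> carrier_mat n n" by (simp_all add: H_def Q_def)
  have "H * Q = (A * U) * (W * P)"
  proof (rule eq_matI)
    fix i j assume "i < dim_row ((A * U) * (W * P))" "j < dim_col ((A * U) * (W * P))"
    then have ij: "i < n" "j < n" using AU WP by auto
    have "(H * Q) $$ (i, j) = (\<Sum>k<n. (A * U) $$ (i, k) * (W * P) $$ (k, j))"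
    proof -
      have "(H * Q) $$ (i, j) = (\<Sum>k<n. H $$ (i, k) * Q $$ (k, j))"
        using H Q ij by (simp add: scalar_prod_def atLeast0LessThan)
      also have "\<dots> = (\<Sum>k<n. (A * U) $$ (i, k) * (W * P) $$ (k, j))"
        using ij by (intro sum.cong refl) (simp add: H_def Q_def)
      finally show ?thesis .
    qed
    also have "\<dots> = (\<Sum>k<m. (A * U) $$ (i, k) * (W * P) $$ (k, j))"
      using nm zero ij by (intro sum.mono_neutral_left) auto
    also have "\<dots> = ((A * U) * (W * P)) $$ (i, j)"
    proof -
      have "((A * U) * (W * P)) $$ (i, j) = row (A * U) i \<bullet> col (W * P) j"
        using AU WP ij by (intro index_mult_mat) auto
      also have "\<dots> = (\<Sum>k<m. row (A * U) i $ k * col (W * P) j $ k)"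
        using WP W by (simp add: scalar_prod_def atLeast0LessThan del: row_mult col_mult2)
      also have "\<dots> = (\<Sum>k<m. (A * U) $$ (i, k) * (W * P) $$ (k, j))"
        using AU WP ij by (intro sum.cong refl arg_cong2[of _ _ _ _ "(*)"] index_row index_col) auto
      finally show ?thesis by simp
    qed
    finally show "(H * Q) $$ (i, j) = ((A * U) * (W * P)) $$ (i, j)" .
  qed (use H Q AU WP in auto)
  also have "\<dots> = A * ((U * W) * P)"
    unfolding assoc_mult_mat[OF A U WP] assoc_mult_mat[OF U W P] ..
  also have "\<dots> = d \<cdot>\<^sub>m 1\<^sub>m n" using AP P UW by simp
  finally have HQ: "H * Q = d \<cdot>\<^sub>m 1\<^sub>m n" .
  have "Determinant.det H * Determinant.det Q = d ^ n"
    using det_mult[OF H Q] unfolding HQ by simp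
  then have "Determinant.det H \<noteq> 0" using d by auto
  then have finH: "finite (torus_kernel H)" by (rule finite_torus_kernel[OF H])
  have "carrier (torus_kernel_group H) = torus_kernel H"
    by (simp add: torus_kernel_group_def)
  then obtain F :: "nat monoid" and e where F: "group F" "finite (carrier F)"
    and e: "e \<in> iso F (torus_kernel_group H)"
    using finite_group_on_nat[OF torus_kernel_is_group[OF H]] finH by metis
  have eK: "bij_betw e (carrier F) (torus_kernel H)"
    using e by (simp add: iso_def torus_kernel_group_def)
  have eT: "e a \<in> carrier (torus n)" if "a \<in> carrier F" for a
    using bij_betwE[OF eK] that by (auto simp: mem_torus_kernel[OF H])
  have emult: "e (a \<otimes>\<^bsub>F\<^esub> b) = e a \<otimes>\<^bsub>torus n\<^esub> e b" if "a \<in> carrier F" "b \<in> carrier F" for a b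
    using hom_mult[of e F "torus_kernel_group H" a b] e that H
    by (simp add: iso_def torus_kernel_group_def)
  let ?J = "\<lambda>p. torus_join n m (e (snd p)) (fst p)"
  let ?f = "\<lambda>p. torus_hom U (?J p)"
  let ?G = "torus (m - n) \<times>\<times> F"
  have J: "?J p \<in> carrier (torus m)" if "p \<in> carrier ?G" for p
    using that by (intro torus_join_closed eT) auto
  have kernel: "torus_hom U u \<in> torus_kernel A \<longleftrightarrow> restrict u {..<n} \<in> torus_kernel H"
    if u: "u \<in> carrier (torus m)" for u
  proof -
    have "(\<Prod>j<m. u j powi ((A * U) $$ (i, j))) = (\<Prod>j<n. restrict u {..<n} j powi (H $$ (i, j)))"
      if i: "i < n" for i
    proof -
      have "(\<Prod>j<m. u j powi ((A * U) $$ (i, j))) = (\<Prod>j<n. u j powi ((A * U) $$ (i, j)))"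
        using nm zero i by (intro prod.mono_neutral_right) auto
      then show ?thesis using i by (simp add: H_def)
    qed
    moreover have "torus_hom A (torus_hom U u) i = (\<Prod>j<m. u j powi ((A * U) $$ (i, j)))"
      if i: "i < n" for i
      unfolding torus_hom_compose[OF A U u, symmetric] by (rule torus_hom_index[OF AU i])
    moreover have "restrict u {..<n} \<in> carrier (torus n)"
      using torus_norm[OF u] nm by (intro restrict_in_torus) simp
    moreover have "torus_hom U u \<in> carrier (torus m)" by (rule torus_hom_closed[OF U u])
    ultimately show ?thesis
      unfolding mem_torus_kernel[OF A] mem_torus_kernel[OF H]
      using torus_hom_index[OF A, of _ "torus_hom U u"] by simp
  qed
  have restrict_J: "restrict (?J p) {..<n} = e (snd p)" if p: "p \<in> carrier ?G" for p
  proof (rule torus_eqI)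
    show "restrict (?J p) {..<n} \<in> carrier (torus n)"
      using torus_norm[OF J[OF p]] nm by (intro restrict_in_torus) simp
    show "e (snd p) \<in> carrier (torus n)" using p by (intro eT) auto
    fix i assume "i < n"
    then show "restrict (?J p) {..<n} i = e (snd p) i" using nm by (simp add: torus_join_def)
  qed
  have fK: "?f p \<in> torus_kernel A" if p: "p \<in> carrier ?G" for p
    unfolding kernel[OF J[OF p]] restrict_J[OF p] using bij_betwE[OF eK] p by auto
  have image: "?f ` carrier ?G = torus_kernel A"
  proof (intro equalityI subsetI)
    fix z assume "z \<in> ?f ` carrier ?G"
    then show "z \<in> torus_kernel A" using fK by blast
  next
    fix z assume zK: "z \<in> torus_kernel A"
    then have z: "z \<in> carrier (torus m)" by (simp add: mem_torus_kernel[OF A])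
    define u where "u = torus_hom W z"
    have u: "u \<in> carrier (torus m)" unfolding u_def by (rule torus_hom_closed[OF W z])
    have Uu: "torus_hom U u = z"
      unfolding u_def torus_hom_compose[OF U W z, symmetric] UW by (rule torus_hom_one[OF z])
    have "restrict u {..<n} \<in> torus_kernel H" using kernel[OF u] zK unfolding Uu by simp
    then obtain a where a: "a \<in> carrier F" "e a = restrict u {..<n}"
      using eK unfolding bij_betw_def by (metis imageE)
    let ?y = "\<lambda>j\<in>{..<m - n}. u (j + n)"
    have "?y \<in> carrier (torus (m - n))"
      using torus_norm[OF u] by (intro restrict_in_torus) simp
    then have mem: "(?y, a) \<in> carrier ?G" using a by simp
    have fz: "?f (?y, a) = z"
      using torus_join_split[OF nm u] Uu a(2) by simp
    show "z \<in> ?f ` carrier ?G" using imageI[OF mem, of ?f] unfolding fz .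
  qed
  have inj: "inj_on ?f (carrier ?G)"
  proof (rule inj_onI)
    fix p q assume p: "p \<in> carrier ?G" and q: "q \<in> carrier ?G" and eq: "?f p = ?f q"
    have "?J p = torus_hom (W * U) (?J p)" unfolding WU by (rule torus_hom_one[OF J[OF p], symmetric])
    also have "\<dots> = torus_hom (W * U) (?J q)"
      unfolding torus_hom_compose[OF W U J[OF p]] torus_hom_compose[OF W U J[OF q]] eq ..
    also have "\<dots> = ?J q" unfolding WU by (rule torus_hom_one[OF J[OF q]])
    finally have "?J p = ?J q" .
    then have "e (snd p) = e (snd q) \<and> fst p = fst q"
      using p q by (intro torus_join_inject[OF nm]) (auto intro: eT)
    moreover have "snd p \<in> carrier F" "snd q \<in> carrier F" using p q by auto
    ultimately show "p = q"
      using inj_onD[OF bij_betw_imp_inj_on[OF eK]] by (simp add: prod_eq_iff)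
  qed
  have iso: "?f \<in> iso ?G (torus_kernel_group A)"
  proof (rule isoI)
    show "?f \<in> hom ?G (torus_kernel_group A)"
    proof (rule homI)
      fix p q assume p: "p \<in> carrier ?G" and q: "q \<in> carrier ?G"
      have "snd p \<in> carrier F" "snd q \<in> carrier F" using p q by auto
      then have "?J (p \<otimes>\<^bsub>?G\<^esub> q) = ?J p \<otimes>\<^bsub>torus m\<^esub> ?J q"
        by (simp add: mult_DirProd' emult torus_join_mult[OF nm])
      then show "?f (p \<otimes>\<^bsub>?G\<^esub> q) = ?f p \<otimes>\<^bsub>torus_kernel_group A\<^esub> ?f q"
        using torus_hom_mult[OF U J[OF p] J[OF q]] A by (simp add: torus_kernel_group_def)
    qed (use fK in \<open>simp add: torus_kernel_group_def\<close>)
    show "bij_betw ?f (carrier ?G) (carrier (torus_kernel_group A))"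
      using inj image by (simp add: bij_betw_def torus_kernel_group_def)
  qed
  let ?X = "prod_topology (torus_topology (m - n)) (discrete_topology (carrier F))"
  have topX: "topspace ?X = carrier ?G" by (simp add: topspace_torus_topology)
  have contJ: "continuous_map ?X (torus_topology m) ?J"
    unfolding torus_topology_def[of m] continuous_map_componentwise
  proof (intro conjI ballI)
    show "?J ` topspace ?X \<subseteq> extensional {..<m}" by (auto simp: torus_join_def)
    fix j assume j: "j \<in> {..<m}"
    show "continuous_map ?X (top_of_set (sphere 0 1)) (\<lambda>p. ?J p j)"
    proof (cases "j < n")
      case True
      have "continuous_map (discrete_topology (carrier F)) (top_of_set (sphere 0 1)) (\<lambda>a. e a j)"
        using torus_norm[OF eT True] by auto
      from continuous_map_compose[OF continuous_map_snd this, of "torus_topology (m - n)"]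
      show ?thesis using True j by (simp add: comp_def torus_join_def)
    next
      case False
      have "continuous_map (torus_topology (m - n)) (top_of_set (sphere 0 1)) (\<lambda>y. y (j - n))"
        unfolding torus_topology_def using False j by (intro continuous_map_product_projection) auto
      from continuous_map_compose[OF continuous_map_fst this, of "discrete_topology (carrier F)"]
      show ?thesis using False j by (simp add: comp_def torus_join_def)
    qed
  qed
  have "continuous_map ?X (torus_topology m) ?f"
    using continuous_map_compose[OF contJ continuous_map_torus_hom[OF U]] by (simp add: comp_def)
  then have cont: "continuous_map ?X (torus_kernel_topology A) ?f"
    using A fK topX unfolding torus_kernel_topology_def
    by (intro continuous_map_into_subtopology) auto
  have "compact_space (torus_topology k)" for k
    unfolding torus_topology_def compact_space_product_topology
    by (intro disjI2 ballI compact_space_subtopology) simp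
  then have "compact_space ?X"
    using F(2) by (simp add: compact_space_prod_topology compact_space_discrete_topology)
  moreover have "Hausdorff_space (torus_kernel_topology A)"
    unfolding torus_kernel_topology_def torus_topology_def
    by (intro Hausdorff_space_subtopology) (simp add: Hausdorff_space_product_topology Hausdorff_space_subtopology)
  moreover have "topspace (torus_kernel_topology A) = torus_kernel A"
    using A by (auto simp: torus_kernel_topology_def topspace_torus_topology mem_torus_kernel[OF A])
  ultimately have "homeomorphic_map ?X (torus_kernel_topology A) ?f"
    using cont image inj topX by (intro continuous_imp_homeomorphic_map) auto
  then have "top_group_isomorphic ?G ?X (torus_kernel_group A) (torus_kernel_topology A)"
    using iso unfolding top_group_isomorphic_def by blast
  then show ?thesis unfolding torus_times_finite_def using F by blast
qed

lemma (in numbered_simplicial_poset) torus_kernel_splits_of_independent: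
  assumes \<Lambda>: "\<Lambda> \<in> carrier_mat n m" and n: "n = poset_rank TYPE('a)"
    and ind: "\<And>\<sigma>. columns_independent \<Lambda> (V \<sigma>)"
  shows "torus_times_finite (m - n) (torus_kernel_group \<Lambda>) (torus_kernel_topology \<Lambda>)"
proof -
  obtain \<sigma> :: 'a where "face_rank \<sigma> = n"
    using facet_of_full_rank unfolding n by blast
  then have \<sigma>: "card (V \<sigma>) = n" by (simp add: card_V)
  obtain d N where d: "d \<noteq> 0"
    and N: "\<And>i l. i < n \<Longrightarrow> l < n \<Longrightarrow> (\<Sum>j\<in>V \<sigma>. \<Lambda> $$ (i, j) * N j l) = (if i = l then d else 0)"
    by (rule independent_right_inverse[OF \<Lambda> V_subset ind \<sigma>]) (rule that)
  define P where "P = Matrix.mat m n (\<lambda>(j, l). if j \<in> V \<sigma> then N j l else 0)"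
  have P: "P \<in> carrier_mat m n" by (simp add: P_def)
  have "\<Lambda> * P = d \<cdot>\<^sub>m 1\<^sub>m n"
  proof (rule eq_matI)
    fix i l assume "i < dim_row (d \<cdot>\<^sub>m 1\<^sub>m n)" "l < dim_col (d \<cdot>\<^sub>m 1\<^sub>m n)"
    then have il: "i < n" "l < n" by simp_all
    have "(\<Lambda> * P) $$ (i, l) = (\<Sum>j<m. \<Lambda> $$ (i, j) * (if j \<in> V \<sigma> then N j l else 0))"
      using \<Lambda> il by (simp add: P_def scalar_prod_def atLeast0LessThan)
    also have "\<dots> = (\<Sum>j\<in>V \<sigma>. \<Lambda> $$ (i, j) * (if j \<in> V \<sigma> then N j l else 0))"
      using V_subset by (intro sum.mono_neutral_right) auto
    also have "\<dots> = (if i = l then d else 0)" using N[OF il] by simp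
    finally show "(\<Lambda> * P) $$ (i, l) = (d \<cdot>\<^sub>m 1\<^sub>m n) $$ (i, l)" using il by simp
  qed (use \<Lambda> P in auto)
  moreover have "n \<le> m" unfolding n by (rule poset_rank_le_vertices)
  ultimately show ?thesis using torus_kernel_splits[OF \<Lambda> _ P _ d] by blast
qed

section \<open>Lsops, ranks and almost free torus actions\<close>

theorem theorem4p2:
  fixes vert :: "nat \<Rightarrow> 'a::{finite,order_bot}"
    and \<Lambda> :: "int mat"
    and m n :: nat
  assumes "simplicial_poset TYPE('a)"
    and "n = poset_rank TYPE('a)"
    and "vertex_numbering m vert"
    and "\<Lambda> \<in> carrier_mat n m"
  shows "(lsop n (linear_element vert \<Lambda> :: nat \<Rightarrow> ('a, rat) mpoly set)
            \<longleftrightarrow> (\<forall>\<sigma>. vec_space.rank n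
                    (map_mat rat_of_int (submatrix \<Lambda> UNIV (vertices_of m vert \<sigma>))) = face_rank \<sigma>))
       \<and> ((\<forall>\<sigma>. vec_space.rank n
                    (map_mat rat_of_int (submatrix \<Lambda> UNIV (vertices_of m vert \<sigma>))) = face_rank \<sigma>)
            \<longleftrightarrow> torus_times_finite (m - n) (torus_kernel_group \<Lambda>) (torus_kernel_topology \<Lambda>)
                \<and> almost_free (torus_kernel_group \<Lambda>)
                    (topspace (moment_angle_complex m vert)) (torus_action m vert))"
proof -
  interpret weighted_simplicial_poset m vert \<Lambda> n
    by unfold_locales (fact assms)+
  have rank: "vec_space.rank n (map_mat rat_of_int (submatrix \<Lambda> UNIV (V \<sigma>))) = face_rank \<sigma>
      \<longleftrightarrow> columns_independent \<Lambda> (V \<sigma>)" for \<sigma>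
    using rank_submatrix_eq_card_iff[OF assms(4) V_subset[of \<sigma>]] unfolding card_V .
  show ?thesis
    unfolding rank
    using lsop_iff_independent almost_free_iff_independent[OF assms(4)]
      torus_kernel_splits_of_independent[OF assms(4,2)] by blast
qed

end
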